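(* Let $(p,\rho)$ be a modular embedding with domain $\Gamma=\mathrm{dom}(\rho)$ such that $p$ is non-constant and $\rho$ has a nontrivial kernel. Then $\Gamma$ is a subgroup of finite index in $\mathrm{Comm}(p,\rho)$.
   Context: Let $G=\mathrm{PSL}_2(\mathbb{R})$, acting on the upper half-plane $\mathbb{H}$. A modular embedding (of rank $2$ and weight $1$) is a pair $(p,\rho)$, where $\rho:\Gamma\to G$ is a group homomorphism from a lattice $\Gamma\leqslant G$ and $p:\mathbb{H}\to\mathbb{H}$ is a $\rho$-equivariant holomorphic map, i.e. $p(\gamma z)=\rho(\gamma)p(z)$ for all $\gamma\in\Gamma$, $z\in\mathbb{H}$; write $\mathrm{dom}(\rho)=\Gamma$. Two modular embeddings $(p_1,\rho_1)$, $(p_2,\rho_2)$ are commensurable if there exists $\Gamma'\leqslant G$ that is a subgroup of finite index in both $\mathrm{dom}(\rho_1)$ and $\mathrm{dom}(\rho_2)$ such that $\rho_1=\rho_2$ on $\Gamma'$. For $(g,h)\in G\times G$ put $$g(p,\rho)h^{-1}:=(g\circ p\circ h^{-1},\,c_g\circ\rho\circ c_{h^{-1}}),$$ where $c_g(\tilde g)=g\tilde gg^{-1}$ (the domain of the new homomorphism being $h\,\mathrm{dom}(\rho)h^{-1}$). The commensurator of $(p,\rho)$ is the group $$\mathrm{Comm}(p,\rho):=\{(g,h)\in G\times G\mid (p,\rho)\text{ and }g(p,\rho)h^{-1}\text{ are commensurable}\}.$$ The group $\Gamma$ is regarded as a subgroup of $\mathrm{Comm}(p,\rho)$ via $\gamma\mapsto(\rho(\gamma),\gamma)$.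 (If $p$ is non-constant, the projection $(g,h)\mapsto h$ is injective on $\mathrm{Comm}(p,\rho)$, so that $\Gamma\leqslant\mathrm{Comm}(p,\rho)$ may be regarded as subgroups of $G$.) *)

theory Defs
  imports "HOL-Complex_Analysis.Complex_Analysis" "HOL-Algebra.Algebra"
begin

section \<open>The group \<open>PSL\<^sub>2(\<real>)\<close>\<close>

definition SL2R :: "(real^2^2) monoid" where
  "SL2R = \<lparr>carrier = {A. det A = 1}, mult = (**), one = mat 1\<rparr>"

text \<open>An element of \<open>PSL2R\<close> is a two-element set \<open>{A, - A}\<close>.\<close>

type_synonym psl2 = "(real^2^2) set"

definition PSL2R :: "psl2 monoid" where
  "PSL2R = SL2R Mod {mat 1, - mat 1}"

definition psl2_proj :: "real^2^2 \<Rightarrow> psl2" where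
  "psl2_proj A = {mat 1, - mat 1} #>\<^bsub>SL2R\<^esub> A"

lemma group_SL2R: "group SL2R"
proof (rule groupI)
  fix A assume A: "A \<in> carrier SL2R"
  then have "invertible A"
    by (simp add: SL2R_def invertible_det_nz)
  then have "matrix_inv A ** A = mat 1"
    unfolding matrix_inv_def invertible_def by (rule someI2_ex) simp
  moreover from this have "det (matrix_inv A) * det A = 1"
    by (simp flip: det_mul)
  then have "det (matrix_inv A) = 1"
    using A by (simp add: SL2R_def)
  ultimately show "\<exists>B\<in>carrier SL2R. B \<otimes>\<^bsub>SL2R\<^esub> A = \<one>\<^bsub>SL2R\<^esub>"
    by (auto simp: SL2R_def)
qed (auto simp: SL2R_def det_mul matrix_mul_assoc)

lemma uminus_matrix_mult:
  fixes A B :: "real^2^2"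
  shows "(- A) ** B = - (A ** B)" "A ** (- B) = - (A ** B)"
  by (simp_all add: matrix_matrix_mult_def vec_eq_iff sum_negf)

lemma det_uminus_2: "det (- A :: real^2^2) = det A"
  by (simp add: det_2)

lemma psl2_proj_eq: "psl2_proj A = {A, - A}"
  by (auto simp: psl2_proj_def r_coset_def SL2R_def uminus_matrix_mult)

lemma normal_centre_SL2R: "{mat 1, - mat 1} \<lhd> SL2R"
proof -
  interpret group SL2R by (rule group_SL2R)
  have inv_neg: "inv\<^bsub>SL2R\<^esub> (- mat 1) = - mat 1"
    by (rule inv_equality) (auto simp: SL2R_def uminus_matrix_mult det_uminus_2)
  have inv_one': "inv\<^bsub>SL2R\<^esub> (mat 1) = mat 1"
    using inv_one by (simp add: SL2R_def)
  have "subgroup {mat 1, - mat 1} SL2R"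
    by (rule subgroupI)
      (auto simp: inv_neg inv_one', auto simp: SL2R_def uminus_matrix_mult det_uminus_2)
  then show ?thesis
    by (rule normalI) (auto simp: r_coset_def l_coset_def SL2R_def uminus_matrix_mult)
qed

lemma group_PSL2R: "group PSL2R"
  unfolding PSL2R_def by (rule normal.factorgroup_is_group[OF normal_centre_SL2R])

lemma carrier_PSL2R: "carrier PSL2R = psl2_proj ` {A. det A = 1}"
  by (auto simp: PSL2R_def FactGroup_def RCOSETS_def psl2_proj_def SL2R_def)

lemma psl2_proj_hom: "psl2_proj \<in> hom SL2R PSL2R"
  using normal.r_coset_hom_Mod[OF normal_centre_SL2R]
  unfolding psl2_proj_def PSL2R_def by simp


section \<open>The action on the upper half-plane\<close>

definition upper_half_plane :: "complex set" where
  "upper_half_plane = {z. 0 < Im z}"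

definition sl2_act :: "real^2^2 \<Rightarrow> complex \<Rightarrow> complex" where
  "sl2_act A = moebius (of_real (A$1$1)) (of_real (A$1$2)) (of_real (A$2$1)) (of_real (A$2$2))"

definition psl2_act :: "psl2 \<Rightarrow> complex \<Rightarrow> complex" where
  "psl2_act g = sl2_act (SOME A. A \<in> g)"

lemma sl2_act_uminus: "sl2_act (- A) = sl2_act A"
proof
  fix z :: complex
  have neg: "of_real (- a) * z + of_real (- b) = - (of_real a * z + of_real b)" for a b
    by simp
  show "sl2_act (- A) z = sl2_act A z"
    unfolding sl2_act_def moebius_def vector_uminus_component neg
    by (simp only: minus_divide_divide)
qed

lemma psl2_act_proj: "psl2_act (psl2_proj A) = sl2_act A"
proof -
  have "(SOME B. B \<in> psl2_proj A) \<in> psl2_proj A"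
    by (rule someI[of _ A]) (simp add: psl2_proj_eq)
  then show ?thesis
    by (auto simp: psl2_act_def psl2_proj_eq sl2_act_uminus)
qed


section \<open>Lattices\<close>

text \<open>The quotient topology induced by \<open>psl2_proj\<close>, where \<open>SL\<^sub>2(\<real>)\<close> is a subspace of the
  Euclidean space of real matrices.\<close>

definition PSL2R_topology :: "psl2 topology" where
  "PSL2R_topology = topology (\<lambda>U. U \<subseteq> carrier PSL2R \<and>
     openin (top_of_set (carrier SL2R)) {A \<in> carrier SL2R. psl2_proj A \<in> U})"

lemma openin_PSL2R_topology:
  "openin PSL2R_topology U \<longleftrightarrow> U \<subseteq> carrier PSL2R \<and>
     openin (top_of_set (carrier SL2R)) {A \<in> carrier SL2R. psl2_proj A \<in> U}"
proof -
  have "istopology (\<lambda>U. U \<subseteq> carrier PSL2R \<and>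
     openin (top_of_set (carrier SL2R)) {A \<in> carrier SL2R. psl2_proj A \<in> U})" (is "istopology ?P")
    unfolding istopology_def
  proof (intro conjI allI impI)
    fix S T assume S: "?P S" and T: "?P T"
    have "{A \<in> carrier SL2R. psl2_proj A \<in> S \<inter> T} =
        {A \<in> carrier SL2R. psl2_proj A \<in> S} \<inter> {A \<in> carrier SL2R. psl2_proj A \<in> T}"
      by auto
    then show "openin (top_of_set (carrier SL2R)) {A \<in> carrier SL2R. psl2_proj A \<in> S \<inter> T}"
      using S T by (simp only: openin_Int)
  next
    fix K assume K: "\<forall>S\<in>K. ?P S"
    have "{A \<in> carrier SL2R. psl2_proj A \<in> \<Union>K} = (\<Union>S\<in>K. {A \<in> carrier SL2R. psl2_proj A \<in> S})"
      by auto
    moreover have "openin (top_of_set (carrier SL2R))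
        (\<Union>S\<in>K. {A \<in> carrier SL2R. psl2_proj A \<in> S})"
      by (rule openin_Union) (use K in blast)
    ultimately show "openin (top_of_set (carrier SL2R)) {A \<in> carrier SL2R. psl2_proj A \<in> \<Union>K}"
      by (simp only:)
  qed blast+
  then show ?thesis
    unfolding PSL2R_topology_def by (simp only: topology_inverse')
qed

lemma topspace_PSL2R_topology: "topspace PSL2R_topology = carrier PSL2R"
proof -
  have "{A \<in> carrier SL2R. psl2_proj A \<in> carrier PSL2R} = carrier SL2R"
    by (auto simp: carrier_PSL2R SL2R_def)
  then have "openin PSL2R_topology (carrier PSL2R)"
    by (simp add: openin_PSL2R_topology)
  then show ?thesis
    by (meson openin_PSL2R_topology openin_subset openin_topspace subset_antisym)
qed

definition haar_measure :: "psl2 measure \<Rightarrow> bool" where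
  "haar_measure \<mu> \<longleftrightarrow>
     space \<mu> = carrier PSL2R \<and>
     sets \<mu> = sigma_sets (carrier PSL2R) {U. openin PSL2R_topology U} \<and>
     emeasure \<mu> (carrier PSL2R) \<noteq> 0 \<and>
     (\<forall>K. compactin PSL2R_topology K \<longrightarrow> emeasure \<mu> K < \<infinity>) \<and>
     (\<forall>g\<in>carrier PSL2R. \<forall>E\<in>sets \<mu>. emeasure \<mu> (g <#\<^bsub>PSL2R\<^esub> E) = emeasure \<mu> E)"

text \<open>A discrete subgroup of finite covolume. The covolume is the measure of a strict Borel
  fundamental domain for the left action of \<open>\<Gamma>\<close>; such a domain always exists because
  \<open>\<Gamma>\<close> is discrete. As \<open>PSL2R\<close> is unimodular and Haar measure is unique up to scaling,
  finiteness does not depend on the choice of sides, measure or domain.\<close>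

definition lattice_PSL2R :: "psl2 set \<Rightarrow> bool" where
  "lattice_PSL2R \<Gamma> \<longleftrightarrow>
     subgroup \<Gamma> PSL2R \<and>
     subtopology PSL2R_topology \<Gamma> = discrete_topology \<Gamma> \<and>
     (\<exists>\<mu> F. haar_measure \<mu> \<and> F \<in> sets \<mu> \<and>
        (\<forall>g\<in>carrier PSL2R. \<exists>!f. f \<in> F \<and> f \<in> \<Gamma> #>\<^bsub>PSL2R\<^esub> g) \<and>
        emeasure \<mu> F < \<infinity>)"


section \<open>Modular embeddings, commensurability and commensurators\<close>

definition finite_index_subgroup :: "'a set \<Rightarrow> ('a, 'b) monoid_scheme \<Rightarrow> bool" where
  "finite_index_subgroup H G \<longleftrightarrow> group G \<and> subgroup H G \<and> finite (rcosets\<^bsub>G\<^esub> H)"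

text \<open>A pair \<open>(p, \<rho>)\<close> is encoded as the triple \<open>(p, \<rho>, \<Gamma>)\<close> with \<open>\<Gamma> = dom(\<rho>)\<close>, since HOL
  functions are total; values of \<open>\<rho>\<close> off \<open>\<Gamma>\<close> and of \<open>p\<close> off the upper half-plane
  are irrelevant.\<close>

type_synonym modular_triple = "(complex \<Rightarrow> complex) \<times> (psl2 \<Rightarrow> psl2) \<times> psl2 set"

fun modular_embedding :: "modular_triple \<Rightarrow> bool" where
  "modular_embedding (p, \<rho>, \<Gamma>) \<longleftrightarrow>
     lattice_PSL2R \<Gamma> \<and>
     \<rho> \<in> hom (PSL2R\<lparr>carrier := \<Gamma>\<rparr>) PSL2R \<and>
     p holomorphic_on upper_half_plane \<and>
     p ` upper_half_plane \<subseteq> upper_half_plane \<and>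
     (\<forall>\<gamma>\<in>\<Gamma>. \<forall>z\<in>upper_half_plane. p (psl2_act \<gamma> z) = psl2_act (\<rho> \<gamma>) (p z))"

fun commensurable :: "modular_triple \<Rightarrow> modular_triple \<Rightarrow> bool" where
  "commensurable (p\<^sub>1, \<rho>\<^sub>1, \<Gamma>\<^sub>1) (p\<^sub>2, \<rho>\<^sub>2, \<Gamma>\<^sub>2) \<longleftrightarrow>
     (\<exists>\<Gamma>'. subgroup \<Gamma>' PSL2R \<and>
        finite_index_subgroup \<Gamma>' (PSL2R\<lparr>carrier := \<Gamma>\<^sub>1\<rparr>) \<and>
        finite_index_subgroup \<Gamma>' (PSL2R\<lparr>carrier := \<Gamma>\<^sub>2\<rparr>) \<and>
        (\<forall>\<gamma>\<in>\<Gamma>'. \<rho>\<^sub>1 \<gamma> = \<rho>\<^sub>2 \<gamma>))"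

definition psl2_conj :: "psl2 \<Rightarrow> psl2 \<Rightarrow> psl2" where
  "psl2_conj g x = g \<otimes>\<^bsub>PSL2R\<^esub> x \<otimes>\<^bsub>PSL2R\<^esub> inv\<^bsub>PSL2R\<^esub> g"

text \<open>The triple \<open>g(p, \<rho>)h\<^sup>-\<^sup>1\<close>.\<close>

fun translate :: "psl2 \<Rightarrow> psl2 \<Rightarrow> modular_triple \<Rightarrow> modular_triple" where
  "translate g h (p, \<rho>, \<Gamma>) =
     (psl2_act g \<circ> p \<circ> psl2_act (inv\<^bsub>PSL2R\<^esub> h),
      psl2_conj g \<circ> \<rho> \<circ> psl2_conj (inv\<^bsub>PSL2R\<^esub> h),
      psl2_conj h ` \<Gamma>)"

definition Comm :: "modular_triple \<Rightarrow> (psl2 \<times> psl2) monoid" where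
  "Comm m = (PSL2R \<times>\<times> PSL2R)\<lparr>carrier :=
     {(g, h). g \<in> carrier PSL2R \<and> h \<in> carrier PSL2R \<and> commensurable m (translate g h m)}\<rparr>"

end

theory Submission
  imports Defs
begin

text \<open>
  The commensurator acts on the half-plane through its second factor, and everything rests on one
  rigidity statement (\<open>overlap_rigidity\<close>): if \<open>p\<close>, \<open>q\<close> are holomorphic self-maps of the half-plane, \<open>p\<close> is
  not constant and the hyperbolic distance of \<open>p z\<close> and \<open>q z\<close> is invariant under a lattice, then
  \<open>p = q\<close>. The reason is that \<open>1 / cosh (d(p z, q z) / 2)\<close>, called the overlap of \<open>p z\<close> and \<open>q z\<close>, is a bounded
  superharmonic function. It is so because near each point where \<open>p\<close> and \<open>q\<close> differ it lies below
  the real part of a holomorphic function with which it agrees at that point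
  (\<open>right_half_plane_overlap_le\<close>, \<open>holomorphic_majorant\<close>). On a quotient of finite volume the mean over
  discs preserves integrals (\<open>symmetric_kernel_integral\<close>), so a bounded superharmonic function must
  satisfy the mean value property almost everywhere; then the overlap equals its majorant near some
  point with \<open>p z \<noteq> q z\<close>, which forces \<open>p\<close> to be constant.

  If \<open>(g, h)\<close> belongs to the commensurator, then \<open>p\<close> and \<open>g p h\<^sup>-\<^sup>1\<close> are equivariant for the same
  homomorphism on a subgroup of finite index, which is again a lattice. Rigidity gives
  \<open>p (h z) = g (p z)\<close> (\<open>Comm_equivariant\<close>), and \<open>h\<close> determines \<open>g\<close>.

  The nontrivial kernel makes the second projection of the commensurator discrete
  (\<open>Comm_snd_discrete\<close>). If \<open>h\<^sub>n\<close> tends to \<open>1\<close> and \<open>\<kappa>\<close> lies in the kernel, the commutators of \<open>h\<^sub>n\<close> and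
  \<open>\<kappa>\<close> preserve \<open>p\<close> and tend to \<open>1\<close>; as \<open>p\<close> has discrete fibres, they are eventually trivial. Were no
  \<open>h\<^sub>n\<close> trivial, all conjugates of \<open>\<kappa>\<close> in \<open>\<Gamma>\<close> would commute with \<open>\<kappa>\<close>, hence, \<open>\<Gamma>\<close> being discrete, be equal to
  \<open>\<kappa>\<close> or its inverse. Then the distance of \<open>z\<close> and \<open>\<kappa> z\<close> is \<open>\<Gamma>\<close>-invariant, and rigidity for the identity
  and \<open>\<kappa>\<close> gives \<open>\<kappa> = 1\<close>.

  Finally, a discrete group containing \<open>\<Gamma>\<close> contains it with finite index, because translates of a small
  open set by coset representatives have disjoint images of equal measure in a fundamental domain
  (\<open>card_disjoint_translates\<close>).
\<close>

no_notation fps_nth (infixl \<open>$\<close> 75)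

section \<open>The action of \<open>PSL\<^sub>2(\<real>)\<close> on the half-plane\<close>

interpretation PSL2R: group PSL2R
  by (rule group_PSL2R)

abbreviation (input) psl2_mult :: "psl2 \<Rightarrow> psl2 \<Rightarrow> psl2" (infixl \<open>\<star>\<close> 70) where
  "g \<star> h \<equiv> g \<otimes>\<^bsub>PSL2R\<^esub> h"

abbreviation (input) half_plane :: "complex set" (\<open>\<H>\<close>) where
  "\<H> \<equiv> upper_half_plane"

lemma PSL2R_representative:
  assumes "g \<in> carrier PSL2R"
  obtains A where "det A = 1" "g = psl2_proj A"
  using assms unfolding carrier_PSL2R by auto

lemma psl2_proj_carrier: "det A = 1 \<Longrightarrow> psl2_proj A \<in> carrier PSL2R"
  unfolding carrier_PSL2R by auto

lemma psl2_proj_mult: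
  "det A = 1 \<Longrightarrow> det B = 1 \<Longrightarrow> psl2_proj A \<star> psl2_proj B = psl2_proj (A ** B)"
  using hom_mult[OF psl2_proj_hom, of A B] by (simp add: SL2R_def)

lemma psl2_proj_one: "psl2_proj (mat 1) = \<one>\<^bsub>PSL2R\<^esub>"
  by (simp add: PSL2R_def psl2_proj_eq FactGroup_def)

lemma psl2_proj_inj_iff: "psl2_proj A = psl2_proj B \<longleftrightarrow> A = B \<or> A = - B"
  by (auto simp: psl2_proj_eq doubleton_eq_iff)

definition adj :: "real^2^2 \<Rightarrow> real^2^2" where
  "adj A = vector [vector [A$2$2, - A$1$2], vector [- A$2$1, A$1$1]]"

lemma adj_nth [simp]:
  "adj A $ 1 $ 1 = A$2$2" "adj A $ 1 $ 2 = - A$1$2" "adj A $ 2 $ 1 = - A$2$1" "adj A $ 2 $ 2 = A$1$1"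
  by (simp_all add: adj_def vector_2)

lemma matrix_2_eq_iff:
  "(A :: real^2^2) = B \<longleftrightarrow>
     A$1$1 = B$1$1 \<and> A$1$2 = B$1$2 \<and> A$2$1 = B$2$1 \<and> A$2$2 = B$2$2"
  by (auto simp: vec_eq_iff forall_2)

lemma matrix_2_mult_nth:
  fixes A B :: "real^2^2"
  shows "(A ** B) $ i $ j = A$i$1 * B$1$j + A$i$2 * B$2$j"
  by (simp add: matrix_matrix_mult_def sum_2)

lemma mat_2_nth: "(mat 1 :: real^2^2) $ 1 $ 1 = 1" "(mat 1 :: real^2^2) $ 1 $ 2 = 0"
  "(mat 1 :: real^2^2) $ 2 $ 1 = 0" "(mat 1 :: real^2^2) $ 2 $ 2 = 1"
  by (simp_all add: mat_def)

lemma det_adj: "det (adj A) = det A"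
  by (simp add: det_2)

lemma adj_mult: "det A = 1 \<Longrightarrow> adj A ** A = mat 1" "det A = 1 \<Longrightarrow> A ** adj A = mat 1"
  by (auto simp: matrix_2_eq_iff matrix_2_mult_nth mat_2_nth det_2 algebra_simps)

lemma psl2_proj_inv: "det A = 1 \<Longrightarrow> inv\<^bsub>PSL2R\<^esub> (psl2_proj A) = psl2_proj (adj A)"
  by (intro PSL2R.inv_equality)
    (simp_all add: psl2_proj_mult det_adj adj_mult psl2_proj_one psl2_proj_carrier)

lemma sl2_act_eq:
  "sl2_act A z = (of_real (A$1$1) * z + of_real (A$1$2)) / (of_real (A$2$1) * z + of_real (A$2$2))"
  by (simp add: sl2_act_def moebius_def)

abbreviation sl2_denom :: "real^2^2 \<Rightarrow> complex \<Rightarrow> complex" where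
  "sl2_denom A z \<equiv> of_real (A$2$1) * z + of_real (A$2$2)"

lemma sl2_denom_nonzero:
  assumes "det A = 1" "0 < Im z"
  shows "sl2_denom A z \<noteq> 0"
proof
  assume 0: "sl2_denom A z = 0"
  have "A$2$1 * Im z = 0" using arg_cong[OF 0, of Im] by simp
  with assms have "A$2$1 = 0" by simp
  with 0 have "A$2$2 = 0" by simp
  with \<open>A$2$1 = 0\<close> assms show False by (simp add: det_2)
qed

lemma sl2_act_diff_cnj:
  assumes "det A = 1" "0 < Im z" "0 < Im w"
  shows "sl2_act A z - cnj (sl2_act A w) = (z - cnj w) / (sl2_denom A z * cnj (sl2_denom A w))"
proof -
  let ?n = "\<lambda>z. of_real (A$1$1) * z + of_real (A$1$2)"
  have nz: "sl2_denom A z \<noteq> 0" "cnj (sl2_denom A w) \<noteq> 0"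
    using sl2_denom_nonzero[OF assms(1)] assms(2,3) by (simp_all only: complex_cnj_zero_iff not_False_eq_True)
  have d: "complex_of_real (A$1$1) * of_real (A$2$2) - of_real (A$1$2) * of_real (A$2$1) = 1"
    using arg_cong[OF assms(1), of complex_of_real] by (simp add: det_2)
  have "?n z * cnj (sl2_denom A w) - cnj (?n w) * sl2_denom A z
      = (complex_of_real (A$1$1) * of_real (A$2$2) - of_real (A$1$2) * of_real (A$2$1)) * (z - cnj w)"
    by (simp add: algebra_simps)
  then have "?n z * cnj (sl2_denom A w) - cnj (?n w) * sl2_denom A z = z - cnj w"
    using d by simp
  then show ?thesis
    unfolding sl2_act_eq complex_cnj_divide diff_frac_eq[OF nz] by simp
qed

lemma sl2_act_diff:
  assumes "det A = 1" "0 < Im z" "0 < Im w"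
  shows "sl2_act A z - sl2_act A w = (z - w) / (sl2_denom A z * sl2_denom A w)"
proof -
  let ?n = "\<lambda>z. of_real (A$1$1) * z + of_real (A$1$2)"
  have nz: "sl2_denom A z \<noteq> 0" "sl2_denom A w \<noteq> 0"
    using sl2_denom_nonzero[OF assms(1)] assms(2,3) by simp_all
  have d: "complex_of_real (A$1$1) * of_real (A$2$2) - of_real (A$1$2) * of_real (A$2$1) = 1"
    using arg_cong[OF assms(1), of complex_of_real] by (simp add: det_2)
  have "?n z * sl2_denom A w - ?n w * sl2_denom A z
      = (complex_of_real (A$1$1) * of_real (A$2$2) - of_real (A$1$2) * of_real (A$2$1)) * (z - w)"
    by (simp add: algebra_simps)
  then have "?n z * sl2_denom A w - ?n w * sl2_denom A z = z - w"
    using d by simp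
  then show ?thesis
    unfolding sl2_act_eq diff_frac_eq[OF nz] by simp
qed

lemma Im_sl2_act:
  assumes "det A = 1" "0 < Im z"
  shows "Im (sl2_act A z) = Im z / (cmod (sl2_denom A z))\<^sup>2"
proof -
  have "sl2_act A z - cnj (sl2_act A z) = (z - cnj z) / of_real ((cmod (sl2_denom A z))\<^sup>2)"
    unfolding complex_norm_square by (rule sl2_act_diff_cnj[OF assms assms(2)])
  then have "Im (sl2_act A z - cnj (sl2_act A z)) = Im (z - cnj z) / (cmod (sl2_denom A z))\<^sup>2"
    by (metis Im_divide_of_real)
  then show ?thesis by simp
qed

lemma sl2_act_mult:
  assumes "det A = 1" "det B = 1" "0 < Im z"
  shows "sl2_act (A ** B) z = sl2_act A (sl2_act B z)"
proof -
  have nz: "sl2_denom B z \<noteq> 0"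
    using sl2_denom_nonzero[OF assms(2,3)] .
  define w where "w = of_real (B$1$1) * z + of_real (B$1$2)"
  define v where "v = sl2_denom B z"
  have n: "of_real ((A ** B)$i$1) * z + of_real ((A ** B)$i$2) = of_real (A$i$1) * w + of_real (A$i$2) * v" for i
    by (simp add: w_def v_def matrix_2_mult_nth algebra_simps)
  have c: "sl2_act B z = w / v" by (simp add: sl2_act_eq w_def v_def)
  have "sl2_act (A ** B) z = ((of_real (A$1$1) * w + of_real (A$1$2) * v) / v) / ((of_real (A$2$1) * w + of_real (A$2$2) * v) / v)"
    using nz by (simp add: sl2_act_eq n v_def)
  also have "\<dots> = sl2_act A (w / v)"
    using nz by (simp add: sl2_act_eq add_divide_distrib v_def)
  finally show ?thesis by (simp add: c)
qed

lemma sl2_act_one: "sl2_act (mat 1) z = z"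
  by (simp add: sl2_act_eq mat_2_nth)

lemma sl2_act_upper: "det A = 1 \<Longrightarrow> 0 < Im z \<Longrightarrow> 0 < Im (sl2_act A z)"
  using sl2_denom_nonzero by (simp add: Im_sl2_act)

lemma upper_half_plane_iff: "z \<in> \<H> \<longleftrightarrow> 0 < Im z"
  by (simp add: upper_half_plane_def)

lemma ii_upper: "\<i> \<in> \<H>"
  by (simp add: upper_half_plane_iff)

lemma open_upper_half_plane: "open \<H>"
  unfolding upper_half_plane_def by (rule open_halfspace_Im_gt)

lemma connected_upper_half_plane: "connected \<H>"
  unfolding upper_half_plane_def by (intro convex_connected convex_halfspace_Im_gt)

lemma psl2_act_upper:
  "g \<in> carrier PSL2R \<Longrightarrow> z \<in> \<H> \<Longrightarrow> psl2_act g z \<in> \<H>"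
  by (auto simp: upper_half_plane_iff psl2_act_proj sl2_act_upper elim!: PSL2R_representative)

lemma psl2_act_mult:
  assumes "g \<in> carrier PSL2R" "h \<in> carrier PSL2R" "z \<in> \<H>"
  shows "psl2_act (g \<star> h) z = psl2_act g (psl2_act h z)"
  using assms by (auto simp: upper_half_plane_iff psl2_act_proj psl2_proj_mult sl2_act_mult
      elim!: PSL2R_representative)

lemma psl2_act_one [simp]: "psl2_act \<one>\<^bsub>PSL2R\<^esub> z = z"
  by (simp add: psl2_act_proj sl2_act_one flip: psl2_proj_one)

lemma psl2_act_inv:
  assumes "g \<in> carrier PSL2R" "z \<in> \<H>"
  shows "psl2_act (inv\<^bsub>PSL2R\<^esub> g) (psl2_act g z) = z" "psl2_act g (psl2_act (inv\<^bsub>PSL2R\<^esub> g) z) = z"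
  using assms by (simp_all flip: psl2_act_mult)

lemma psl2_act_holomorphic:
  assumes "g \<in> carrier PSL2R"
  shows "psl2_act g holomorphic_on \<H>"
proof -
  obtain A where A: "det A = 1" "g = psl2_proj A" using assms by (rule PSL2R_representative)
  have "sl2_act A holomorphic_on \<H>"
    unfolding sl2_act_eq using sl2_denom_nonzero[OF A(1)]
    by (intro holomorphic_intros) (auto simp: upper_half_plane_iff)
  then show ?thesis by (simp add: A psl2_act_proj)
qed

lemma psl2_act_transitive:
  assumes "z \<in> \<H>"
  obtains g where "g \<in> carrier PSL2R" "psl2_act g \<i> = z"
proof -
  define s where "s = sqrt (Im z)"
  have s: "s > 0" "s * s = Im z" using assms by (auto simp: s_def upper_half_plane_iff)
  define A :: "real^2^2" where "A = vector [vector [s, Re z / s], vector [0, 1 / s]]"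
  have "det A = 1" using s by (simp add: A_def det_2 vector_2)
  moreover have "sl2_act A \<i> = z"
  proof -
    have "sl2_act A \<i> = (of_real s * \<i> + of_real (Re z / s)) * of_real s"
      using s(1) by (simp add: sl2_act_eq A_def vector_2)
    also have "\<dots> = of_real (s * s) * \<i> + of_real (Re z / s * s)"
      by (simp add: algebra_simps)
    also have "\<dots> = z" using s by (simp add: complex_eq_iff)
    finally show ?thesis .
  qed
  ultimately show ?thesis
    using that[of "psl2_proj A"] by (simp add: psl2_proj_carrier psl2_act_proj)
qed

text \<open>The equation \<open>A z = z\<close> is a real quadratic equation, so a second fixed point in the half-plane
  gives it, together with the conjugates, four roots.\<close>

lemma sl2_act_two_fixed_points:
  assumes A: "det A = 1" and z: "0 < Im z" "0 < Im w" "z \<noteq> w"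
    and fp: "sl2_act A z = z" "sl2_act A w = w"
  shows "A = mat 1 \<or> A = - mat 1"
proof -
  let ?a = "A$1$1" and ?b = "A$1$2" and ?c = "A$2$1" and ?d = "A$2$2"
  have eq: "?c * (Re u * Re u - Im u * Im u) + (?d - ?a) * Re u = ?b \<and> 2 * ?c * Re u + ?d - ?a = 0"
    if "sl2_act A u = u" "0 < Im u" for u
  proof -
    have "of_real ?a * u + of_real ?b = u * sl2_denom A u"
      using that sl2_denom_nonzero[OF A that(2)] by (simp add: sl2_act_eq divide_eq_eq)
    from arg_cong[OF this, of Re] arg_cong[OF this, of Im]
    have "?a * Re u + ?b = Re u * (?c * Re u + ?d) - Im u * (?c * Im u)"
      "Im u * ?a = Im u * (2 * ?c * Re u + ?d)"
      by (auto simp: algebra_simps)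
    with that(2) have "?a * Re u + ?b = Re u * (?c * Re u + ?d) - Im u * (?c * Im u)"
      "?a = 2 * ?c * Re u + ?d"
      by simp_all
    then show ?thesis by (simp add: algebra_simps)
  qed
  have 1: "?c * (Re z * Re z - Im z * Im z) + (?d - ?a) * Re z = ?b" "2 * ?c * Re z + ?d - ?a = 0"
    "?c * (Re w * Re w - Im w * Im w) + (?d - ?a) * Re w = ?b" "2 * ?c * Re w + ?d - ?a = 0"
    using eq fp z by blast+
  have "?c = 0"
  proof (rule ccontr)
    assume c: "?c \<noteq> 0"
    from 1(2,4) have "2 * ?c * Re z = 2 * ?c * Re w" by linarith
    then have R: "Re z = Re w" using c by simp
    have "?c * (Im z * Im z) = ?c * (Im w * Im w)" using 1(1,3) R by (simp add: algebra_simps)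
    then have "Im z * Im z = Im w * Im w" using c by simp
    then have "Im z = Im w" using z(1,2) by (simp add: square_eq_iff)
    then show False using R z(3) by (simp add: complex_eq_iff)
  qed
  moreover from this 1 have "?d = ?a" "?b = 0" by simp_all
  moreover from this have "?a * ?a = 1" using A \<open>?c = 0\<close> by (simp add: det_2)
  then have "?a = 1 \<or> ?a = -1" by (simp add: square_eq_1_iff)
  ultimately show ?thesis by (auto simp: matrix_2_eq_iff mat_2_nth)
qed

lemma psl2_act_two_fixed_points:
  assumes "g \<in> carrier PSL2R" "z \<in> \<H>" "w \<in> \<H>" "z \<noteq> w"
    and "psl2_act g z = z" "psl2_act g w = w"
  shows "g = \<one>\<^bsub>PSL2R\<^esub>"
proof -
  obtain A where A: "det A = 1" "g = psl2_proj A" using assms(1) by (rule PSL2R_representative)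
  then have "A = mat 1 \<or> A = - mat 1"
    using assms sl2_act_two_fixed_points by (simp add: upper_half_plane_iff psl2_act_proj)
  then show ?thesis
    using psl2_proj_inj_iff[of A "mat 1"] A by (simp add: psl2_proj_one)
qed


section \<open>Superharmonicity of the overlap of two holomorphic maps\<close>

text \<open>In terms of the hyperbolic distance \<open>d\<close> this is \<open>1 / cosh (d(a, b) / 2)\<close>.\<close>

definition overlap :: "complex \<Rightarrow> complex \<Rightarrow> real" where
  "overlap a b = 2 * sqrt (Im a * Im b) / cmod (a - cnj b)"

lemma cmod_diff_cnj_square: "(cmod (a - cnj b))\<^sup>2 = (cmod (a - b))\<^sup>2 + 4 * (Im a * Im b)"
  unfolding cmod_power2 by (simp add: power2_eq_square algebra_simps)

lemma overlap_square:
  assumes "0 < Im a" "0 < Im b"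
  shows "(overlap a b)\<^sup>2 = 4 * (Im a * Im b) / ((cmod (a - b))\<^sup>2 + 4 * (Im a * Im b))"
  using assms by (simp add: overlap_def power_divide power_mult_distrib flip: cmod_diff_cnj_square)

lemma overlap_nonneg: "0 < Im a \<Longrightarrow> 0 < Im b \<Longrightarrow> 0 \<le> overlap a b"
  by (simp add: overlap_def)

lemma overlap_le_1:
  assumes "0 < Im a" "0 < Im b"
  shows "overlap a b \<le> 1"
proof -
  have "0 < 4 * (Im a * Im b)" using assms by simp
  then have "(overlap a b)\<^sup>2 \<le> 1"
    unfolding overlap_square[OF assms] by (simp add: divide_le_eq_1 add_nonneg_pos)
  then show ?thesis by (simp add: power_le_one_iff abs_square_le_1)
qed

lemma overlap_eq_1_iff:
  assumes "0 < Im a" "0 < Im b"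
  shows "overlap a b = 1 \<longleftrightarrow> a = b"
proof -
  have pos: "0 < 4 * (Im a * Im b)" using assms by simp
  then have nz: "(cmod (a - b))\<^sup>2 + 4 * (Im a * Im b) \<noteq> 0"
    by (smt (verit) zero_le_power2)
  have "overlap a b = 1 \<longleftrightarrow> (overlap a b)\<^sup>2 = 1"
    using overlap_nonneg[OF assms] by (simp add: power2_eq_1_iff)
  also have "\<dots> \<longleftrightarrow> a = b"
    unfolding overlap_square[OF assms] using nz by (simp add: divide_eq_1_iff)
  finally show ?thesis .
qed

lemma overlap_commute: "overlap a b = overlap b a"
proof -
  have "cmod (a - cnj b) = cmod (cnj (a - cnj b))" by (simp only: complex_mod_cnj)
  also have "\<dots> = cmod (b - cnj a)" by (simp add: norm_minus_commute)
  finally show ?thesis by (simp add: overlap_def mult.commute)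
qed

lemma overlap_psl2_act:
  assumes "g \<in> carrier PSL2R" "z \<in> \<H>" "w \<in> \<H>"
  shows "overlap (psl2_act g z) (psl2_act g w) = overlap z w"
proof -
  obtain A where A: "det A = 1" "g = psl2_proj A" using assms(1) by (rule PSL2R_representative)
  have z: "0 < Im z" "0 < Im w" using assms by (auto simp: upper_half_plane_iff)
  define u v where "u = sl2_denom A z" and "v = sl2_denom A w"
  have nz: "u \<noteq> 0" "v \<noteq> 0" using sl2_denom_nonzero[OF A(1)] z by (auto simp: u_def v_def)
  have "sqrt (Im (sl2_act A z) * Im (sl2_act A w)) = sqrt (Im z * Im w) / (cmod u * cmod v)"
    by (simp add: Im_sl2_act[OF A(1)] z u_def[symmetric] v_def[symmetric] real_sqrt_divide real_sqrt_mult)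
  moreover have "cmod (sl2_act A z - cnj (sl2_act A w)) = cmod (z - cnj w) / (cmod u * cmod v)"
    unfolding sl2_act_diff_cnj[OF A(1) z] u_def v_def norm_divide norm_mult complex_mod_cnj ..
  ultimately show ?thesis
    using nz by (simp add: overlap_def A psl2_act_proj)
qed

text \<open>The same quantity in the right half-plane, compared with the function of \<open>P\<close> and \<open>Q\<close> that is
  holomorphic in both and agrees with it on the positive real axis. Writing \<open>P = A\<^sup>2\<close>, \<open>Q = B\<^sup>2\<close>, the
  bound passes through \<open>t = 2 Re(A cnj B) / (|A|\<^sup>2 + |B|\<^sup>2)\<close>. Here \<open>t \<le> \<phi>\<close> is the triangle inequality
  \<open>|A\<^sup>2 + B\<^sup>2| \<le> |A|\<^sup>2 + |B|\<^sup>2\<close>, and \<open>s \<le> t\<close> comes down to \<open>(|PQ| - Re(PQ)) |P - Q|\<^sup>2 \<ge> 0\<close>. Equality in both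
  makes \<open>PQ\<close> and \<open>P cnj Q\<close> real when \<open>P \<noteq> Q\<close>.\<close>

lemma right_half_plane_overlap:
  assumes P: "0 < Re P" and Q: "0 < Re Q"
  defines "s \<equiv> 2 * sqrt (Re P * Re Q) / cmod (P + cnj Q)"
    and "\<phi> \<equiv> Re (2 * csqrt P * csqrt Q / (P + Q))"
  shows right_half_plane_overlap_le: "s \<le> \<phi>"
    and right_half_plane_overlap_eq: "s = \<phi> \<Longrightarrow> P \<noteq> Q \<Longrightarrow> Im P = 0"
    and right_half_plane_overlap_real: "Im P = 0 \<Longrightarrow> Im Q = 0 \<Longrightarrow> s = \<phi>"
proof -
  define A B where "A = csqrt P" and "B = csqrt Q"
  have AP: "A * A = P" and BQ: "B * B = Q"
    by (simp_all add: A_def B_def flip: power2_eq_square)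
  define N r S m c where "N = cmod P * cmod Q" and "r = Re (P * Q)"
    and "S = (cmod P)\<^sup>2 + (cmod Q)\<^sup>2" and "m = Re (P * cnj Q)" and "c = Re (A * cnj B)"
  have A2: "(cmod A)\<^sup>2 = cmod P" and B2: "(cmod B)\<^sup>2 = cmod Q"
    by (simp_all add: power2_eq_square flip: AP BQ norm_mult)
  have nP: "cmod P > 0" and nQ: "cmod Q > 0" using P Q by auto
  have rN: "r \<le> N" unfolding r_def N_def norm_mult[symmetric] by (rule complex_Re_le_cmod)
  have Sm: "S - 2 * m = (cmod (P - Q))\<^sup>2"
    unfolding S_def m_def cmod_power2 by (simp add: power2_eq_square algebra_simps)
  have rm: "r + m = 2 * (Re P * Re Q)" by (simp add: r_def m_def)
  have c2: "2 * c\<^sup>2 = N + m"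
  proof -
    have "2 * (Re z)\<^sup>2 = (cmod z)\<^sup>2 + Re (z * z)" for z
      unfolding cmod_power2 by (simp add: power2_eq_square)
    from this[of "A * cnj B"] have "2 * c\<^sup>2 = (cmod A)\<^sup>2 * (cmod B)\<^sup>2 + Re ((A * A) * cnj (B * B))"
      by (simp add: c_def norm_mult power_mult_distrib mult_ac)
    then show ?thesis by (simp add: A2 B2 AP BQ N_def m_def)
  qed
  have PQ: "(cmod (P + cnj Q))\<^sup>2 = S + 2 * r"
    unfolding S_def r_def cmod_power2 by (simp add: power2_eq_square algebra_simps)
  have "0 < Re (P + cnj Q)" using P Q by simp
  then have PQ0: "cmod (P + cnj Q) > 0" by (rule less_le_trans[OF _ complex_Re_le_cmod])
  then have Sr: "S + 2 * r > 0" using PQ by (metis zero_less_power)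
  have SN: "(cmod P + cmod Q)\<^sup>2 = S + 2 * N" by (simp add: S_def N_def power2_sum)
  have s2: "s\<^sup>2 = 2 * (r + m) / (S + 2 * r)"
    using P Q by (simp add: s_def power_divide power_mult_distrib PQ rm)
  have s0: "s \<ge> 0" using P Q by (simp add: s_def)
  have cpos: "c > 0"
  proof -
    have pos: "Re A > 0" "Re B > 0" and lt: "\<bar>Im A\<bar> < Re A" "\<bar>Im B\<bar> < Re B"
    proof -
      have *: "0 < Re (csqrt z) \<and> \<bar>Im (csqrt z)\<bar> < Re (csqrt z)" if "0 < Re z" for z
      proof -
        define w where "w = csqrt z"
        have "Re (w * w) = Re z" by (simp add: w_def flip: power2_eq_square)
        then have "(Im w)\<^sup>2 < (Re w)\<^sup>2" using that by (simp add: power2_eq_square)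
        then have "\<bar>Im w\<bar> < \<bar>Re w\<bar>" by (simp add: abs_le_square_iff flip: not_le)
        moreover have "0 \<le> Re w" using csqrt_principal[of z] by (auto simp: w_def)
        ultimately show ?thesis unfolding w_def by linarith
      qed
      show "Re A > 0" "Re B > 0" "\<bar>Im A\<bar> < Re A" "\<bar>Im B\<bar> < Re B"
        using *[OF P] *[OF Q] by (auto simp: A_def B_def)
    qed
    have "\<bar>Im A * Im B\<bar> < Re A * Re B"
      using pos lt by (simp add: abs_mult mult_strict_mono')
    then show ?thesis by (simp add: c_def)
  qed
  define t where "t = 2 * c / (cmod P + cmod Q)"
  have t0: "t > 0" unfolding t_def using cpos nP nQ by (intro divide_pos_pos add_pos_pos mult_pos_pos) simp_all
  have SN0: "S + 2 * N > 0" using SN nP nQ by (metis add_pos_pos zero_less_power)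
  have t2: "t\<^sup>2 = 2 * (N + m) / (S + 2 * N)"
    by (simp add: t_def power_divide power_mult_distrib SN flip: c2)
  have key: "(N + m) * (S + 2 * r) - (r + m) * (S + 2 * N) = (N - r) * (cmod (P - Q))\<^sup>2"
    by (simp add: algebra_simps flip: Sm)
  have "t\<^sup>2 - s\<^sup>2 = 2 * ((N + m) * (S + 2 * r) - (r + m) * (S + 2 * N)) / ((S + 2 * N) * (S + 2 * r))"
    unfolding t2 s2 using SN0 Sr by (simp add: diff_frac_eq) (simp add: algebra_simps)
  then have ts: "t\<^sup>2 - s\<^sup>2 = 2 * ((N - r) * (cmod (P - Q))\<^sup>2) / ((S + 2 * N) * (S + 2 * r))"
    by (simp only: key)
  have "0 \<le> t\<^sup>2 - s\<^sup>2"
    unfolding ts using rN SN0 Sr by (intro divide_nonneg_pos mult_nonneg_nonneg mult_pos_pos) simp_all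
  then have "s\<^sup>2 \<le> t\<^sup>2" by (simp only: diff_ge_0_iff_ge)
  then have st: "s \<le> t" by (rule power2_le_imp_le) (use t0 in simp)
  have "0 < Re (P + Q)" using P Q by simp
  then have PQ0': "cmod (P + Q) > 0" by (rule less_le_trans[OF _ complex_Re_le_cmod])
  have \<phi>: "\<phi> = 2 * c * (cmod P + cmod Q) / (cmod (P + Q))\<^sup>2"
  proof -
    have "2 * A * B / (P + Q) = 2 * (A * B * cnj (P + Q)) / of_real ((cmod (P + Q))\<^sup>2)"
      by (subst complex_div_cnj) (simp add: mult_ac)
    then have "\<phi> = 2 * Re (A * B * cnj (P + Q)) / (cmod (P + Q))\<^sup>2"
      unfolding \<phi>_def A_def[symmetric] B_def[symmetric]
      by (simp only: Re_divide_of_real mult.assoc) simp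
    also have "A * B * cnj (P + Q) = of_real (cmod P) * (B * cnj A) + of_real (cmod Q) * (A * cnj B)"
    proof -
      have "of_real (cmod P) = A * cnj A" "of_real (cmod Q) = B * cnj B"
        unfolding A2[symmetric] B2[symmetric] complex_norm_square by simp_all
      moreover have "A * B * cnj (A * A + B * B) = A * cnj A * (B * cnj A) + B * cnj B * (A * cnj B)"
        by (simp add: algebra_simps)
      ultimately show ?thesis by (simp only: AP BQ)
    qed
    also have "Re \<dots> = c * (cmod P + cmod Q)"
      by (simp add: c_def algebra_simps)
    finally show ?thesis by (simp add: mult_ac)
  qed
  have tri: "cmod (P + Q) \<le> cmod P + cmod Q" by (rule norm_triangle_ineq)
  have \<phi>t: "\<phi> = t * ((cmod P + cmod Q) / cmod (P + Q))\<^sup>2"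
    unfolding \<phi> t_def using nP nQ by (simp add: power2_eq_square)
  have ge1: "1 \<le> (cmod P + cmod Q) / cmod (P + Q)"
    using tri PQ0' by simp
  then have "1 \<le> ((cmod P + cmod Q) / cmod (P + Q))\<^sup>2"
    by (simp add: one_le_power)
  then have t\<phi>: "t \<le> \<phi>" using t0 mult_left_mono[of 1 _ t] unfolding \<phi>t by simp
  show "s \<le> \<phi>" using st t\<phi> by simp
  show "Im P = 0" if eq: "s = \<phi>" and ne: "P \<noteq> Q"
  proof -
    have "s = t" "t = \<phi>" using eq st t\<phi> by auto
    from \<open>s = t\<close> ts ne SN0 Sr have "N = r" by simp
    then have "Re (P * Q) = cmod (P * Q)" by (simp add: N_def r_def norm_mult)
    then have 1: "Im (P * Q) = 0" using cmod_power2[of "P * Q"] by simp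
    from \<open>t = \<phi>\<close> t0 have "((cmod P + cmod Q) / cmod (P + Q))\<^sup>2 = 1" unfolding \<phi>t by simp
    then have "cmod P + cmod Q = cmod (P + Q)" using ge1 PQ0' by (simp add: power2_eq_1_iff)
    then have "(cmod P + cmod Q)\<^sup>2 = (cmod (P + Q))\<^sup>2" by simp
    moreover have "(cmod (P + Q))\<^sup>2 = S + 2 * m"
      unfolding S_def m_def cmod_power2 by (simp add: power2_eq_square algebra_simps)
    ultimately have "N = m" using SN by simp
    then have "Re (P * cnj Q) = cmod (P * cnj Q)" by (simp add: N_def m_def norm_mult)
    then have 2: "Im (P * cnj Q) = 0" using cmod_power2[of "P * cnj Q"] by simp
    from 1 2 show ?thesis using P Q by auto
  qed
  show "s = \<phi>" if "Im P = 0" "Im Q = 0"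
  proof -
    have nn: "cmod P = Re P" "cmod Q = Re Q" using that P Q by (auto simp: cmod_eq_Re)
    then have "N = r" by (simp add: N_def r_def that)
    then have "s\<^sup>2 = t\<^sup>2" using ts by simp
    then have st: "s = t" using s0 t0 by (simp add: power2_eq_iff_nonneg)
    have "cmod (P + Q) = cmod P + cmod Q"
      using that P Q by (simp add: cmod_eq_Re)
    moreover have "cmod P + cmod Q \<noteq> 0" using nP nQ by linarith
    ultimately have "t = \<phi>" unfolding \<phi>t by simp
    with st show ?thesis by simp
  qed
qed

text \<open>The geodesic through two points can be moved to the positive real axis of the right
  half-plane: send one end to \<open>0\<close> and the other to \<open>\<infinity>\<close>.\<close>

lemma geodesic_chart:
  assumes "0 < Im a" "0 < Im b" "a \<noteq> b"
  obtains T where "T holomorphic_on \<H>" "inj_on T \<H>"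
    "\<And>z. z \<in> \<H> \<Longrightarrow> 0 < Re (T z)" "Im (T a) = 0" "Im (T b) = 0"
    "\<And>z w. z \<in> \<H> \<Longrightarrow> w \<in> \<H> \<Longrightarrow>
       overlap z w = 2 * sqrt (Re (T z) * Re (T w)) / cmod (T z + cnj (T w))"
proof (cases "Re a = Re b")
  case True
  let ?T = "\<lambda>z. - \<i> * (z - of_real (Re a))"
  have "cmod (?T z + cnj (?T w)) = cmod (z - cnj w)" for z w
  proof -
    have "?T z + cnj (?T w) = - \<i> * (z - cnj w)" by (simp add: algebra_simps)
    then show ?thesis by (simp add: norm_mult)
  qed
  then have "overlap z w = 2 * sqrt (Re (?T z) * Re (?T w)) / cmod (?T z + cnj (?T w))" for z w
    unfolding overlap_def by simp
  moreover have "?T holomorphic_on \<H>" by (intro holomorphic_intros)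
  moreover have "inj_on ?T \<H>" by (auto simp: inj_on_def)
  ultimately show ?thesis
    using that[of ?T] True by (simp add: upper_half_plane_iff)
next
  case False
  \<comment> \<open>centre and radius of the circle through \<open>a\<close> and \<open>b\<close> that is orthogonal to the real axis\<close>
  define c where "c = ((cmod b)\<^sup>2 - (cmod a)\<^sup>2) / (2 * (Re b - Re a))"
  have c: "(cmod b)\<^sup>2 - 2 * c * Re b = (cmod a)\<^sup>2 - 2 * c * Re a"
  proof -
    have "2 * (Re b - Re a) \<noteq> 0" using False by simp
    then have "c * (2 * (Re b - Re a)) = (cmod b)\<^sup>2 - (cmod a)\<^sup>2" unfolding c_def by simp
    then show ?thesis by (simp add: algebra_simps)
  qed
  define R where "R = cmod (a - of_real c)"
  have R2: "R\<^sup>2 = (cmod a)\<^sup>2 - 2 * c * Re a + c\<^sup>2"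
    unfolding R_def cmod_power2 by (simp add: power2_eq_square algebra_simps)
  have R: "R > 0" using assms(1) by (auto simp: R_def complex_eq_iff)
  let ?d = "\<lambda>z. z - of_real (c - R)"
  let ?T = "\<lambda>z. - \<i> * (z - of_real (c + R)) / ?d z"
  have nz: "?d z \<noteq> 0" if "0 < Im z" for z using that by (auto simp: complex_eq_iff)
  have sum: "?T z + cnj (?T w) = - \<i> * of_real (2 * R) * (z - cnj w) / (?d z * cnj (?d w))"
    if "0 < Im z" "0 < Im w" for z w
  proof -
    have n: "?d z \<noteq> 0" "cnj (?d w) \<noteq> 0" using nz that by (blast, metis complex_cnj_zero_iff)
    have "?T z + cnj (?T w) = (- \<i> * (z - of_real (c + R)) * cnj (?d w) + cnj (- \<i> * (w - of_real (c + R))) * ?d z) / (?d z * cnj (?d w))"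
      unfolding complex_cnj_divide using n by (rule add_frac_eq)
    also have "- \<i> * (z - of_real (c + R)) * cnj (?d w) + cnj (- \<i> * (w - of_real (c + R))) * ?d z
        = - \<i> * of_real (2 * R) * (z - cnj w)"
      by (simp add: algebra_simps)
    finally show ?thesis .
  qed
  have Re: "Re (?T z) = 2 * R * Im z / (cmod (?d z))\<^sup>2" if "0 < Im z" for z
  proof -
    have "?T z + cnj (?T z) = of_real (4 * R * Im z / (cmod (?d z))\<^sup>2)"
      unfolding sum[OF that that] complex_norm_square[symmetric]
      by (simp add: complex_eq_iff)
    then have "2 * Re (?T z) = 4 * R * Im z / (cmod (?d z))\<^sup>2"
      by (metis Re_complex_of_real complex_add_cnj)
    then show ?thesis by simp
  qed
  have Im: "Im (?T u) = 0" if "0 < Im u" "(cmod u)\<^sup>2 - 2 * c * Re u = (cmod a)\<^sup>2 - 2 * c * Re a" for u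
  proof -
    have "(u - of_real (c + R)) * cnj (?d u) = ?T u * \<i> * of_real ((cmod (?d u))\<^sup>2)"
    proof -
      have "- \<i> * x * \<i> = x" for x by (simp add: complex_eq_iff)
      then have "?T u * \<i> = (u - of_real (c + R)) / ?d u"
        by (simp only: times_divide_eq_left)
      then show ?thesis
        unfolding complex_norm_square using nz[OF that(1)] by (simp only: times_divide_eq_left) simp
    qed
    moreover have "Re (x * \<i> * of_real r) = - Im x * r" for x r by simp
    ultimately have "Re ((u - of_real (c + R)) * cnj (?d u)) = - Im (?T u) * (cmod (?d u))\<^sup>2"
      by (simp only:)
    moreover have "Re ((u - of_real (c + R)) * cnj (?d u)) = (cmod u)\<^sup>2 - 2 * c * Re u + c\<^sup>2 - R\<^sup>2"
      unfolding cmod_power2 by (simp add: power2_eq_square algebra_simps)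
    ultimately have "Im (?T u) * (cmod (?d u))\<^sup>2 = 0" using that(2) R2 by simp
    then show ?thesis using nz[OF that(1)] by simp
  qed
  show ?thesis
  proof (rule that[of ?T])
    show "?T holomorphic_on \<H>"
      using nz by (intro holomorphic_intros) (simp_all add: upper_half_plane_iff)
    show "inj_on ?T \<H>"
    proof (rule inj_onI)
      fix z w assume zw: "z \<in> \<H>" "w \<in> \<H>" and "?T z = ?T w"
      then have "(z - of_real (c + R)) * ?d w = (w - of_real (c + R)) * ?d z"
        using nz by (simp add: upper_half_plane_iff frac_eq_eq)
      then have "of_real (2 * R) * (z - w) = 0" by (simp add: algebra_simps)
      then show "z = w" using R by simp
    qed
    show "0 < Re (?T z)" if "z \<in> \<H>" for z
      using that R nz[of z] Re[of z] by (simp add: upper_half_plane_iff)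
    show "Im (?T a) = 0" "Im (?T b) = 0" using Im assms c by auto
    show "overlap z w = 2 * sqrt (Re (?T z) * Re (?T w)) / cmod (?T z + cnj (?T w))"
      if "z \<in> \<H>" "w \<in> \<H>" for z w
    proof -
      have zw: "0 < Im z" "0 < Im w" using that by (auto simp: upper_half_plane_iff)
      have p: "cmod (?d z) > 0" "cmod (?d w) > 0" using nz zw by auto
      have 1: "sqrt (Re (?T z) * Re (?T w)) = 2 * R * sqrt (Im z * Im w) / (cmod (?d z) * cmod (?d w))"
        unfolding Re[OF zw(1)] Re[OF zw(2)] using R p zw
        by (intro real_sqrt_unique, simp_all add: power_divide power_mult_distrib) (simp add: power2_eq_square)
      have 2: "cmod (?T z + cnj (?T w)) = 2 * R * cmod (z - cnj w) / (cmod (?d z) * cmod (?d w))"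
        unfolding sum[OF zw] norm_divide norm_mult complex_mod_cnj using R by simp
      show ?thesis unfolding 1 2 overlap_def using R p by simp
    qed
  qed
qed


section \<open>Haar measure and unfolding\<close>

lemma continuous_on_left_matrix_mult: "continuous_on S (\<lambda>A. B ** A :: real^2^2)"
  unfolding matrix_matrix_mult_def by (intro continuous_intros)

lemma carrier_SL2R: "carrier SL2R = {A. det A = 1}"
  by (simp add: SL2R_def)

lemma quotient_map_psl2_proj:
  "quotient_map (top_of_set (carrier SL2R)) PSL2R_topology psl2_proj"
  unfolding quotient_map_def topspace_PSL2R_topology openin_PSL2R_topology
  by (simp add: carrier_PSL2R carrier_SL2R)

lemma continuous_map_left_mult:
  assumes "g \<in> carrier PSL2R"
  shows "continuous_map PSL2R_topology PSL2R_topology (\<lambda>x. g \<star> x)"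
proof (rule continuous_compose_quotient_map[OF quotient_map_psl2_proj])
  obtain B where B: "det B = 1" "g = psl2_proj B" using assms by (rule PSL2R_representative)
  have "continuous_map (top_of_set (carrier SL2R)) (top_of_set (carrier SL2R)) (\<lambda>A. B ** A)"
    using B by (auto intro: continuous_on_left_matrix_mult simp: carrier_SL2R det_mul)
  then have "continuous_map (top_of_set (carrier SL2R)) PSL2R_topology (psl2_proj \<circ> (\<lambda>A. B ** A))"
    by (rule continuous_map_compose) (rule quotient_imp_continuous_map[OF quotient_map_psl2_proj])
  then show "continuous_map (top_of_set (carrier SL2R)) PSL2R_topology ((\<lambda>x. g \<star> x) \<circ> psl2_proj)"
    by (rule continuous_map_eq) (simp add: B psl2_proj_mult carrier_SL2R)
qed

lemma continuous_on_sl2_act: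
  assumes "z \<in> \<H>"
  shows "continuous_on {A. det A = 1} (\<lambda>A. sl2_act A z)"
  unfolding sl2_act_eq using assms sl2_denom_nonzero
  by (intro continuous_intros) (auto simp: upper_half_plane_iff)

lemma continuous_map_orbit:
  assumes "z \<in> \<H>"
  shows "continuous_map PSL2R_topology euclidean (\<lambda>g. psl2_act g z)"
  by (rule continuous_compose_quotient_map[OF quotient_map_psl2_proj])
    (simp add: o_def psl2_act_proj carrier_SL2R continuous_on_sl2_act[OF assms])

lemma open_map_psl2_proj: "open_map (top_of_set (carrier SL2R)) PSL2R_topology psl2_proj"
  unfolding open_map_def openin_PSL2R_topology
proof (intro allI impI conjI)
  fix U assume U: "openin (top_of_set (carrier SL2R)) U"
  then have sub: "U \<subseteq> carrier SL2R" by (simp add: openin_imp_subset)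
  then show "psl2_proj ` U \<subseteq> carrier PSL2R" by (auto simp: carrier_PSL2R carrier_SL2R)
  have "continuous_map (top_of_set (carrier SL2R)) (top_of_set (carrier SL2R)) uminus"
    by (auto simp: carrier_SL2R det_uminus_2 intro!: continuous_intros)
  from openin_continuous_map_preimage[OF this U]
  have "openin (top_of_set (carrier SL2R)) {A \<in> carrier SL2R. - A \<in> U}" by simp
  with U have "openin (top_of_set (carrier SL2R)) (U \<union> {A \<in> carrier SL2R. - A \<in> U})"
    by (rule openin_Un)
  moreover have "{A \<in> carrier SL2R. psl2_proj A \<in> psl2_proj ` U} = U \<union> {A \<in> carrier SL2R. - A \<in> U}"
    using sub by (auto simp: psl2_proj_inj_iff image_iff intro: bexI[of _ "- _"])
  ultimately show "openin (top_of_set (carrier SL2R)) {A \<in> carrier SL2R. psl2_proj A \<in> psl2_proj ` U}"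
    by simp
qed

lemma second_countable_PSL2R: "second_countable PSL2R_topology"
proof (rule second_countable_open_map_image)
  show "continuous_map (top_of_set (carrier SL2R)) PSL2R_topology psl2_proj"
    by (rule quotient_imp_continuous_map[OF quotient_map_psl2_proj])
  show "open_map (top_of_set (carrier SL2R)) PSL2R_topology psl2_proj"
    by (rule open_map_psl2_proj)
  show "psl2_proj ` topspace (top_of_set (carrier SL2R)) = topspace PSL2R_topology"
    by (simp add: topspace_PSL2R_topology carrier_PSL2R carrier_SL2R)
  show "second_countable (top_of_set (carrier SL2R))"
  proof (rule second_countable_subtopology)
    obtain \<B> :: "(real^2^2) set set" where "countable \<B>" "\<And>C. C \<in> \<B> \<Longrightarrow> open C"
      "\<And>S. open S \<Longrightarrow> \<exists>U. U \<subseteq> \<B> \<and> S = \<Union>U"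
      by (rule univ_second_countable) blast
    then show "second_countable (euclidean :: (real^2^2) topology)"
      unfolding second_countable_def open_openin[symmetric] by (intro exI[of _ \<B>]) blast
  qed
qed

lemma PSL2R_cancel:
  assumes "g \<in> carrier PSL2R" "x \<in> carrier PSL2R"
  shows "inv\<^bsub>PSL2R\<^esub> g \<star> (g \<star> x) = x"
    and "g \<star> (inv\<^bsub>PSL2R\<^esub> g \<star> x) = x"
  using assms by (simp_all flip: PSL2R.m_assoc)

locale haar =
  fixes \<mu> :: "psl2 measure"
  assumes haar: "haar_measure \<mu>"
begin

lemma space_haar [simp]: "space \<mu> = carrier PSL2R"
  using haar by (simp add: haar_measure_def)

lemma sets_haar: "sets \<mu> = sigma_sets (carrier PSL2R) {U. openin PSL2R_topology U}"
  using haar by (simp add: haar_measure_def)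

lemma open_measurable: "openin PSL2R_topology U \<Longrightarrow> U \<in> sets \<mu>"
  by (auto simp: sets_haar)

lemma continuous_measurable:
  fixes f :: "psl2 \<Rightarrow> 'b::topological_space"
  assumes "continuous_map PSL2R_topology euclidean f"
  shows "f \<in> borel_measurable \<mu>"
proof (rule borel_measurableI)
  fix S :: "'b set" assume "open S"
  then have "openin PSL2R_topology {x \<in> topspace PSL2R_topology. f x \<in> S}"
    by (intro openin_continuous_map_preimage[OF assms]) simp
  then have "{x \<in> carrier PSL2R. f x \<in> S} \<in> sets \<mu>"
    using open_measurable by (simp add: topspace_PSL2R_topology)
  moreover have "f -` S \<inter> space \<mu> = {x \<in> carrier PSL2R. f x \<in> S}" by auto
  ultimately show "f -` S \<inter> space \<mu> \<in> sets \<mu>" by simp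
qed

lemma orbit_measurable: "z \<in> \<H> \<Longrightarrow> (\<lambda>g. psl2_act g z) \<in> borel_measurable \<mu>"
  by (intro continuous_measurable continuous_map_orbit)

lemma left_mult_measurable:
  assumes g: "g \<in> carrier PSL2R"
  shows "(\<lambda>x. g \<star> x) \<in> measurable \<mu> \<mu>"
proof (rule measurable_sigma_sets[OF sets_haar])
  show "{U. openin PSL2R_topology U} \<subseteq> Pow (carrier PSL2R)"
    by (auto simp: openin_PSL2R_topology)
  fix U assume "U \<in> {U. openin PSL2R_topology U}"
  then have "openin PSL2R_topology {x \<in> topspace PSL2R_topology. g \<star> x \<in> U}"
    by (intro openin_continuous_map_preimage[OF continuous_map_left_mult[OF g]]) simp
  moreover have "{x \<in> topspace PSL2R_topology. g \<star> x \<in> U} = (\<lambda>x. g \<star> x) -` U \<inter> space \<mu>"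
    by (auto simp: topspace_PSL2R_topology)
  ultimately show "(\<lambda>x. g \<star> x) -` U \<inter> space \<mu> \<in> sets \<mu>"
    using open_measurable by simp
qed (use g in auto)

lemma l_coset_eq_vimage:
  assumes "g \<in> carrier PSL2R" "E \<subseteq> carrier PSL2R"
  shows "g <#\<^bsub>PSL2R\<^esub> E = (\<lambda>x. inv\<^bsub>PSL2R\<^esub> g \<star> x) -` E \<inter> space \<mu>"
proof (intro equalityI subsetI)
  fix y assume "y \<in> g <#\<^bsub>PSL2R\<^esub> E"
  then obtain x where "x \<in> E" "y = g \<star> x" by (auto simp: l_coset_def)
  then show "y \<in> (\<lambda>x. inv\<^bsub>PSL2R\<^esub> g \<star> x) -` E \<inter> space \<mu>"
    using assms by (auto simp: PSL2R_cancel)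
next
  fix x assume "x \<in> (\<lambda>x. inv\<^bsub>PSL2R\<^esub> g \<star> x) -` E \<inter> space \<mu>"
  then have x: "inv\<^bsub>PSL2R\<^esub> g \<star> x \<in> E" "x \<in> carrier PSL2R" by auto
  then have "x = g \<star> (inv\<^bsub>PSL2R\<^esub> g \<star> x)"
    using assms by (simp add: PSL2R_cancel)
  with x(1) show "x \<in> g <#\<^bsub>PSL2R\<^esub> E" unfolding l_coset_def by blast
qed

lemma l_coset_measurable:
  assumes "g \<in> carrier PSL2R" "E \<in> sets \<mu>"
  shows "g <#\<^bsub>PSL2R\<^esub> E \<in> sets \<mu>"
proof -
  have "E \<subseteq> carrier PSL2R" using sets.sets_into_space[OF assms(2)] by simp
  then show ?thesis
    unfolding l_coset_eq_vimage[OF assms(1) \<open>E \<subseteq> carrier PSL2R\<close>]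
    by (intro measurable_sets[OF left_mult_measurable assms(2)]) (simp add: assms(1))
qed

lemma emeasure_l_coset:
  "g \<in> carrier PSL2R \<Longrightarrow> E \<in> sets \<mu> \<Longrightarrow> emeasure \<mu> (g <#\<^bsub>PSL2R\<^esub> E) = emeasure \<mu> E"
  using haar by (simp add: haar_measure_def)

lemma distr_left_mult:
  assumes g: "g \<in> carrier PSL2R"
  shows "distr \<mu> \<mu> (\<lambda>x. g \<star> x) = \<mu>"
proof (rule measure_eqI)
  fix E assume "E \<in> sets (distr \<mu> \<mu> (\<lambda>x. g \<star> x))"
  then have E: "E \<in> sets \<mu>" by simp
  then have "E \<subseteq> carrier PSL2R" using sets.sets_into_space by fastforce
  then have "(\<lambda>x. g \<star> x) -` E \<inter> space \<mu> = inv\<^bsub>PSL2R\<^esub> g <#\<^bsub>PSL2R\<^esub> E"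
    using g by (simp add: l_coset_eq_vimage)
  then show "emeasure (distr \<mu> \<mu> (\<lambda>x. g \<star> x)) E = emeasure \<mu> E"
    using g E by (simp add: emeasure_distr left_mult_measurable emeasure_l_coset)
qed simp

lemma nn_integral_left_mult:
  assumes "g \<in> carrier PSL2R" and [measurable]: "f \<in> borel_measurable \<mu>"
  shows "(\<integral>\<^sup>+x. f (g \<star> x) \<partial>\<mu>) = (\<integral>\<^sup>+x. f x \<partial>\<mu>)"
  by (subst (2) distr_left_mult[OF assms(1), symmetric])
    (simp add: nn_integral_distr left_mult_measurable assms)

lemma integral_left_mult:
  fixes f :: "psl2 \<Rightarrow> complex"
  assumes "g \<in> carrier PSL2R" "f \<in> borel_measurable \<mu>"
  shows "(\<integral>x. f (g \<star> x) \<partial>\<mu>) = (\<integral>x. f x \<partial>\<mu>)"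
  by (subst (2) distr_left_mult[OF assms(1), symmetric])
    (simp add: integral_distr left_mult_measurable assms)

text \<open>Countably many translates of a nonempty open set cover the group, which is not a null set.\<close>

lemma open_nonnull:
  assumes U: "openin PSL2R_topology U" "U \<noteq> {}"
  shows "emeasure \<mu> U \<noteq> 0"
proof
  assume 0: "emeasure \<mu> U = 0"
  have UM: "U \<in> sets \<mu>" and sub: "U \<subseteq> carrier PSL2R"
    using U open_measurable by (auto simp: openin_PSL2R_topology)
  obtain u where u: "u \<in> U" "u \<in> carrier PSL2R" using U sub by auto
  define T where "T g = {x \<in> topspace PSL2R_topology. inv\<^bsub>PSL2R\<^esub> g \<star> x \<in> U}" for g
  have T: "T g = g <#\<^bsub>PSL2R\<^esub> U" if "g \<in> carrier PSL2R" for g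
    using l_coset_eq_vimage[OF that sub] by (auto simp: T_def topspace_PSL2R_topology)
  have Lindelof: "Lindelof_space PSL2R_topology"
    by (rule second_countable_imp_Lindelof_space[OF second_countable_PSL2R])
  have "openin PSL2R_topology (T g)" if "g \<in> carrier PSL2R" for g
    unfolding T_def
    by (rule openin_continuous_map_preimage[OF continuous_map_left_mult U(1)]) (simp add: that)
  moreover have "\<Union>(T ` carrier PSL2R) = topspace PSL2R_topology"
  proof
    show "topspace PSL2R_topology \<subseteq> \<Union>(T ` carrier PSL2R)"
    proof
      fix x assume "x \<in> topspace PSL2R_topology"
      then have x: "x \<in> carrier PSL2R" by (simp add: topspace_PSL2R_topology)
      then have "inv\<^bsub>PSL2R\<^esub> (x \<star> inv\<^bsub>PSL2R\<^esub> u) \<star> x = u"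
        using u by (simp add: PSL2R.inv_mult_group PSL2R.m_assoc)
      then have "x \<in> T (x \<star> inv\<^bsub>PSL2R\<^esub> u)"
        using x u by (simp add: T_def topspace_PSL2R_topology)
      moreover have "x \<star> inv\<^bsub>PSL2R\<^esub> u \<in> carrier PSL2R" using x u by simp
      ultimately show "x \<in> \<Union>(T ` carrier PSL2R)" by (intro UN_I)
    qed
  qed (auto simp: T_def)
  ultimately have Lcover: "\<exists>\<V>. countable \<V> \<and> \<V> \<subseteq> T ` carrier PSL2R \<and> \<Union>\<V> = topspace PSL2R_topology"
    by (intro Lindelof[unfolded Lindelof_space_def, rule_format] conjI ballI) (elim imageE, simp_all)
  then obtain \<V> where \<V>: "countable \<V>" "\<V> \<subseteq> T ` carrier PSL2R" "\<Union>\<V> = topspace PSL2R_topology"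
    by (elim exE conjE)
  have "V \<in> null_sets \<mu>" if mem: "V \<in> \<V>" for V
  proof -
    obtain g where g: "g \<in> carrier PSL2R" "V = T g" using subsetD[OF \<V>(2) mem] by (elim imageE)
    then have V: "V = g <#\<^bsub>PSL2R\<^esub> U" by (simp only: T)
    show ?thesis
      unfolding V using l_coset_measurable[OF g(1) UM] emeasure_l_coset[OF g(1) UM] 0
      by (intro null_setsI) simp_all
  qed
  then have "(\<Union>V\<in>\<V>. V) \<in> null_sets \<mu>" by (rule null_sets_UN'[OF \<V>(1)])
  from null_setsD1[OF this] have "emeasure \<mu> (\<Union>\<V>) = 0" by (simp only: image_ident)
  then have "emeasure \<mu> (carrier PSL2R) = 0" unfolding \<V>(3) topspace_PSL2R_topology .
  then show False using haar unfolding haar_measure_def by blast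
qed

end

locale haar_lattice = haar +
  fixes \<Gamma> F :: "psl2 set"
  assumes subgroup: "subgroup \<Gamma> PSL2R"
    and countable: "countable \<Gamma>"
    and F_measurable: "F \<in> sets \<mu>"
    and F_finite: "emeasure \<mu> F < \<infinity>"
    and F_domain: "\<And>g. g \<in> carrier PSL2R \<Longrightarrow> \<exists>!f. f \<in> F \<and> f \<in> \<Gamma> #>\<^bsub>PSL2R\<^esub> g"
begin

lemma carrierI: "\<gamma> \<in> \<Gamma> \<Longrightarrow> \<gamma> \<in> carrier PSL2R"
  by (rule subgroup.mem_carrier[OF subgroup])

lemma F_carrier: "x \<in> F \<Longrightarrow> x \<in> carrier PSL2R"
  using sets.sets_into_space[OF F_measurable] by auto

lemma ex1_translate:
  assumes x: "x \<in> carrier PSL2R"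
  shows "\<exists>!\<gamma>. \<gamma> \<in> \<Gamma> \<and> inv\<^bsub>PSL2R\<^esub> \<gamma> \<star> x \<in> F"
proof -
  obtain f where f: "f \<in> F" "f \<in> \<Gamma> #>\<^bsub>PSL2R\<^esub> x" using F_domain[OF x] by blast
  then obtain \<gamma> where \<gamma>: "\<gamma> \<in> \<Gamma>" "f = \<gamma> \<star> x" by (auto simp: r_coset_def)
  show ?thesis
  proof (rule ex1I[of _ "inv\<^bsub>PSL2R\<^esub> \<gamma>"])
    show "inv\<^bsub>PSL2R\<^esub> \<gamma> \<in> \<Gamma> \<and> inv\<^bsub>PSL2R\<^esub> (inv\<^bsub>PSL2R\<^esub> \<gamma>) \<star> x \<in> F"
      using \<gamma> f carrierI subgroup.m_inv_closed[OF subgroup] by simp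
    fix \<delta> assume \<delta>: "\<delta> \<in> \<Gamma> \<and> inv\<^bsub>PSL2R\<^esub> \<delta> \<star> x \<in> F"
    then have "inv\<^bsub>PSL2R\<^esub> \<delta> \<star> x \<in> \<Gamma> #>\<^bsub>PSL2R\<^esub> x"
      using subgroup.m_inv_closed[OF subgroup] by (auto simp: r_coset_def)
    then have "inv\<^bsub>PSL2R\<^esub> \<delta> \<star> x = \<gamma> \<star> x"
      using F_domain[OF x] \<delta> f \<gamma> by blast
    then have "inv\<^bsub>PSL2R\<^esub> \<delta> = \<gamma>" using \<delta> \<gamma> x carrierI by simp
    then show "\<delta> = inv\<^bsub>PSL2R\<^esub> \<gamma>" using \<delta> carrierI by auto
  qed
qed

abbreviation N :: "psl2 measure" where "N \<equiv> restrict_space \<mu> F"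

lemma nn_integral_N: "(\<integral>\<^sup>+x. f x \<partial>N) = (\<integral>\<^sup>+x. f x * indicator F x \<partial>\<mu>)"
  by (rule nn_integral_restrict_space) (simp only: F_measurable sets.Int_space_eq2)

lemma space_N: "space N = F"
  using sets.sets_into_space[OF F_measurable] by (auto simp: space_restrict_space)

lemma finite_measure_N: "finite_measure N"
  by (rule finite_measureI) (use F_finite F_measurable sets.sets_into_space[OF F_measurable] in
      \<open>simp add: space_N emeasure_restrict_space less_top[symmetric] Int_absorb2\<close>)

text \<open>Each group element lies in exactly one translate of \<open>F\<close> by an element of \<open>\<Gamma>\<close>.\<close>

lemma nn_integral_unfold:
  assumes f: "f \<in> borel_measurable \<mu>"
  shows "(\<integral>\<^sup>+x. f x \<partial>\<mu>) = (\<integral>\<^sup>+\<gamma>. \<integral>\<^sup>+x. f (\<gamma> \<star> x) \<partial>N \<partial>count_space \<Gamma>)"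
proof -
  note [measurable] = f F_measurable
  have mult [measurable]: "(\<lambda>x. inv\<^bsub>PSL2R\<^esub> \<gamma> \<star> x) \<in> measurable \<mu> \<mu>" "(\<lambda>x. \<gamma> \<star> x) \<in> measurable \<mu> \<mu>"
    if "\<gamma> \<in> \<Gamma>" for \<gamma> using that carrierI by (auto intro: left_mult_measurable)
  have "(\<integral>\<^sup>+x. f x \<partial>\<mu>) = (\<integral>\<^sup>+x. \<integral>\<^sup>+\<gamma>. f x * indicator F (inv\<^bsub>PSL2R\<^esub> \<gamma> \<star> x) \<partial>count_space \<Gamma> \<partial>\<mu>)"
  proof (rule nn_integral_cong)
    fix x assume "x \<in> space \<mu>"
    then have "\<exists>!\<gamma>. \<gamma> \<in> \<Gamma> \<and> inv\<^bsub>PSL2R\<^esub> \<gamma> \<star> x \<in> F" by (intro ex1_translate) simp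
    then obtain \<delta> where \<delta>: "\<delta> \<in> \<Gamma>" "inv\<^bsub>PSL2R\<^esub> \<delta> \<star> x \<in> F"
      and uniq: "\<And>\<gamma>. \<gamma> \<in> \<Gamma> \<Longrightarrow> inv\<^bsub>PSL2R\<^esub> \<gamma> \<star> x \<in> F \<Longrightarrow> \<gamma> = \<delta>"
      unfolding Ex1_def by blast
    have "indicator F (inv\<^bsub>PSL2R\<^esub> \<gamma> \<star> x) = (indicator {\<delta>} \<gamma> :: ennreal)" if "\<gamma> \<in> \<Gamma>" for \<gamma>
    proof (cases "\<gamma> = \<delta>")
      case False
      then have "inv\<^bsub>PSL2R\<^esub> \<gamma> \<star> x \<notin> F" using uniq[OF that] by blast
      with False show ?thesis by simp
    qed (simp add: \<delta>)
    then have "(\<integral>\<^sup>+\<gamma>. f x * indicator F (inv\<^bsub>PSL2R\<^esub> \<gamma> \<star> x) \<partial>count_space \<Gamma>) = (\<integral>\<^sup>+\<gamma>. f x * indicator {\<delta>} \<gamma> \<partial>count_space \<Gamma>)"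
      by (intro nn_integral_cong) simp
    also have "\<dots> = f x"
      using \<delta> by (simp add: nn_integral_cmult)
    finally show "f x = (\<integral>\<^sup>+\<gamma>. f x * indicator F (inv\<^bsub>PSL2R\<^esub> \<gamma> \<star> x) \<partial>count_space \<Gamma>)" ..
  qed
  also have "\<dots> = (\<integral>\<^sup>+\<gamma>. \<integral>\<^sup>+x. f x * indicator F (inv\<^bsub>PSL2R\<^esub> \<gamma> \<star> x) \<partial>\<mu> \<partial>count_space \<Gamma>)"
    by (intro nn_integral_count_space_nn_integral countable borel_measurable_times_ennreal f
        measurable_compose[OF mult(1) borel_measurable_indicator[OF F_measurable]])
  also have "\<dots> = (\<integral>\<^sup>+\<gamma>. \<integral>\<^sup>+x. f (\<gamma> \<star> x) \<partial>N \<partial>count_space \<Gamma>)"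
  proof (rule nn_integral_cong)
    fix \<gamma> assume "\<gamma> \<in> space (count_space \<Gamma>)"
    then have \<gamma>: "\<gamma> \<in> \<Gamma>" "\<gamma> \<in> carrier PSL2R" using carrierI by auto
    note [measurable] = mult[OF \<gamma>(1)]
    have "(\<integral>\<^sup>+x. f x * indicator F (inv\<^bsub>PSL2R\<^esub> \<gamma> \<star> x) \<partial>\<mu>)
        = (\<integral>\<^sup>+x. f (\<gamma> \<star> x) * indicator F (inv\<^bsub>PSL2R\<^esub> \<gamma> \<star> (\<gamma> \<star> x)) \<partial>\<mu>)"
      by (rule nn_integral_left_mult[OF \<gamma>(2), symmetric])
        (intro borel_measurable_times_ennreal f
          measurable_compose[OF mult(1) borel_measurable_indicator[OF F_measurable]] \<gamma>(1))
    also have "\<dots> = (\<integral>\<^sup>+x. f (\<gamma> \<star> x) * indicator F x \<partial>\<mu>)"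
      using \<gamma>(2) by (intro nn_integral_cong) (simp add: PSL2R_cancel)
    finally show "(\<integral>\<^sup>+x. f x * indicator F (inv\<^bsub>PSL2R\<^esub> \<gamma> \<star> x) \<partial>\<mu>) = (\<integral>\<^sup>+x. f (\<gamma> \<star> x) \<partial>N)"
      by (simp add: nn_integral_N)
  qed
  finally show ?thesis .
qed

text \<open>Averaging with respect to an invariant symmetric kernel preserves integrals over the
  fundamental domain: the left-hand side unfolds to \<open>\<Sum>\<^sub>\<gamma> \<integral>\<^sub>F \<integral>\<^sub>F k(x, \<gamma>y) f(y)\<close>, and replacing \<open>\<gamma>\<close> by its
  inverse exchanges the two variables.\<close>

lemma symmetric_kernel_integral:
  fixes k :: "psl2 \<Rightarrow> psl2 \<Rightarrow> ennreal"
  assumes k: "(\<lambda>p. k (fst p) (snd p)) \<in> borel_measurable (\<mu> \<Otimes>\<^sub>M \<mu>)"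
    and sym: "\<And>x y. x \<in> carrier PSL2R \<Longrightarrow> y \<in> carrier PSL2R \<Longrightarrow> k x y = k y x"
    and inv: "\<And>g x y. g \<in> \<Gamma> \<Longrightarrow> x \<in> carrier PSL2R \<Longrightarrow> y \<in> carrier PSL2R \<Longrightarrow>
      k (g \<star> x) (g \<star> y) = k x y"
    and f: "f \<in> borel_measurable \<mu>"
    and finv: "\<And>g x. g \<in> \<Gamma> \<Longrightarrow> x \<in> carrier PSL2R \<Longrightarrow> f (g \<star> x) = f x"
  shows "(\<integral>\<^sup>+x. \<integral>\<^sup>+y. k x y * f y \<partial>\<mu> \<partial>N) = (\<integral>\<^sup>+x. f x * (\<integral>\<^sup>+y. k x y \<partial>\<mu>) \<partial>N)"
proof -
  interpret N: finite_measure N by (rule finite_measure_N)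
  interpret NN: pair_sigma_finite N N ..
  have idN: "(\<lambda>x. x) \<in> measurable N \<mu>" by (intro measurable_restrict_space1 measurable_ident_sets refl)
  have fN [measurable]: "f \<in> borel_measurable N" by (rule measurable_restrict_space1[OF f])
  have kx: "(\<lambda>y. k x y) \<in> borel_measurable \<mu>" if "x \<in> carrier PSL2R" for x
    using measurable_compose[OF measurable_Pair1' k, of x] that by simp
  have k\<gamma>: "(\<lambda>p. k (fst p) (\<gamma> \<star> snd p)) \<in> borel_measurable (N \<Otimes>\<^sub>M N)" if "\<gamma> \<in> \<Gamma>" for \<gamma>
  proof -
    have "(\<lambda>p. (fst p, \<gamma> \<star> snd p)) \<in> measurable (N \<Otimes>\<^sub>M N) (\<mu> \<Otimes>\<^sub>M \<mu>)"
      using that carrierI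
      by (intro measurable_Pair measurable_compose[OF measurable_fst idN]
          measurable_compose[OF measurable_compose[OF measurable_snd idN] left_mult_measurable]) auto
    from measurable_compose[OF this k] show ?thesis by simp
  qed
  have swap: "k x (\<gamma> \<star> y) = k y (inv\<^bsub>PSL2R\<^esub> \<gamma> \<star> x)"
    if "\<gamma> \<in> \<Gamma>" "x \<in> F" "y \<in> F" for \<gamma> x y
  proof -
    have c: "\<gamma> \<in> carrier PSL2R" "x \<in> carrier PSL2R" "y \<in> carrier PSL2R"
      using that carrierI F_carrier by auto
    have "k x (\<gamma> \<star> y) = k (inv\<^bsub>PSL2R\<^esub> \<gamma> \<star> x) (inv\<^bsub>PSL2R\<^esub> \<gamma> \<star> (\<gamma> \<star> y))"
      using that c subgroup.m_inv_closed[OF subgroup] by (simp add: inv)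
    also have "inv\<^bsub>PSL2R\<^esub> \<gamma> \<star> (\<gamma> \<star> y) = y"
      using c by (simp add: PSL2R_cancel)
    finally show ?thesis using c sym by simp
  qed
  have "(\<integral>\<^sup>+x. \<integral>\<^sup>+y. k x y * f y \<partial>\<mu> \<partial>N)
      = (\<integral>\<^sup>+x. \<integral>\<^sup>+\<gamma>. \<integral>\<^sup>+y. k x (\<gamma> \<star> y) * f y \<partial>N \<partial>count_space \<Gamma> \<partial>N)"
    by (intro nn_integral_cong, subst nn_integral_unfold)
      (auto simp: space_N F_carrier finv intro!: borel_measurable_times_ennreal kx f nn_integral_cong)
  also have "\<dots> = (\<integral>\<^sup>+\<gamma>. \<integral>\<^sup>+x. \<integral>\<^sup>+y. k x (\<gamma> \<star> y) * f y \<partial>N \<partial>N \<partial>count_space \<Gamma>)"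
    using k\<gamma> by (intro nn_integral_count_space_nn_integral countable N.borel_measurable_nn_integral)
      (simp add: case_prod_unfold)
  also have "\<dots> = (\<integral>\<^sup>+\<gamma>. \<integral>\<^sup>+y. \<integral>\<^sup>+x. k x (\<gamma> \<star> y) * f y \<partial>N \<partial>N \<partial>count_space \<Gamma>)"
    using k\<gamma> by (intro nn_integral_cong NN.Fubini'[symmetric]) (simp add: case_prod_unfold)
  also have "\<dots> = (\<integral>\<^sup>+\<gamma>. \<integral>\<^sup>+y. \<integral>\<^sup>+x. k y (inv\<^bsub>PSL2R\<^esub> \<gamma> \<star> x) * f y \<partial>N \<partial>N \<partial>count_space \<Gamma>)"
    by (intro nn_integral_cong) (simp add: space_N swap)
  also have "\<dots> = (\<integral>\<^sup>+\<gamma>. \<integral>\<^sup>+y. \<integral>\<^sup>+x. k y (\<gamma> \<star> x) * f y \<partial>N \<partial>N \<partial>count_space \<Gamma>)"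
  proof (rule nn_integral_bij_count_space)
    have "inv\<^bsub>PSL2R\<^esub> \<gamma> \<in> \<Gamma>" "inv\<^bsub>PSL2R\<^esub> (inv\<^bsub>PSL2R\<^esub> \<gamma>) = \<gamma>" if "\<gamma> \<in> \<Gamma>" for \<gamma>
      using that carrierI subgroup.m_inv_closed[OF subgroup] by auto
    then show "bij_betw (\<lambda>\<gamma>. inv\<^bsub>PSL2R\<^esub> \<gamma>) \<Gamma> \<Gamma>"
      by (intro bij_betwI[where g = "\<lambda>\<gamma>. inv\<^bsub>PSL2R\<^esub> \<gamma>"]) auto
  qed
  also have "\<dots> = (\<integral>\<^sup>+y. \<integral>\<^sup>+\<gamma>. \<integral>\<^sup>+x. k y (\<gamma> \<star> x) * f y \<partial>N \<partial>count_space \<Gamma> \<partial>N)"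
    using k\<gamma> by (intro nn_integral_count_space_nn_integral[symmetric] countable N.borel_measurable_nn_integral)
      (simp add: case_prod_unfold)
  also have "\<dots> = (\<integral>\<^sup>+y. \<integral>\<^sup>+x. k y x * f y \<partial>\<mu> \<partial>N)"
    by (intro nn_integral_cong, subst nn_integral_unfold)
      (auto simp: space_N F_carrier intro!: borel_measurable_times_ennreal kx)
  also have "\<dots> = (\<integral>\<^sup>+y. f y * (\<integral>\<^sup>+x. k y x \<partial>\<mu>) \<partial>N)"
    by (intro nn_integral_cong, subst mult.commute[of "f _"], rule nn_integral_multc)
      (simp add: space_N F_carrier kx)
  finally show ?thesis .
qed

end

lemma lattice_haar_lattice:
  assumes "lattice_PSL2R \<Gamma>"
  obtains \<mu> F where "haar_lattice \<mu> \<Gamma> F"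
proof -
  from assms obtain \<mu> F where *: "subgroup \<Gamma> PSL2R"
    "subtopology PSL2R_topology \<Gamma> = discrete_topology \<Gamma>"
    "haar_measure \<mu>" "F \<in> sets \<mu>" "\<forall>g\<in>carrier PSL2R. \<exists>!f. f \<in> F \<and> f \<in> \<Gamma> #>\<^bsub>PSL2R\<^esub> g"
    "emeasure \<mu> F < \<infinity>"
    unfolding lattice_PSL2R_def by blast
  have "countable \<Gamma>"
    using second_countable_subtopology[OF second_countable_PSL2R, of \<Gamma>]
    by (simp add: *(2) second_countable_discrete_topology)
  with * have "haar_lattice \<mu> \<Gamma> F"
    by (intro haar_lattice.intro haar.intro haar_lattice_axioms.intro) auto
  then show ?thesis using that by blast
qed


section \<open>The mean value property\<close>

text \<open>The points \<open>w\<close> with \<open>sinh (d(z, w) / 2) < 1 / 2\<close>: a hyperbolic disc about \<open>z\<close> of fixed radius,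
  in a form that shows its symmetry and invariance.\<close>

definition hyp_near :: "complex \<Rightarrow> complex \<Rightarrow> bool" where
  "hyp_near z w \<longleftrightarrow> (cmod (z - w))\<^sup>2 < Im z * Im w"

definition cayley :: "complex \<Rightarrow> complex" where
  "cayley w = (w - \<i>) / (w + \<i>)"

lemma hyp_near_commute: "hyp_near z w \<longleftrightarrow> hyp_near w z"
  by (simp add: hyp_near_def norm_minus_commute mult.commute)

lemma hyp_near_refl: "z \<in> \<H> \<Longrightarrow> hyp_near z z"
  by (simp add: hyp_near_def upper_half_plane_iff)

lemma hyp_near_act:
  assumes "g \<in> carrier PSL2R" "z \<in> \<H>" "w \<in> \<H>"
  shows "hyp_near (psl2_act g z) (psl2_act g w) \<longleftrightarrow> hyp_near z w"
proof -
  obtain A where A: "det A = 1" "g = psl2_proj A" using assms(1) by (rule PSL2R_representative)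
  have z: "0 < Im z" "0 < Im w" using assms by (auto simp: upper_half_plane_iff)
  define u v where "u = (cmod (sl2_denom A z))\<^sup>2" and "v = (cmod (sl2_denom A w))\<^sup>2"
  have pos: "u > 0" "v > 0" using sl2_denom_nonzero[OF A(1)] z by (auto simp: u_def v_def)
  have "(cmod (sl2_act A z - sl2_act A w))\<^sup>2 = (cmod (z - w))\<^sup>2 / (u * v)"
    unfolding sl2_act_diff[OF A(1) z] u_def v_def by (simp only: norm_divide norm_mult power_divide power_mult_distrib)
  moreover have "Im (sl2_act A z) * Im (sl2_act A w) = Im z * Im w / (u * v)"
    by (simp add: Im_sl2_act[OF A(1)] z u_def v_def)
  ultimately show ?thesis
    using mult_pos_pos[OF pos] by (auto simp: hyp_near_def A psl2_act_proj divide_less_cancel)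
qed

lemma plus_ii_nonzero: "w \<in> \<H> \<Longrightarrow> w + \<i> \<noteq> 0"
  by (auto simp: upper_half_plane_iff complex_eq_iff)

lemma cmod_plus_ii: "(cmod (w + \<i>))\<^sup>2 = (cmod (w - \<i>))\<^sup>2 + 4 * Im w"
  unfolding cmod_power2 by (simp add: power2_eq_square algebra_simps)

lemma hyp_near_cayley:
  assumes "w \<in> \<H>"
  shows "hyp_near \<i> w \<longleftrightarrow> (cmod (cayley w))\<^sup>2 < 1 / 5"
proof -
  have pos: "0 < (cmod (w + \<i>))\<^sup>2" using plus_ii_nonzero[OF assms] by simp
  have "(cmod (cayley w))\<^sup>2 < 1 / 5 \<longleftrightarrow> (cmod (w - \<i>))\<^sup>2 < 1 / 5 * (cmod (w + \<i>))\<^sup>2"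
    using pos by (simp only: cayley_def norm_divide power_divide pos_divide_less_eq)
  also have "\<dots> \<longleftrightarrow> hyp_near \<i> w"
    unfolding cmod_plus_ii by (auto simp: hyp_near_def norm_minus_commute[of \<i>])
  finally show ?thesis by simp
qed

lemma cayley_less_1:
  assumes "w \<in> \<H>"
  shows "cmod (cayley w) < 1"
proof -
  have "(cmod (w - \<i>))\<^sup>2 < (cmod (w + \<i>))\<^sup>2"
    using assms by (simp add: cmod_plus_ii upper_half_plane_iff)
  then have "cmod (w - \<i>) < cmod (w + \<i>)" by (simp add: power_less_imp_less_base)
  then show ?thesis by (simp add: cayley_def norm_divide divide_less_eq_1)
qed

lemma cayley_inverse:
  assumes "w \<in> \<H>"
  shows "\<i> * (1 + cayley w) / (1 - cayley w) = w"
proof -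
  have nz: "w + \<i> \<noteq> 0" by (rule plus_ii_nonzero[OF assms])
  have "1 + cayley w = 2 * w / (w + \<i>)" "1 - cayley w = 2 * \<i> / (w + \<i>)"
    using nz by (simp_all add: cayley_def field_simps)
  then show ?thesis using nz by simp
qed

lemma cayley_inverse_upper:
  assumes "cmod \<zeta> < 1"
  shows "\<i> * (1 + \<zeta>) / (1 - \<zeta>) \<in> \<H>"
proof -
  have nz: "1 - \<zeta> \<noteq> 0" using assms by auto
  have "\<i> * (1 + \<zeta>) / (1 - \<zeta>) = \<i> * ((1 + \<zeta>) * cnj (1 - \<zeta>)) / of_real ((cmod (1 - \<zeta>))\<^sup>2)"
    by (subst complex_div_cnj) (simp add: mult_ac)
  then have "Im (\<i> * (1 + \<zeta>) / (1 - \<zeta>)) = Re ((1 + \<zeta>) * cnj (1 - \<zeta>)) / (cmod (1 - \<zeta>))\<^sup>2"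
    by (simp only: Im_divide_of_real) simp
  also have "Re ((1 + \<zeta>) * cnj (1 - \<zeta>)) = 1 - (cmod \<zeta>)\<^sup>2"
    unfolding cmod_power2 by (simp add: power2_eq_square algebra_simps)
  finally show ?thesis
    using assms nz by (simp add: upper_half_plane_iff power_less_one_iff)
qed

lemma cayley_rotation:
  obtains r where "r \<in> carrier PSL2R"
    "\<And>w. w \<in> \<H> \<Longrightarrow> cayley (psl2_act r w) = cis (2 * t) * cayley w"
proof -
  define A :: "real^2^2" where "A = vector [vector [cos t, sin t], vector [- sin t, cos t]]"
  have d: "det A = 1" by (simp add: A_def det_2 vector_2 flip: power2_eq_square)
  have "cayley (sl2_act A w) = cis (2 * t) * cayley w" if w: "w \<in> \<H>" for w
  proof -
    define D where "D = - of_real (sin t) * w + of_real (cos t)"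
    have "D = sl2_denom A w" by (simp add: D_def A_def vector_2)
    then have D: "D \<noteq> 0" using sl2_denom_nonzero[OF d] w by (simp add: upper_half_plane_iff)
    have act: "sl2_act A w = (of_real (cos t) * w + of_real (sin t)) / D"
      by (simp add: sl2_act_eq A_def vector_2 D_def)
    have "of_real (cos t) * w + of_real (sin t) - \<i> * D = cis t * (w - \<i>)"
      "of_real (cos t) * w + of_real (sin t) + \<i> * D = cis (- t) * (w + \<i>)"
      by (simp_all add: D_def complex_eq_iff algebra_simps)
    then have "sl2_act A w - \<i> = cis t * (w - \<i>) / D" "sl2_act A w + \<i> = cis (- t) * (w + \<i>) / D"
      using D by (simp_all add: act divide_simps)
    then have "cayley (sl2_act A w) = cis t / cis (- t) * cayley w"
      using D by (simp add: cayley_def)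
    also have "cis t / cis (- t) = cis (2 * t)" by (simp add: cis_divide)
    finally show ?thesis .
  qed
  then show ?thesis
    using that[of "psl2_proj A"] d by (simp add: psl2_proj_carrier psl2_act_proj)
qed

lemma orbit_upper: "x \<in> carrier PSL2R \<Longrightarrow> psl2_act x \<i> \<in> \<H>"
  by (intro psl2_act_upper ii_upper)

lemma continuous_map_orbit_compose:
  fixes f :: "complex \<Rightarrow> 'b::topological_space"
  assumes f: "continuous_on \<H> f"
  shows "continuous_map PSL2R_topology euclidean (\<lambda>y. f (psl2_act y \<i>))"
proof -
  have "continuous_map PSL2R_topology (top_of_set \<H>) (\<lambda>y. psl2_act y \<i>)"
    using continuous_map_orbit[OF ii_upper] orbit_upper
    by (auto simp: continuous_map_in_subtopology topspace_PSL2R_topology)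
  moreover have "continuous_map (top_of_set \<H>) euclidean f"
    using f by simp
  ultimately have "continuous_map PSL2R_topology euclidean (f \<circ> (\<lambda>y. psl2_act y \<i>))"
    by (rule continuous_map_compose)
  then show ?thesis by (simp add: o_def)
qed

definition nbhd :: "psl2 \<Rightarrow> psl2 set" where
  "nbhd x = {y \<in> carrier PSL2R. hyp_near (psl2_act x \<i>) (psl2_act y \<i>)}"

lemma openin_orbit_vimage:
  assumes "open W"
  shows "openin PSL2R_topology {y \<in> carrier PSL2R. psl2_act y \<i> \<in> W}"
  using openin_continuous_map_preimage[OF continuous_map_orbit[OF ii_upper], of W] assms
  by (simp add: topspace_PSL2R_topology)

lemma open_hyp_near: "open {w. hyp_near z w}"
  unfolding hyp_near_def by (intro open_Collect_less continuous_intros)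

lemma openin_nbhd: "openin PSL2R_topology (nbhd x)"
  using openin_orbit_vimage[OF open_hyp_near] by (simp add: nbhd_def)

lemma nbhd_mult:
  assumes "g \<in> carrier PSL2R" "x \<in> carrier PSL2R" "y \<in> carrier PSL2R"
  shows "g \<star> y \<in> nbhd (g \<star> x) \<longleftrightarrow> y \<in> nbhd x"
  using assms by (simp add: nbhd_def psl2_act_mult ii_upper hyp_near_act psl2_act_upper)

text \<open>If \<open>w = A \<i>\<close>, the rows of \<open>A\<close> have squared lengths \<open>|w|\<^sup>2 / Im w\<close> and \<open>1 / Im w\<close>, both of which are
  bounded on the disc about \<open>\<i>\<close>.\<close>

lemma compactin_near_ii:
  "\<exists>K. compactin PSL2R_topology K \<and> closedin PSL2R_topology K \<and> nbhd \<one>\<^bsub>PSL2R\<^esub> \<subseteq> K"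
proof (intro exI conjI)
  define K :: "(real^2^2) set" where "K = {A. det A = 1} \<inter> cball 0 3"
  have "continuous_on UNIV (det :: real^2^2 \<Rightarrow> real)"
    unfolding det_2 by (intro continuous_intros)
  then have "closed {A :: real^2^2. det A = 1}"
    by (intro closed_Collect_eq continuous_on_const)
  then have "compact K" unfolding K_def by (intro closed_Int_compact compact_cball)
  then have "compactin (top_of_set (carrier SL2R)) K"
    by (auto simp: compactin_subtopology K_def carrier_SL2R)
  then show "compactin PSL2R_topology (psl2_proj ` K)"
    by (rule image_compactin) (rule quotient_imp_continuous_map[OF quotient_map_psl2_proj])
  have c1: "closedin (top_of_set (carrier SL2R)) K"
    using \<open>compact K\<close> by (intro closed_subset compact_imp_closed) (auto simp: K_def carrier_SL2R)
  have c2: "{A \<in> carrier SL2R. psl2_proj A \<in> psl2_proj ` K} = K"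
    by (auto simp: K_def carrier_SL2R psl2_proj_inj_iff det_uminus_2)
  have c3: "psl2_proj ` K \<subseteq> carrier PSL2R" by (auto simp: K_def carrier_PSL2R)
  have c4: "closedin (top_of_set (carrier SL2R)) {A \<in> carrier SL2R. psl2_proj A \<in> U} \<longleftrightarrow>
      closedin PSL2R_topology U" if "U \<subseteq> carrier PSL2R" for U
    using quotient_map_psl2_proj that unfolding quotient_map_closedin topspace_PSL2R_topology by simp
  show "closedin PSL2R_topology (psl2_proj ` K)"
    using c4[OF c3] c1 unfolding c2 by simp
  show "nbhd \<one>\<^bsub>PSL2R\<^esub> \<subseteq> psl2_proj ` K"
  proof
    fix y assume y: "y \<in> nbhd \<one>\<^bsub>PSL2R\<^esub>"
    then obtain A where A: "det A = 1" "y = psl2_proj A"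
      unfolding nbhd_def by (auto elim: PSL2R_representative)
    define w where "w = sl2_act A \<i>"
    have near: "hyp_near \<i> w" using y A by (simp add: nbhd_def psl2_act_proj w_def)
    define a b c d where "a = A$1$1" and "b = A$1$2" and "c = A$2$1" and "d = A$2$2"
    have nz: "sl2_denom A \<i> \<noteq> 0" by (rule sl2_denom_nonzero[OF A(1)]) simp
    define v where "v = (cmod (sl2_denom A \<i>))\<^sup>2"
    have "v > 0" unfolding v_def using nz by simp
    moreover have "v = c\<^sup>2 + d\<^sup>2" by (simp add: v_def cmod_power2 c_def d_def)
    ultimately have v: "v > 0" "v = c\<^sup>2 + d\<^sup>2" by simp_all
    have Imw: "Im w = 1 / v" using Im_sl2_act[OF A(1), of \<i>] by (simp add: w_def v_def)
    have "a\<^sup>2 + b\<^sup>2 = (cmod (of_real a * \<i> + of_real b))\<^sup>2" by (simp add: cmod_power2)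
    also have "\<dots> = (cmod w)\<^sup>2 * v"
      using nz by (simp add: w_def sl2_act_eq v_def norm_divide power_divide a_def b_def)
    finally have ab: "a\<^sup>2 + b\<^sup>2 = (cmod w)\<^sup>2 * v" .
    have n: "(Re w)\<^sup>2 + (Im w - 1)\<^sup>2 < Im w"
      using near unfolding hyp_near_def cmod_power2 by (simp add: power2_commute)
    then have "(Im w - 1)\<^sup>2 < Im w" by (smt (verit) zero_le_power2)
    then have "1 + (Im w)\<^sup>2 < 3 * Im w" by (simp add: power2_eq_square algebra_simps)
    moreover have "0 \<le> (Im w)\<^sup>2" by simp
    ultimately have "1 < 3 * Im w" by linarith
    then have v3: "v < 3" using v(1) by (simp add: Imw field_simps)
    have "(cmod w)\<^sup>2 < 3 * Im w"
      using n unfolding cmod_power2 by (simp add: power2_eq_square algebra_simps)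
    then have "(cmod w)\<^sup>2 * v < 3 * Im w * v" using v(1) by (intro mult_strict_right_mono)
    then have "a\<^sup>2 + b\<^sup>2 < 3" using v(1) by (simp add: ab Imw)
    then have "(norm A)\<^sup>2 \<le> 3\<^sup>2"
      using v3 v(2) by (simp add: norm_vec_def L2_set_def sum_2 sum_nonneg a_def b_def c_def d_def)
    then have "norm A \<le> 3" by (rule power2_le_imp_le) simp
    then show "y \<in> psl2_proj ` K" using A by (auto simp: K_def)
  qed
qed

context haar
begin

lemma nbhd_measurable: "nbhd x \<in> sets \<mu>"
  by (intro open_measurable openin_nbhd)

lemma indicator_nbhd_one_mult:
  assumes "x \<in> carrier PSL2R" "y \<in> carrier PSL2R"
  shows "indicator (nbhd x) (x \<star> y) = indicator (nbhd \<one>\<^bsub>PSL2R\<^esub>) y"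
  using nbhd_mult[OF assms(1) _ assms(2), of "\<one>\<^bsub>PSL2R\<^esub>"] assms by (simp add: indicator_def)

lemma emeasure_nbhd:
  assumes x: "x \<in> carrier PSL2R"
  shows "emeasure \<mu> (nbhd x) = emeasure \<mu> (nbhd \<one>\<^bsub>PSL2R\<^esub>)"
proof -
  have "emeasure \<mu> (nbhd x) = (\<integral>\<^sup>+y. indicator (nbhd x) y \<partial>\<mu>)"
    by (simp add: nbhd_measurable)
  also have "\<dots> = (\<integral>\<^sup>+y. indicator (nbhd x) (x \<star> y) \<partial>\<mu>)"
    by (intro nn_integral_left_mult[symmetric] x borel_measurable_indicator nbhd_measurable)
  also have "\<dots> = (\<integral>\<^sup>+y. indicator (nbhd \<one>\<^bsub>PSL2R\<^esub>) y \<partial>\<mu>)"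
    using x by (intro nn_integral_cong) (simp add: indicator_nbhd_one_mult)
  finally show ?thesis by (simp add: nbhd_measurable)
qed

lemma emeasure_nbhd_finite:
  assumes "x \<in> carrier PSL2R"
  shows "emeasure \<mu> (nbhd x) < \<infinity>"
proof -
  obtain K where K: "compactin PSL2R_topology K" "closedin PSL2R_topology K" "nbhd \<one>\<^bsub>PSL2R\<^esub> \<subseteq> K"
    using compactin_near_ii by blast
  have "topspace PSL2R_topology - K \<in> sets \<mu>"
    using K(2) by (intro open_measurable) (simp add: closedin_def)
  then have "space \<mu> - (topspace PSL2R_topology - K) \<in> sets \<mu>"
    by (rule sets.compl_sets)
  moreover have "K \<subseteq> carrier PSL2R" using K(2) closedin_subset topspace_PSL2R_topology by metis
  ultimately have "K \<in> sets \<mu>" by (simp add: topspace_PSL2R_topology double_diff)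
  then have "emeasure \<mu> (nbhd \<one>\<^bsub>PSL2R\<^esub>) \<le> emeasure \<mu> K" by (rule emeasure_mono[OF K(3)])
  also have "\<dots> < \<infinity>" using haar K(1) unfolding haar_measure_def by blast
  finally show ?thesis using emeasure_nbhd[OF assms] by simp
qed

text \<open>Left translation by the rotation through \<open>\<pi> / n\<close> about \<open>\<i>\<close> changes the sign of the integrand.\<close>

lemma integral_cayley_power:
  assumes "n \<noteq> 0"
  shows "(\<integral>y. indicator (nbhd \<one>\<^bsub>PSL2R\<^esub>) y *\<^sub>R cayley (psl2_act y \<i>) ^ n \<partial>\<mu>) = 0"
    (is "(\<integral>y. ?f y \<partial>\<mu>) = 0")
proof -
  obtain r where r: "r \<in> carrier PSL2R"
    and rot: "\<And>w. w \<in> \<H> \<Longrightarrow> cayley (psl2_act r w) = cis (2 * (pi / (2 * real n))) * cayley w"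
    using cayley_rotation[of "pi / (2 * real n)"] by blast
  have meas: "?f \<in> borel_measurable \<mu>"
    unfolding cayley_def
    by (intro borel_measurable_scaleR borel_measurable_indicator nbhd_measurable borel_measurable_power
        borel_measurable_divide borel_measurable_diff borel_measurable_add orbit_measurable ii_upper
        borel_measurable_const)
  have "cis (2 * (pi / (2 * real n))) ^ n = -1"
  proof -
    have "real n * (2 * (pi / (2 * real n))) = pi" using assms by simp
    then show ?thesis by (metis Complex.DeMoivre cis_pi)
  qed
  then have pow: "(cis (2 * (pi / (2 * real n))) * z) ^ n = - (z ^ n)" for z
    by (simp add: power_mult_distrib)
  have "?f (r \<star> y) = - ?f y" if y: "y \<in> carrier PSL2R" for y
  proof -
    have w: "psl2_act y \<i> \<in> \<H>" using y ii_upper psl2_act_upper by blast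
    have act: "psl2_act (r \<star> y) \<i> = psl2_act r (psl2_act y \<i>)"
      using r y ii_upper by (simp add: psl2_act_mult)
    have "r \<star> y \<in> nbhd \<one>\<^bsub>PSL2R\<^esub> \<longleftrightarrow> y \<in> nbhd \<one>\<^bsub>PSL2R\<^esub>"
      using r y w by (simp add: nbhd_def act hyp_near_cayley psl2_act_upper rot norm_mult)
    then show ?thesis
      unfolding act rot[OF w] pow indicator_def by simp
  qed
  then have "(\<integral>y. ?f (r \<star> y) \<partial>\<mu>) = (\<integral>y. - ?f y \<partial>\<mu>)"
    by (intro Bochner_Integration.integral_cong) auto
  then have "(\<integral>y. ?f y \<partial>\<mu>) = - (\<integral>y. ?f y \<partial>\<mu>)"
    using integral_left_mult[OF r meas] by simp
  then show ?thesis by simp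
qed

text \<open>Rotation invariance kills every term but the constant one in the expansion of \<open>h\<close> in powers
  of the Cayley coordinate.\<close>

lemma mean_value_at_ii:
  assumes h: "h holomorphic_on \<H>"
  shows "integrable \<mu> (\<lambda>y. indicator (nbhd \<one>\<^bsub>PSL2R\<^esub>) y *\<^sub>R h (psl2_act y \<i>))"
    and "(\<integral>y. indicator (nbhd \<one>\<^bsub>PSL2R\<^esub>) y *\<^sub>R h (psl2_act y \<i>) \<partial>\<mu>)
       = measure \<mu> (nbhd \<one>\<^bsub>PSL2R\<^esub>) *\<^sub>R h \<i>"
proof -
  let ?E = "nbhd \<one>\<^bsub>PSL2R\<^esub>"
  define f where "f \<zeta> = h (\<i> * (1 + \<zeta>) / (1 - \<zeta>))" for \<zeta>
  have "(\<lambda>\<zeta>. \<i> * (1 + \<zeta>) / (1 - \<zeta>)) holomorphic_on ball 0 1"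
    by (intro holomorphic_intros) auto
  then have "(h \<circ> (\<lambda>\<zeta>. \<i> * (1 + \<zeta>) / (1 - \<zeta>))) holomorphic_on ball 0 1"
    by (rule holomorphic_on_compose_gen[OF _ h]) (use cayley_inverse_upper in auto)
  then have f: "f holomorphic_on ball 0 1" by (simp add: f_def[abs_def] o_def)
  define a where "a n = (deriv ^^ n) f 0 / fact n" for n
  have sums: "(\<lambda>n. a n * \<zeta> ^ n) sums f \<zeta>" if "cmod \<zeta> < 1" for \<zeta>
    using holomorphic_power_series[OF f, of \<zeta>] that by (simp add: a_def)
  have "summable (\<lambda>n. a n * (3 / 4) ^ n)" using sums[of "3 / 4"] by (simp add: sums_iff)
  then have abs: "summable (\<lambda>n. norm (a n * (1 / 2) ^ n))" by (rule powser_insidea) simp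
  define g where "g n y = indicator ?E y *\<^sub>R (a n * cayley (psl2_act y \<i>) ^ n)" for n y
  have half: "cmod (cayley (psl2_act y \<i>)) < 1 / 2" if "y \<in> ?E" for y
  proof -
    have "(cmod (cayley (psl2_act y \<i>)))\<^sup>2 < 1 / 5"
      using that hyp_near_cayley[OF psl2_act_upper[OF _ ii_upper], of y] by (simp add: nbhd_def)
    then have "(cmod (cayley (psl2_act y \<i>)))\<^sup>2 < (1 / 2)\<^sup>2" by (simp add: power2_eq_square)
    then show ?thesis by (rule power_less_imp_less_base) simp
  qed
  have bound: "norm (a n * cayley (psl2_act y \<i>) ^ n) \<le> norm (a n * (1 / 2) ^ n)" if "y \<in> ?E" for n y
  proof -
    have "cmod (cayley (psl2_act y \<i>)) ^ n \<le> (1 / 2) ^ n"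
      using half[OF that] by (intro power_mono) simp_all
    then show ?thesis by (simp add: norm_mult norm_power norm_divide mult_left_mono)
  qed
  have gbound: "norm (g n y) \<le> norm (a n * (1 / 2) ^ n)" for n y
    using bound[of y n] by (cases "y \<in> ?E") (simp_all add: g_def)
  have fin: "emeasure \<mu> ?E < \<infinity>" by (intro emeasure_nbhd_finite) simp
  have g: "integrable \<mu> (g n)" for n
    unfolding g_def
    by (intro integrableI_bounded_set_indicator[where B = "norm (a n * (1 / 2) ^ n)"]
        nbhd_measurable fin AE_I2 impI bound, unfold cayley_def)
      (intro borel_measurable_times borel_measurable_power
        borel_measurable_divide borel_measurable_diff borel_measurable_add orbit_measurable ii_upper
        borel_measurable_const)
  have s1: "AE y in \<mu>. summable (\<lambda>n. norm (g n y))"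
    by (intro AE_I2 summable_comparison_test'[OF abs]) (simp only: real_norm_def abs_norm_cancel gbound)
  have s2: "summable (\<lambda>n. \<integral>y. norm (g n y) \<partial>\<mu>)"
  proof (rule summable_comparison_test')
    show "summable (\<lambda>n. norm (a n * (1 / 2) ^ n) * measure \<mu> ?E)"
      using abs by (rule summable_mult2)
    fix n :: nat
    have "(\<integral>y. norm (g n y) \<partial>\<mu>) \<le> (\<integral>y. norm (a n * (1 / 2) ^ n) * indicator ?E y \<partial>\<mu>)"
      using fin nbhd_measurable bound
      by (intro integral_mono integrable_norm g integrable_mult_right integrable_real_indicator)
        (auto simp: g_def indicator_def)
    also have "\<dots> = norm (a n * (1 / 2) ^ n) * measure \<mu> ?E"
      using nbhd_measurable sets.sets_into_space[OF nbhd_measurable[of "\<one>\<^bsub>PSL2R\<^esub>"]]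
      by (simp only: integral_mult_right_zero) (simp add: Int_absorb2)
    finally show "norm (\<integral>y. norm (g n y) \<partial>\<mu>) \<le> norm (a n * (1 / 2) ^ n) * measure \<mu> ?E"
      by simp
  qed
  have eq: "suminf (\<lambda>n. g n y) = indicator ?E y *\<^sub>R h (psl2_act y \<i>)" for y
  proof (cases "y \<in> ?E")
    case True
    then have w: "psl2_act y \<i> \<in> \<H>"
      by (simp add: nbhd_def psl2_act_upper ii_upper)
    have "(\<lambda>n. a n * cayley (psl2_act y \<i>) ^ n) sums f (cayley (psl2_act y \<i>))"
      by (intro sums cayley_less_1 w)
    then show ?thesis using True by (simp add: g_def sums_iff f_def cayley_inverse[OF w])
  qed (simp add: g_def)
  show "integrable \<mu> (\<lambda>y. indicator ?E y *\<^sub>R h (psl2_act y \<i>))"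
    using integrable_suminf[OF g s1 s2] by (simp only: eq)
  have int: "(\<integral>y. g n y \<partial>\<mu>) = (if n = 0 then measure \<mu> ?E *\<^sub>R a 0 else 0)" for n
  proof (cases "n = 0")
    case True
    then show ?thesis
      using sets.sets_into_space[OF nbhd_measurable[of "\<one>\<^bsub>PSL2R\<^esub>"]] nbhd_measurable fin
      by (simp add: g_def Int_absorb2)
  next
    case False
    have "g n y = a n * (indicator ?E y *\<^sub>R cayley (psl2_act y \<i>) ^ n)" for y
      by (simp add: g_def)
    then have "(\<integral>y. g n y \<partial>\<mu>) = a n * (\<integral>y. indicator ?E y *\<^sub>R cayley (psl2_act y \<i>) ^ n \<partial>\<mu>)"
      by (simp only: integral_mult_right_zero)
    then show ?thesis using integral_cayley_power[OF False] False by simp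
  qed
  have c1: "(\<lambda>n. \<integral>y. g n y \<partial>\<mu>) sums (\<integral>y. indicator ?E y *\<^sub>R h (psl2_act y \<i>) \<partial>\<mu>)"
    using sums_integral[OF g s1 s2] by (simp only: eq)
  have c2: "(\<lambda>n. \<integral>y. g n y \<partial>\<mu>) sums (measure \<mu> ?E *\<^sub>R a 0)"
    unfolding int using sums_single[of 0 "\<lambda>n. measure \<mu> ?E *\<^sub>R a 0"] by simp
  have "a 0 = h \<i>" by (simp add: a_def f_def)
  then show "(\<integral>y. indicator ?E y *\<^sub>R h (psl2_act y \<i>) \<partial>\<mu>) = measure \<mu> ?E *\<^sub>R h \<i>"
    using sums_unique2[OF c1 c2] by simp
qed

lemma mean_value:
  assumes h: "h holomorphic_on \<H>" and x: "x \<in> carrier PSL2R"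
  shows "integrable \<mu> (\<lambda>y. indicator (nbhd x) y *\<^sub>R h (psl2_act y \<i>))"
    and "(\<integral>y. indicator (nbhd x) y *\<^sub>R h (psl2_act y \<i>) \<partial>\<mu>)
       = measure \<mu> (nbhd x) *\<^sub>R h (psl2_act x \<i>)"
proof -
  let ?f = "\<lambda>y. indicator (nbhd x) y *\<^sub>R h (psl2_act y \<i>)"
  let ?g = "\<lambda>y. indicator (nbhd \<one>\<^bsub>PSL2R\<^esub>) y *\<^sub>R (h \<circ> psl2_act x) (psl2_act y \<i>)"
  have hx: "(h \<circ> psl2_act x) holomorphic_on \<H>"
    by (rule holomorphic_on_compose_gen[OF psl2_act_holomorphic[OF x] h]) (use psl2_act_upper[OF x] in auto)
  have "(\<lambda>y. h (psl2_act y \<i>)) \<in> borel_measurable \<mu>"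
    by (intro continuous_measurable continuous_map_orbit_compose holomorphic_on_imp_continuous_on h)
  then have meas: "?f \<in> borel_measurable \<mu>"
    by (intro borel_measurable_scaleR borel_measurable_indicator nbhd_measurable)
  have eq: "?f (x \<star> y) = ?g y" if "y \<in> carrier PSL2R" for y
    using x that by (simp add: indicator_nbhd_one_mult psl2_act_mult ii_upper)
  have "integrable \<mu> (\<lambda>y. ?f (x \<star> y))"
    using mean_value_at_ii(1)[OF hx] by (rule Bochner_Integration.integrable_cong[THEN iffD2, rotated -1]) (auto simp: eq)
  then show "integrable \<mu> ?f"
    by (subst distr_left_mult[OF x, symmetric])
      (simp add: integrable_distr_eq[OF left_mult_measurable[OF x] meas])
  have "(\<integral>y. ?f y \<partial>\<mu>) = (\<integral>y. ?f (x \<star> y) \<partial>\<mu>)"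
    by (rule integral_left_mult[OF x meas, symmetric])
  also have "\<dots> = (\<integral>y. ?g y \<partial>\<mu>)"
    by (intro Bochner_Integration.integral_cong) (auto simp: eq)
  also have "\<dots> = measure \<mu> (nbhd x) *\<^sub>R h (psl2_act x \<i>)"
    using mean_value_at_ii(2)[OF hx] emeasure_nbhd[OF x] by (simp add: measure_def)
  finally show "(\<integral>y. ?f y \<partial>\<mu>) = measure \<mu> (nbhd x) *\<^sub>R h (psl2_act x \<i>)" .
qed

end


section \<open>Rigidity of the overlap on a quotient of finite volume\<close>

locale map_pair =
  fixes p q :: "complex \<Rightarrow> complex"
  assumes p: "p holomorphic_on \<H>" "p ` \<H> \<subseteq> \<H>"
    and q: "q holomorphic_on \<H>" "q ` \<H> \<subseteq> \<H>"
begin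

definition s :: "complex \<Rightarrow> real" where "s w = overlap (p w) (q w)"

lemma p_upper: "w \<in> \<H> \<Longrightarrow> p w \<in> \<H>"
  and q_upper: "w \<in> \<H> \<Longrightarrow> q w \<in> \<H>"
  using p(2) q(2) by auto

lemma s_bounds:
  assumes "w \<in> \<H>"
  shows "0 \<le> s w" "s w \<le> 1" "s w = 1 \<longleftrightarrow> p w = q w"
  using p_upper[OF assms] q_upper[OF assms]
  by (simp_all add: s_def upper_half_plane_iff overlap_nonneg overlap_le_1 overlap_eq_1_iff)

lemma continuous_on_s: "continuous_on \<H> s"
proof -
  have "p w - cnj (q w) \<noteq> 0" if "w \<in> \<H>" for w
    using p_upper[OF that] q_upper[OF that] by (auto simp: upper_half_plane_iff complex_eq_iff)
  then show ?thesis
    unfolding s_def[abs_def] overlap_def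
    by (intro continuous_intros holomorphic_on_imp_continuous_on p(1) q(1)) auto
qed

text \<open>Applied to \<open>T (p w)\<close> and \<open>T (q w)\<close>, where the chart \<open>T\<close> makes both real at \<open>w = z\<close>, the comparison in
  the right half-plane yields a majorant of \<open>s\<close> that touches it at \<open>z\<close>. Where the two agree on a
  neighbourhood of \<open>z\<close>, \<open>T (p w)\<close> is real, contradicting the open mapping theorem unless \<open>p\<close> is
  constant.\<close>

lemma holomorphic_majorant:
  assumes z: "z \<in> \<H>" and ne: "p z \<noteq> q z"
  obtains \<Phi> where "\<Phi> holomorphic_on \<H>"
    "\<And>w. w \<in> \<H> \<Longrightarrow> s w \<le> Re (\<Phi> w)" "s z = Re (\<Phi> z)"
    "\<And>V. open V \<Longrightarrow> z \<in> V \<Longrightarrow> V \<subseteq> \<H> \<Longrightarrow> \<forall>w\<in>V. s w = Re (\<Phi> w) \<Longrightarrow>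
       p constant_on \<H>"
proof -
  obtain T where T: "T holomorphic_on \<H>" "inj_on T \<H>"
    "\<And>z. z \<in> \<H> \<Longrightarrow> 0 < Re (T z)" "Im (T (p z)) = 0" "Im (T (q z)) = 0"
    "\<And>z w. z \<in> \<H> \<Longrightarrow> w \<in> \<H> \<Longrightarrow>
       overlap z w = 2 * sqrt (Re (T z) * Re (T w)) / cmod (T z + cnj (T w))"
    using geodesic_chart[of "p z" "q z"] ne p_upper[OF z] q_upper[OF z]
    unfolding upper_half_plane_iff by metis
  define \<Phi> where "\<Phi> w = 2 * csqrt (T (p w)) * csqrt (T (q w)) / (T (p w) + T (q w))" for w
  have hol: "(\<lambda>w. T (p w)) holomorphic_on \<H>" "(\<lambda>w. T (q w)) holomorphic_on \<H>"
    using holomorphic_on_compose_gen[OF p(1) T(1) p(2)] holomorphic_on_compose_gen[OF q(1) T(1) q(2)]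
    by (simp_all add: o_def)
  have pos: "0 < Re (T (p w))" "0 < Re (T (q w))" if "w \<in> \<H>" for w
    using that by (simp_all add: T(3) p_upper q_upper)
  have "T (p w) + T (q w) \<noteq> 0" if "w \<in> \<H>" for w
    using pos[OF that] by (auto simp: complex_eq_iff)
  moreover have "T (p w) \<notin> \<real>\<^sub>\<le>\<^sub>0" "T (q w) \<notin> \<real>\<^sub>\<le>\<^sub>0" if "w \<in> \<H>" for w
    using pos[OF that] by (auto simp: complex_nonpos_Reals_iff)
  ultimately have 1: "\<Phi> holomorphic_on \<H>"
    unfolding \<Phi>_def[abs_def] by (intro holomorphic_intros hol) auto
  have s: "s w = 2 * sqrt (Re (T (p w)) * Re (T (q w))) / cmod (T (p w) + cnj (T (q w)))"
    if "w \<in> \<H>" for w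
    unfolding s_def by (intro T(6) p_upper q_upper that)
  have 2: "s w \<le> Re (\<Phi> w)" if "w \<in> \<H>" for w
    unfolding s[OF that] \<Phi>_def by (rule right_half_plane_overlap_le[OF pos[OF that]])
  have 3: "s z = Re (\<Phi> z)"
    unfolding s[OF z] \<Phi>_def by (rule right_half_plane_overlap_real[OF pos[OF z] T(4,5)])
  have 4: "p constant_on \<H>"
    if V: "open V" "z \<in> V" "V \<subseteq> \<H>" and eq: "\<forall>w\<in>V. s w = Re (\<Phi> w)" for V
  proof (rule ccontr)
    assume nc: "\<not> p constant_on \<H>"
    define U where "U = {w \<in> V. p w - q w \<noteq> 0}"
    have "continuous_on V (\<lambda>w. p w - q w)"
      using holomorphic_on_imp_continuous_on[OF p(1)] holomorphic_on_imp_continuous_on[OF q(1)] V(3)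
      by (intro continuous_intros) (auto intro: continuous_on_subset)
    then have "open U" unfolding U_def
      using continuous_open_preimage[OF _ V(1), of "\<lambda>w. p w - q w" "- {0}"]
      by (simp add: vimage_def Int_def open_Compl)
    have "z \<in> U" using V ne by (simp add: U_def)
    have "\<not> (\<lambda>w. T (p w)) constant_on \<H>"
    proof
      assume "(\<lambda>w. T (p w)) constant_on \<H>"
      then have "T (p w) = T (p z)" if "w \<in> \<H>" for w
        using that z unfolding constant_on_def by metis
      then have "p w = p z" if "w \<in> \<H>" for w
        using that z inj_onD[OF T(2)] p_upper by metis
      then show False using nc unfolding constant_on_def by blast
    qed
    then have "open ((\<lambda>w. T (p w)) ` U)"
      using V(3) by (intro open_mapping_thm[OF hol(1) open_upper_half_plane connected_upper_half_plane \<open>open U\<close>])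
        (auto simp: U_def)
    then obtain e where e: "e > 0" "ball (T (p z)) e \<subseteq> (\<lambda>w. T (p w)) ` U"
      using \<open>z \<in> U\<close> by (meson imageI openE)
    have "T (p z) + \<i> * of_real (e / 2) \<in> ball (T (p z)) e"
      using e(1) by (simp add: dist_norm norm_mult)
    then obtain w where w: "w \<in> U" "T (p z) + \<i> * of_real (e / 2) = T (p w)"
      using e(2) by blast
    have wH: "w \<in> \<H>" "w \<in> V" "p w \<noteq> q w" using w(1) V(3) by (auto simp: U_def)
    have "T (p w) \<noteq> T (q w)"
      using wH(3) inj_onD[OF T(2)] p_upper[OF wH(1)] q_upper[OF wH(1)] by blast
    moreover have "s w = Re (\<Phi> w)" using eq wH(2) by blast
    ultimately have "Im (T (p w)) = 0"
      unfolding s[OF wH(1)] \<Phi>_def by (intro right_half_plane_overlap_eq[OF pos[OF wH(1)]])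
    then show False using arg_cong[OF w(2), of Im] T(4) e(1) by simp
  qed
  show ?thesis using that[OF 1 2 3 4] .
qed

end

locale haar_map_pair = haar + map_pair
begin

lemma s_measurable: "(\<lambda>y. s (psl2_act y \<i>)) \<in> borel_measurable \<mu>"
  by (intro continuous_measurable continuous_map_orbit_compose continuous_on_s)

lemma nn_integral_s:
  assumes "x \<in> carrier PSL2R"
  shows "integrable \<mu> (\<lambda>y. indicator (nbhd x) y *\<^sub>R s (psl2_act y \<i>))"
    and "(\<integral>\<^sup>+y. indicator (nbhd x) y * ennreal (s (psl2_act y \<i>)) \<partial>\<mu>)
       = ennreal (\<integral>y. indicator (nbhd x) y *\<^sub>R s (psl2_act y \<i>) \<partial>\<mu>)"
proof -
  show int: "integrable \<mu> (\<lambda>y. indicator (nbhd x) y *\<^sub>R s (psl2_act y \<i>))"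
    using s_bounds orbit_upper
    by (intro integrableI_bounded_set_indicator[where B = 1] nbhd_measurable s_measurable
        emeasure_nbhd_finite assms AE_I2) auto
  have "(\<integral>\<^sup>+y. indicator (nbhd x) y * ennreal (s (psl2_act y \<i>)) \<partial>\<mu>)
      = (\<integral>\<^sup>+y. ennreal (indicator (nbhd x) y *\<^sub>R s (psl2_act y \<i>)) \<partial>\<mu>)"
    by (intro nn_integral_cong) (simp split: split_indicator)
  also have "\<dots> = ennreal (\<integral>y. indicator (nbhd x) y *\<^sub>R s (psl2_act y \<i>) \<partial>\<mu>)"
    using s_bounds orbit_upper by (intro nn_integral_eq_integral int AE_I2) auto
  finally show "(\<integral>\<^sup>+y. indicator (nbhd x) y * ennreal (s (psl2_act y \<i>)) \<partial>\<mu>)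
       = ennreal (\<integral>y. indicator (nbhd x) y *\<^sub>R s (psl2_act y \<i>) \<partial>\<mu>)" .
qed

text \<open>Where \<open>p z \<noteq> q z\<close> the mean value property of the majorant gives the inequality, and equality makes
  the continuous nonnegative difference vanish on the whole disc. Where \<open>p z = q z\<close>, the value
  \<open>s z = 1\<close> is maximal.\<close>

lemma
  assumes x: "x \<in> carrier PSL2R"
  defines "z \<equiv> psl2_act x \<i>"
    and "I \<equiv> (\<integral>\<^sup>+y. indicator (nbhd x) y * ennreal (s (psl2_act y \<i>)) \<partial>\<mu>)"
  shows super_mean_value: "I \<le> ennreal (s z) * emeasure \<mu> (nbhd x)"
    and super_mean_value_eq:
      "I = ennreal (s z) * emeasure \<mu> (nbhd x) \<Longrightarrow> p z \<noteq> q z \<Longrightarrow> p constant_on \<H>"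
proof -
  let ?E = "nbhd x"
  let ?J = "\<integral>y. indicator ?E y *\<^sub>R s (psl2_act y \<i>) \<partial>\<mu>"
  have z: "z \<in> \<H>" using orbit_upper[OF x] by (simp add: z_def)
  have fin: "emeasure \<mu> ?E < \<infinity>" by (rule emeasure_nbhd_finite[OF x])
  then have em: "emeasure \<mu> ?E = ennreal (measure \<mu> ?E)"
    by (simp add: emeasure_eq_ennreal_measure less_top[symmetric])
  have I: "I = ennreal ?J" unfolding I_def by (rule nn_integral_s(2)[OF x])
  have prod: "ennreal (s z) * emeasure \<mu> ?E = ennreal (measure \<mu> ?E * s z)"
    using s_bounds[OF z] by (simp add: em ennreal_mult mult.commute)
  have main: "?J \<le> measure \<mu> ?E * s z \<and> (?J = measure \<mu> ?E * s z \<longrightarrow> p constant_on \<H>)"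
    if ne: "p z \<noteq> q z"
  proof -
    obtain \<Phi> where \<Phi>: "\<Phi> holomorphic_on \<H>"
      "\<And>w. w \<in> \<H> \<Longrightarrow> s w \<le> Re (\<Phi> w)" "s z = Re (\<Phi> z)"
      and const: "\<And>V. open V \<Longrightarrow> z \<in> V \<Longrightarrow> V \<subseteq> \<H> \<Longrightarrow> \<forall>w\<in>V. s w = Re (\<Phi> w) \<Longrightarrow>
        p constant_on \<H>"
      using holomorphic_majorant[OF z ne] by metis
    define D where "D w = Re (\<Phi> w) - s w" for w
    have D0: "D w \<ge> 0" if "w \<in> \<H>" for w using \<Phi>(2)[OF that] by (simp add: D_def)
    note mv = mean_value[OF \<Phi>(1) x]
    have Reint: "integrable \<mu> (\<lambda>y. indicator ?E y *\<^sub>R Re (\<Phi> (psl2_act y \<i>)))"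
      "(\<integral>y. indicator ?E y *\<^sub>R Re (\<Phi> (psl2_act y \<i>)) \<partial>\<mu>) = measure \<mu> ?E * s z"
      using integrable_Re[OF mv(1)] integral_Re[OF mv(1)] unfolding mv(2)
      by (simp_all add: z_def[symmetric] \<Phi>(3))
    have Dint: "integrable \<mu> (\<lambda>y. indicator ?E y *\<^sub>R D (psl2_act y \<i>))"
      "(\<integral>y. indicator ?E y *\<^sub>R D (psl2_act y \<i>) \<partial>\<mu>) = measure \<mu> ?E * s z - ?J"
      unfolding D_def scaleR_diff_right
      using Reint nn_integral_s(1)[OF x] by (simp_all del: scaleR_conv_of_real real_scaleR_def)
    have nonneg: "AE y in \<mu>. 0 \<le> indicator ?E y *\<^sub>R D (psl2_act y \<i>)"
      using D0 orbit_upper by (intro AE_I2) auto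
    have le: "?J \<le> measure \<mu> ?E * s z"
      using integral_nonneg_AE[OF nonneg] unfolding Dint(2) by simp
    have "p constant_on \<H>" if eq: "?J = measure \<mu> ?E * s z"
    proof -
      have "(\<integral>y. indicator ?E y *\<^sub>R D (psl2_act y \<i>) \<partial>\<mu>) = 0" unfolding Dint(2) using eq by simp
      then have ae: "AE y in \<mu>. indicator ?E y *\<^sub>R D (psl2_act y \<i>) = 0"
        using integral_nonneg_eq_0_iff_AE[OF Dint(1) nonneg] by blast
      define V where "V = {w \<in> \<H>. hyp_near z w}"
      have V: "open V" "z \<in> V" "V \<subseteq> \<H>"
        using open_Int[OF open_upper_half_plane open_hyp_near[of z]] z hyp_near_refl[OF z]
        by (auto simp: V_def Collect_conj_eq)
      have contD: "continuous_on \<H> D"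
        unfolding D_def[abs_def]
        by (intro continuous_intros continuous_on_s holomorphic_on_imp_continuous_on \<Phi>(1))
      define W where "W = {w \<in> V. D w > 0}"
      have "open W"
        using continuous_open_preimage[OF continuous_on_subset[OF contD V(3)] V(1), of "{0<..}"]
        by (simp add: W_def vimage_def Int_def)
      define O' where "O' = {y \<in> carrier PSL2R. psl2_act y \<i> \<in> W}"
      have O': "openin PSL2R_topology O'"
        unfolding O'_def by (rule openin_orbit_vimage[OF \<open>open W\<close>])
      have sub: "y \<in> ?E \<and> D (psl2_act y \<i>) > 0" if "y \<in> O'" for y
        using that by (simp add: O'_def W_def V_def nbhd_def z_def)
      have "AE y in \<mu>. y \<notin> O'"
        using ae by (rule eventually_mono) (use sub in force)
      then have "emeasure \<mu> O' = 0"
        using AE_iff_measurable[OF open_measurable[OF O'], of "\<lambda>y. y \<notin> O'"]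
          sets.sets_into_space[OF open_measurable[OF O']] by auto
      then have "O' = {}" using open_nonnull[OF O'] by blast
      have "s w = Re (\<Phi> w)" if "w \<in> V" for w
      proof -
        have wH: "w \<in> \<H>" using that V(3) by blast
        obtain y where y: "y \<in> carrier PSL2R" "psl2_act y \<i> = w" by (rule psl2_act_transitive[OF wH])
        then have "y \<notin> O'" using \<open>O' = {}\<close> by simp
        then have "w \<notin> W" using y by (simp add: O'_def)
        then show ?thesis using that D0[OF wH] by (auto simp: W_def D_def)
      qed
      then show ?thesis using const[OF V] by blast
    qed
    with le show ?thesis by blast
  qed
  show "I \<le> ennreal (s z) * emeasure \<mu> ?E"
  proof (cases "p z = q z")
    case True
    have "I \<le> (\<integral>\<^sup>+y. indicator ?E y \<partial>\<mu>)"
      unfolding I_def using s_bounds orbit_upper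
      by (intro nn_integral_mono) (auto split: split_indicator simp: ennreal_le_1)
    also have "\<dots> = ennreal (s z) * emeasure \<mu> ?E"
      using True s_bounds(3)[OF z] by (simp add: nbhd_measurable)
    finally show ?thesis .
  next
    case False
    then show ?thesis unfolding I prod using main by (intro ennreal_leI) simp
  qed
  show "p constant_on \<H>" if eq: "I = ennreal (s z) * emeasure \<mu> ?E" and ne: "p z \<noteq> q z"
  proof -
    have "?J \<ge> 0" using s_bounds orbit_upper by (intro integral_nonneg_AE AE_I2) auto
    moreover have "measure \<mu> ?E * s z \<ge> 0" using s_bounds[OF z] by simp
    ultimately have "?J = measure \<mu> ?E * s z" using eq unfolding I prod by simp
    then show ?thesis using main[OF ne] by blast
  qed
qed

end

lemma (in haar_lattice) sigma_finite: "sigma_finite_measure \<mu>"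
proof
  show "\<exists>A. countable A \<and> A \<subseteq> sets \<mu> \<and> \<Union>A = space \<mu> \<and> (\<forall>a\<in>A. emeasure \<mu> a \<noteq> \<infinity>)"
  proof (intro exI conjI)
    let ?A = "(\<lambda>\<gamma>. \<gamma> <#\<^bsub>PSL2R\<^esub> F) ` \<Gamma>"
    show "countable ?A" using countable by simp
    show A: "?A \<subseteq> sets \<mu>" using carrierI F_measurable l_coset_measurable by auto
    show "\<forall>a\<in>?A. emeasure \<mu> a \<noteq> \<infinity>"
      using carrierI F_measurable F_finite by (auto simp: emeasure_l_coset)
    show "\<Union>?A = space \<mu>"
    proof (intro equalityI subsetI)
      fix x assume "x \<in> space \<mu>"
      then have x: "x \<in> carrier PSL2R" by simp
      from ex1_translate[OF this] obtain \<gamma> where \<gamma>: "\<gamma> \<in> \<Gamma>" "inv\<^bsub>PSL2R\<^esub> \<gamma> \<star> x \<in> F"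
        unfolding Ex1_def by blast
      moreover have "x = \<gamma> \<star> (inv\<^bsub>PSL2R\<^esub> \<gamma> \<star> x)"
        using PSL2R_cancel(2)[OF carrierI[OF \<gamma>(1)] x] by simp
      ultimately show "x \<in> \<Union>?A" unfolding l_coset_def by blast
    qed (use A sets.sets_into_space in blast)
  qed
qed

text \<open>The average of \<open>s\<close> over a hyperbolic disc never exceeds its central value, while both have
  the same integral over a fundamental domain. So they agree almost everywhere, in particular at
  some point where \<open>p\<close> and \<open>q\<close> differ, as soon as there is any.\<close>

theorem overlap_rigidity:
  assumes \<Gamma>: "lattice_PSL2R \<Gamma>"
    and p: "p holomorphic_on \<H>" "p ` \<H> \<subseteq> \<H>"
    and q: "q holomorphic_on \<H>" "q ` \<H> \<subseteq> \<H>"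
    and inv: "\<And>\<gamma> z. \<gamma> \<in> \<Gamma> \<Longrightarrow> z \<in> \<H> \<Longrightarrow>
      overlap (p (psl2_act \<gamma> z)) (q (psl2_act \<gamma> z)) = overlap (p z) (q z)"
    and nc: "\<not> p constant_on \<H>"
    and z: "z \<in> \<H>"
  shows "p z = q z"
proof (rule ccontr)
  assume ne: "p z \<noteq> q z"
  obtain \<mu> F where "haar_lattice \<mu> \<Gamma> F" by (rule lattice_haar_lattice[OF \<Gamma>])
  then interpret haar_lattice \<mu> \<Gamma> F .
  interpret haar_map_pair \<mu> p q by unfold_locales (fact p q)+
  interpret sigma_finite_measure \<mu> by (rule sigma_finite)
  define C where "C = emeasure \<mu> (nbhd \<one>\<^bsub>PSL2R\<^esub>)"
  define f where "f y = ennreal (s (psl2_act y \<i>))" for y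
  define k :: "psl2 \<Rightarrow> psl2 \<Rightarrow> ennreal" where "k x y = indicator (nbhd x) y" for x y
  define I where "I x = (\<integral>\<^sup>+y. k x y * f y \<partial>\<mu>)" for x
  have s_inv: "s (psl2_act \<gamma> w) = s w" if "\<gamma> \<in> \<Gamma>" "w \<in> \<H>" for \<gamma> w
    using inv[OF that] by (simp add: s_def)
  have f: "f \<in> borel_measurable \<mu>" unfolding f_def[abs_def] using s_measurable by measurable
  have finv: "f (\<gamma> \<star> y) = f y" if "\<gamma> \<in> \<Gamma>" "y \<in> carrier PSL2R" for \<gamma> y
    using that carrierI by (simp add: f_def psl2_act_mult ii_upper s_inv orbit_upper)
  define orb where "orb y = psl2_act y \<i>" for y
  have orb [measurable]: "orb \<in> borel_measurable \<mu>"
    unfolding orb_def[abs_def] by (rule orbit_measurable[OF ii_upper])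
  have k: "(\<lambda>p. k (fst p) (snd p)) \<in> borel_measurable (\<mu> \<Otimes>\<^sub>M \<mu>)"
  proof -
    let ?P = "{p \<in> space (\<mu> \<Otimes>\<^sub>M \<mu>). (cmod (orb (fst p) - orb (snd p)))\<^sup>2 < Im (orb (fst p)) * Im (orb (snd p))}"
    have "?P \<in> sets (\<mu> \<Otimes>\<^sub>M \<mu>)" by measurable
    then have "(indicator ?P :: _ \<Rightarrow> ennreal) \<in> borel_measurable (\<mu> \<Otimes>\<^sub>M \<mu>)" by (rule borel_measurable_indicator)
    then show ?thesis
      by (rule measurable_cong[THEN iffD1, rotated])
        (auto simp: k_def nbhd_def hyp_near_def indicator_def space_pair_measure orb_def)
  qed
  have Cfin: "C < \<infinity>" unfolding C_def by (rule emeasure_nbhd_finite) simp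
  have kint: "(\<integral>\<^sup>+y. k x y \<partial>\<mu>) = C" if "x \<in> carrier PSL2R" for x
    using emeasure_nbhd[OF that] by (simp add: k_def C_def nbhd_measurable)
  have "(\<integral>\<^sup>+x. I x \<partial>N) = (\<integral>\<^sup>+x. f x * (\<integral>\<^sup>+y. k x y \<partial>\<mu>) \<partial>N)"
    unfolding I_def
  proof (rule symmetric_kernel_integral[OF k _ _ f finv])
    show "k x y = k y x" if "x \<in> carrier PSL2R" "y \<in> carrier PSL2R" for x y
      using that by (simp add: k_def nbhd_def indicator_def hyp_near_commute)
    show "k (g \<star> x) (g \<star> y) = k x y"
      if "g \<in> \<Gamma>" "x \<in> carrier PSL2R" "y \<in> carrier PSL2R" for g x y
      using nbhd_mult[OF carrierI[OF that(1)] that(2,3)] by (simp add: k_def indicator_def)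
  qed
  also have "\<dots> = (\<integral>\<^sup>+x. f x * C \<partial>N)"
    by (intro nn_integral_cong) (simp add: kint space_N F_carrier)
  finally have same: "(\<integral>\<^sup>+x. I x \<partial>N) = (\<integral>\<^sup>+x. f x * C \<partial>N)" .
  have le: "I x \<le> f x * C" if "x \<in> carrier PSL2R" for x
    using super_mean_value[OF that] emeasure_nbhd[OF that] by (simp add: I_def f_def k_def C_def)
  have fN: "f \<in> borel_measurable N" by (rule measurable_restrict_space1[OF f])
  have "I \<in> borel_measurable \<mu>"
    unfolding I_def[abs_def] by (rule borel_measurable_nn_integral)
      (unfold case_prod_unfold, rule borel_measurable_times_ennreal[OF k measurable_compose[OF measurable_snd f]])
  then have IN: "I \<in> borel_measurable N" by (rule measurable_restrict_space1)
  have "(\<integral>\<^sup>+x. f x * C \<partial>N) \<le> (\<integral>\<^sup>+x. C \<partial>N)"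
  proof (intro nn_integral_mono)
    fix x assume "x \<in> space N"
    then have "f x \<le> 1" using s_bounds orbit_upper F_carrier by (simp add: f_def space_N ennreal_le_1)
    then have "f x * C \<le> 1 * C" by (rule mult_right_mono) simp
    then show "f x * C \<le> C" by simp
  qed
  also have "\<dots> = C * emeasure N F" unfolding nn_integral_const space_N ..
  also have "\<dots> < \<infinity>"
    using Cfin finite_measure.emeasure_finite[OF finite_measure_N] by (simp add: ennreal_mult_less_top less_top)
  finally have fin: "(\<integral>\<^sup>+x. I x \<partial>N) \<noteq> \<infinity>" using same by simp
  have "(\<integral>\<^sup>+x. f x * C - I x \<partial>N) = (\<integral>\<^sup>+x. f x * C \<partial>N) - (\<integral>\<^sup>+x. I x \<partial>N)"
    using le F_carrier by (intro nn_integral_diff IN borel_measurable_times_ennreal fN fin AE_I2) (auto simp: space_N)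
  also have "\<dots> = 0" using fin unfolding same by simp
  finally have "AE x in N. f x * C - I x = 0"
    using IN fN by (subst (asm) nn_integral_0_iff_AE) auto
  then have ae: "AE x in N. I x = f x * C"
  proof (rule AE_mp, intro AE_I2 impI antisym)
    fix x assume x: "x \<in> space N" and 0: "f x * C - I x = 0"
    show "I x \<le> f x * C" using le F_carrier x by (simp add: space_N)
    show "f x * C \<le> I x" using 0 by (rule ennreal_minus_eq_0)
  qed
  define O' where "O' = {y \<in> carrier PSL2R. s (psl2_act y \<i>) \<noteq> 1}"
  have O': "openin PSL2R_topology O'"
    using openin_continuous_map_preimage[OF continuous_map_orbit_compose[OF continuous_on_s], of "- {1}"]
    by (simp add: O'_def topspace_PSL2R_topology open_Compl)
  obtain y where "y \<in> carrier PSL2R" "psl2_act y \<i> = z" by (rule psl2_act_transitive[OF z])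
  then have "y \<in> O'" using ne s_bounds(3)[OF z] by (simp add: O'_def)
  then have "emeasure \<mu> O' \<noteq> 0" using open_nonnull[OF O'] by blast
  moreover have "emeasure \<mu> O' = 0" if null: "AE x in N. x \<notin> O'"
  proof -
    have "emeasure \<mu> O' = (\<integral>\<^sup>+x. indicator O' x \<partial>\<mu>)" by (simp add: open_measurable[OF O'])
    also have "\<dots> = (\<integral>\<^sup>+\<gamma>. \<integral>\<^sup>+x. indicator O' (\<gamma> \<star> x) \<partial>N \<partial>count_space \<Gamma>)"
      by (intro nn_integral_unfold borel_measurable_indicator open_measurable[OF O'])
    also have "\<dots> = (\<integral>\<^sup>+\<gamma>. \<integral>\<^sup>+x. 0 \<partial>N \<partial>count_space \<Gamma>)"
    proof (rule nn_integral_cong, rule nn_integral_cong_AE)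
      fix \<gamma> assume "\<gamma> \<in> space (count_space \<Gamma>)"
      then have \<gamma>: "\<gamma> \<in> \<Gamma>" by simp
      have "\<gamma> \<star> x \<in> O' \<longleftrightarrow> x \<in> O'" if "x \<in> F" for x
        using F_carrier[OF that] carrierI[OF \<gamma>] \<gamma>
        by (simp add: O'_def psl2_act_mult ii_upper s_inv orbit_upper)
      then show "AE x in N. indicator O' (\<gamma> \<star> x) = (0::ennreal)"
        by (intro AE_mp[OF null, OF AE_I2]) (simp add: space_N)
    qed
    finally show ?thesis by simp
  qed
  ultimately have "\<not> (AE x in N. x \<notin> O')" by blast
  moreover have "AE x in N. x \<notin> O'" if "\<forall>x\<in>space N. I x = f x * C \<longrightarrow> x \<notin> O'"
    by (rule AE_mp[OF ae]) (rule AE_I2, use that in blast)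
  ultimately obtain x where x: "x \<in> F" "I x = f x * C" "x \<in> O'" by (auto simp: space_N)
  have xc: "x \<in> carrier PSL2R" by (rule F_carrier[OF x(1)])
  have "p (psl2_act x \<i>) \<noteq> q (psl2_act x \<i>)"
    using x(3) s_bounds(3)[OF orbit_upper[OF xc]] by (simp add: O'_def)
  then show False
    using super_mean_value_eq[OF xc] x(2) emeasure_nbhd[OF xc] nc by (simp add: I_def f_def k_def C_def)
qed


section \<open>Subgroups of finite index\<close>

text \<open>All cosets are taken in the ambient group, so that chains of subgroups and conjugates can be
  compared without changing the group structure.\<close>

definition fin_index :: "psl2 set \<Rightarrow> psl2 set \<Rightarrow> bool" where
  "fin_index H K \<longleftrightarrow> subgroup H PSL2R \<and> subgroup K PSL2R \<and> H \<subseteq> K \<and>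
     finite ((\<lambda>x. H #>\<^bsub>PSL2R\<^esub> x) ` K)"

lemma finite_index_subgroup_iff:
  assumes "subgroup K PSL2R" "subgroup H PSL2R"
  shows "finite_index_subgroup H (PSL2R\<lparr>carrier := K\<rparr>) \<longleftrightarrow> fin_index H K"
proof -
  have "subgroup H (PSL2R\<lparr>carrier := K\<rparr>) \<longleftrightarrow> H \<subseteq> K"
    using PSL2R.subgroup_incl[OF assms(2,1)] subgroup.subset by fastforce
  moreover have "group (PSL2R\<lparr>carrier := K\<rparr>)"
    by (rule PSL2R.subgroup_imp_group[OF assms(1)])
  moreover have "rcosets\<^bsub>PSL2R\<lparr>carrier := K\<rparr>\<^esub> H = (\<lambda>x. H #>\<^bsub>PSL2R\<^esub> x) ` K"
    by (auto simp: RCOSETS_def r_coset_def)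
  ultimately show ?thesis
    using assms by (simp add: finite_index_subgroup_def fin_index_def)
qed

lemma fin_index_refl: "subgroup K PSL2R \<Longrightarrow> fin_index K K"
proof -
  assume K: "subgroup K PSL2R"
  have "(\<lambda>x. K #>\<^bsub>PSL2R\<^esub> x) ` K \<subseteq> {K}"
    using PSL2R.coset_join2[OF subgroup.mem_carrier[OF K] K] by auto
  then have "finite ((\<lambda>x. K #>\<^bsub>PSL2R\<^esub> x) ` K)" by (rule finite_subset) simp
  then show "fin_index K K" using K by (simp add: fin_index_def)
qed

lemma fin_index_subset:
  assumes "fin_index L K" "subgroup H PSL2R" "L \<subseteq> H" "H \<subseteq> K"
  shows "fin_index L H"
  using assms finite_subset[OF image_mono[OF assms(4), of "\<lambda>x. L #>\<^bsub>PSL2R\<^esub> x"]] by (simp add: fin_index_def)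

lemma fin_index_trans:
  assumes LH: "fin_index L H" and HK: "fin_index H K"
  shows "fin_index L K"
proof -
  define cL where "cL = (\<lambda>x. L #>\<^bsub>PSL2R\<^esub> x)"
  define cH where "cH = (\<lambda>x. H #>\<^bsub>PSL2R\<^esub> x)"
  define tr :: "psl2 \<Rightarrow> psl2 set \<Rightarrow> psl2 set" where "tr = (\<lambda>t C. C #>\<^bsub>PSL2R\<^esub> t)"
  have sub: "subgroup L PSL2R" "subgroup H PSL2R" "subgroup K PSL2R" "L \<subseteq> H" "H \<subseteq> K"
    and fin: "finite (cL ` H)" "finite (cH ` K)"
    using LH HK by (simp_all add: fin_index_def cL_def cH_def)
  obtain T where T: "T \<subseteq> K" "finite T" "cH ` K = cH ` T"
    using finite_subset_image[OF fin(2) subset_refl] by blast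
  have "cL ` K \<subseteq> (\<Union>t\<in>T. tr t ` (cL ` H))"
  proof
    fix C assume "C \<in> cL ` K"
    then obtain x where x: "x \<in> K" "C = cL x" by blast
    then obtain t where t: "t \<in> T" "cH x = cH t" using T(3) by blast
    have c: "x \<in> carrier PSL2R" "t \<in> carrier PSL2R"
      using x(1) t(1) T(1) subgroup.mem_carrier[OF sub(3)] by blast+
    have "x \<in> cH x" unfolding cH_def by (rule PSL2R.rcos_self[OF c(1) sub(2)])
    then have "x \<in> H #>\<^bsub>PSL2R\<^esub> t" unfolding t(2) by (simp only: cH_def)
    then obtain h where h: "h \<in> H" "x = h \<star> t" by (auto simp: r_coset_def)
    have "C = tr t (cL h)"
      unfolding x(2) h(2) cL_def tr_def
      by (rule PSL2R.coset_mult_assoc[OF subgroup.subset[OF sub(1)]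
          subgroup.mem_carrier[OF sub(2) h(1)] c(2), symmetric])
    then show "C \<in> (\<Union>t\<in>T. tr t ` (cL ` H))" using t(1) h(1) by blast
  qed
  moreover have "finite (\<Union>t\<in>T. tr t ` (cL ` H))" using T(2) fin(1) by simp
  ultimately have "finite (cL ` K)" by (rule finite_subset)
  then show ?thesis
    unfolding fin_index_def cL_def using sub(1,3) subset_trans[OF sub(4,5)] by (intro conjI)
qed

lemma r_coset_Int:
  assumes "subgroup H PSL2R" "x \<in> carrier PSL2R" "H \<subseteq> carrier PSL2R" "L \<subseteq> carrier PSL2R"
  shows "(H \<inter> L) #>\<^bsub>PSL2R\<^esub> x = (H #>\<^bsub>PSL2R\<^esub> x) \<inter> (L #>\<^bsub>PSL2R\<^esub> x)"
proof (intro equalityI subsetI)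
  fix y assume "y \<in> (H #>\<^bsub>PSL2R\<^esub> x) \<inter> (L #>\<^bsub>PSL2R\<^esub> x)"
  then obtain h l where hl: "h \<in> H" "l \<in> L" "y = h \<star> x" "y = l \<star> x"
    by (auto simp: r_coset_def)
  then have "h = l" using PSL2R.r_cancel[of h x l] subsetD[OF assms(3)] subsetD[OF assms(4)] assms(2) by simp
  then show "y \<in> (H \<inter> L) #>\<^bsub>PSL2R\<^esub> x" using hl by (auto simp: r_coset_def)
qed (auto simp: r_coset_def)

lemma fin_index_Int:
  assumes "fin_index H K" "fin_index L K"
  shows "fin_index (H \<inter> L) K"
proof -
  have sub: "subgroup H PSL2R" "subgroup L PSL2R" "subgroup K PSL2R" "H \<subseteq> K"
    and fin: "finite ((\<lambda>x. H #>\<^bsub>PSL2R\<^esub> x) ` K)" "finite ((\<lambda>x. L #>\<^bsub>PSL2R\<^esub> x) ` K)"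
    using assms by (auto simp: fin_index_def)
  have "(\<lambda>x. (H \<inter> L) #>\<^bsub>PSL2R\<^esub> x) ` K
      \<subseteq> (\<lambda>(C, D). C \<inter> D) ` ((\<lambda>x. H #>\<^bsub>PSL2R\<^esub> x) ` K \<times> (\<lambda>x. L #>\<^bsub>PSL2R\<^esub> x) ` K)"
  proof
    fix C assume "C \<in> (\<lambda>x. (H \<inter> L) #>\<^bsub>PSL2R\<^esub> x) ` K"
    then obtain x where x: "x \<in> K" "C = (H \<inter> L) #>\<^bsub>PSL2R\<^esub> x" by blast
    have "C = (case (H #>\<^bsub>PSL2R\<^esub> x, L #>\<^bsub>PSL2R\<^esub> x) of (C, D) \<Rightarrow> C \<inter> D)"
      using r_coset_Int[OF sub(1) subgroup.mem_carrier[OF sub(3) x(1)] subgroup.subset[OF sub(1)]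
          subgroup.subset[OF sub(2)]] by (simp add: x(2))
    then show "C \<in> (\<lambda>(C, D). C \<inter> D) ` ((\<lambda>x. H #>\<^bsub>PSL2R\<^esub> x) ` K \<times> (\<lambda>x. L #>\<^bsub>PSL2R\<^esub> x) ` K)"
      by (rule image_eqI) (use x(1) in blast)
  qed
  then have "finite ((\<lambda>x. (H \<inter> L) #>\<^bsub>PSL2R\<^esub> x) ` K)"
    by (rule finite_subset) (use fin in simp)
  moreover have "subgroup (H \<inter> L) PSL2R" by (rule PSL2R.subgroups_Inter_pair[OF sub(1,2)])
  ultimately show ?thesis using sub unfolding fin_index_def by blast
qed

lemma psl2_conj_closed: "g \<in> carrier PSL2R \<Longrightarrow> x \<in> carrier PSL2R \<Longrightarrow> psl2_conj g x \<in> carrier PSL2R"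
  by (simp add: psl2_conj_def)

lemma psl2_conj_one: "x \<in> carrier PSL2R \<Longrightarrow> psl2_conj \<one>\<^bsub>PSL2R\<^esub> x = x"
  by (simp add: psl2_conj_def)

lemma psl2_conj_conj:
  "g \<in> carrier PSL2R \<Longrightarrow> h \<in> carrier PSL2R \<Longrightarrow> x \<in> carrier PSL2R \<Longrightarrow>
     psl2_conj g (psl2_conj h x) = psl2_conj (g \<star> h) x"
  by (simp add: psl2_conj_def PSL2R.inv_mult_group PSL2R.m_assoc)

lemma psl2_conj_inv:
  assumes "g \<in> carrier PSL2R" "x \<in> carrier PSL2R"
  shows "psl2_conj (inv\<^bsub>PSL2R\<^esub> g) (psl2_conj g x) = x" "psl2_conj g (psl2_conj (inv\<^bsub>PSL2R\<^esub> g) x) = x"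
  using assms by (simp_all add: psl2_conj_conj psl2_conj_one)

lemma psl2_conj_mult:
  "g \<in> carrier PSL2R \<Longrightarrow> x \<in> carrier PSL2R \<Longrightarrow> y \<in> carrier PSL2R \<Longrightarrow>
     psl2_conj g (x \<star> y) = psl2_conj g x \<star> psl2_conj g y"
  by (simp add: psl2_conj_def PSL2R.m_assoc PSL2R_cancel)

lemma psl2_conj_group_hom:
  assumes "g \<in> carrier PSL2R"
  shows "group_hom PSL2R PSL2R (psl2_conj g)"
  by (intro group_hom.intro group_hom_axioms.intro group_PSL2R homI)
    (use assms in \<open>simp_all add: psl2_conj_closed psl2_conj_mult\<close>)

lemma subgroup_conj:
  "g \<in> carrier PSL2R \<Longrightarrow> subgroup H PSL2R \<Longrightarrow> subgroup (psl2_conj g ` H) PSL2R"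
  using group_hom.subgroup_img_is_subgroup[OF psl2_conj_group_hom] .

lemma fin_index_conj:
  assumes g: "g \<in> carrier PSL2R" and HK: "fin_index H K"
  shows "fin_index (psl2_conj g ` H) (psl2_conj g ` K)"
proof -
  have sub: "subgroup H PSL2R" "subgroup K PSL2R" "H \<subseteq> K"
    and fin: "finite ((\<lambda>x. H #>\<^bsub>PSL2R\<^esub> x) ` K)"
    using HK by (auto simp: fin_index_def)
  have coset: "(psl2_conj g ` H) #>\<^bsub>PSL2R\<^esub> psl2_conj g x = psl2_conj g ` (H #>\<^bsub>PSL2R\<^esub> x)" if "x \<in> K" for x
  proof -
    have "H' #>\<^bsub>PSL2R\<^esub> y = (\<lambda>h. h \<star> y) ` H'" for H' y by (auto simp: r_coset_def)
    then show ?thesis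
      using g subgroup.mem_carrier[OF sub(1)] subgroup.mem_carrier[OF sub(2) that]
      by (simp add: image_image psl2_conj_mult)
  qed
  have "(\<lambda>x. (psl2_conj g ` H) #>\<^bsub>PSL2R\<^esub> x) ` (psl2_conj g ` K)
      = (\<lambda>C. psl2_conj g ` C) ` ((\<lambda>x. H #>\<^bsub>PSL2R\<^esub> x) ` K)"
    unfolding image_image by (rule image_cong[OF refl coset])
  then have "finite ((\<lambda>x. (psl2_conj g ` H) #>\<^bsub>PSL2R\<^esub> x) ` (psl2_conj g ` K))"
    using fin by simp
  then show ?thesis
    using sub subgroup_conj[OF g] unfolding fin_index_def by blast
qed

lemma lattice_subgroup: "lattice_PSL2R \<Gamma> \<Longrightarrow> subgroup \<Gamma> PSL2R"
  by (simp add: lattice_PSL2R_def)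

text \<open>The union of the translates of a fundamental domain by representatives of the cosets of \<open>\<Delta>\<close> in
  \<open>\<Gamma>\<close> is a fundamental domain for \<open>\<Delta>\<close>.\<close>

lemma lattice_finite_index:
  assumes lat: "lattice_PSL2R \<Gamma>" and fi: "fin_index \<Delta> \<Gamma>"
  shows "lattice_PSL2R \<Delta>"
proof -
  from lat obtain \<mu> F where F: "haar_measure \<mu>" "F \<in> sets \<mu>" "emeasure \<mu> F < \<infinity>"
    "\<forall>g\<in>carrier PSL2R. \<exists>!f. f \<in> F \<and> f \<in> \<Gamma> #>\<^bsub>PSL2R\<^esub> g"
    and disc: "subtopology PSL2R_topology \<Gamma> = discrete_topology \<Gamma>"
    unfolding lattice_PSL2R_def by (elim conjE exE)
  interpret haar \<mu> by (rule haar.intro[OF F(1)])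
  have sub: "subgroup \<Delta> PSL2R" "subgroup \<Gamma> PSL2R" "\<Delta> \<subseteq> \<Gamma>"
    and fin: "finite ((\<lambda>x. \<Delta> #>\<^bsub>PSL2R\<^esub> x) ` \<Gamma>)"
    using fi by (auto simp: fin_index_def)
  note mem = subgroup.mem_carrier[OF sub(2)] subgroup.mem_carrier[OF sub(1)]
  note cl = subgroup.m_closed[OF sub(2)] subgroup.m_inv_closed[OF sub(2)]
    subgroup.m_closed[OF sub(1)] subgroup.m_inv_closed[OF sub(1)]
  have Fc: "x \<in> carrier PSL2R" if "x \<in> F" for x
    using that sets.sets_into_space[OF F(2)] by auto
  obtain R where R: "R \<subseteq> \<Gamma>" "inj_on (\<lambda>x. \<Delta> #>\<^bsub>PSL2R\<^esub> x) R"
    "(\<lambda>x. \<Delta> #>\<^bsub>PSL2R\<^esub> x) ` \<Gamma> = (\<lambda>x. \<Delta> #>\<^bsub>PSL2R\<^esub> x) ` R"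
    using subset_image_inj[of "(\<lambda>x. \<Delta> #>\<^bsub>PSL2R\<^esub> x) ` \<Gamma>" "\<lambda>x. \<Delta> #>\<^bsub>PSL2R\<^esub> x" \<Gamma>,
        THEN iffD1, OF subset_refl] by (elim exE conjE)
  have finR: "finite R" using fin unfolding R(3) by (rule finite_imageD[OF _ R(2)])
  define F' where "F' = (\<Union>r\<in>R. r <#\<^bsub>PSL2R\<^esub> F)"
  have rep: "\<exists>r\<in>R. \<exists>\<delta>\<in>\<Delta>. x = \<delta> \<star> r" if x: "x \<in> \<Gamma>" for x
  proof -
    have "\<Delta> #>\<^bsub>PSL2R\<^esub> x \<in> (\<lambda>x. \<Delta> #>\<^bsub>PSL2R\<^esub> x) ` R"
      unfolding R(3)[symmetric] using x by (rule imageI)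
    then obtain r where r: "r \<in> R" "\<Delta> #>\<^bsub>PSL2R\<^esub> x = \<Delta> #>\<^bsub>PSL2R\<^esub> r" by (elim imageE)
    have "x \<in> \<Delta> #>\<^bsub>PSL2R\<^esub> r" using PSL2R.rcos_self[OF mem(1)[OF x] sub(1)] r(2) by simp
    then show ?thesis using r(1) by (auto simp: r_coset_def)
  qed
  have dom: "\<exists>!f. f \<in> F' \<and> f \<in> \<Delta> #>\<^bsub>PSL2R\<^esub> g" if g: "g \<in> carrier PSL2R" for g
  proof -
    obtain f0 where f0: "f0 \<in> F" "f0 \<in> \<Gamma> #>\<^bsub>PSL2R\<^esub> g"
      and uniq: "\<And>f. f \<in> F \<Longrightarrow> f \<in> \<Gamma> #>\<^bsub>PSL2R\<^esub> g \<Longrightarrow> f = f0"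
      using bspec[OF F(4) g] by (elim ex1E) blast
    obtain \<gamma> where \<gamma>: "\<gamma> \<in> \<Gamma>" "f0 = \<gamma> \<star> g" using f0(2) by (auto simp: r_coset_def)
    obtain r \<delta> where r: "r \<in> R" "\<delta> \<in> \<Delta>" "inv\<^bsub>PSL2R\<^esub> \<gamma> = \<delta> \<star> r"
      using rep[OF cl(2)[OF \<gamma>(1)]] by blast
    have c: "r \<in> carrier PSL2R" "\<delta> \<in> carrier PSL2R" "\<gamma> \<in> carrier PSL2R" "f0 \<in> carrier PSL2R"
      using mem(1)[OF subsetD[OF R(1) r(1)]] mem(2)[OF r(2)] mem(1)[OF \<gamma>(1)] Fc[OF f0(1)] by simp_all
    have "inv\<^bsub>PSL2R\<^esub> \<delta> \<star> (inv\<^bsub>PSL2R\<^esub> \<gamma> \<star> f0) = r \<star> f0"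
      using c by (simp add: r(3) PSL2R.m_assoc PSL2R_cancel)
    then have rf: "r \<star> f0 = inv\<^bsub>PSL2R\<^esub> \<delta> \<star> g"
      using c g by (simp add: \<gamma>(2) PSL2R_cancel)
    show ?thesis
    proof (rule ex1I[of _ "r \<star> f0"])
      have "r \<star> f0 \<in> F'" using r(1) f0(1) by (auto simp: F'_def l_coset_def)
      moreover have "r \<star> f0 \<in> \<Delta> #>\<^bsub>PSL2R\<^esub> g"
        unfolding rf using cl(4)[OF r(2)] by (auto simp: r_coset_def)
      ultimately show "r \<star> f0 \<in> F' \<and> r \<star> f0 \<in> \<Delta> #>\<^bsub>PSL2R\<^esub> g" ..
    next
      fix f assume "f \<in> F' \<and> f \<in> \<Delta> #>\<^bsub>PSL2R\<^esub> g"
      then obtain r' f' \<delta>' where f: "r' \<in> R" "f' \<in> F" "f = r' \<star> f'" "\<delta>' \<in> \<Delta>" "f = \<delta>' \<star> g"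
        by (auto simp: F'_def l_coset_def r_coset_def)
      have c': "r' \<in> carrier PSL2R" "f' \<in> carrier PSL2R" "\<delta>' \<in> carrier PSL2R"
        using mem(1)[OF subsetD[OF R(1) f(1)]] Fc[OF f(2)] mem(2)[OF f(4)] by simp_all
      have "f' = inv\<^bsub>PSL2R\<^esub> r' \<star> \<delta>' \<star> g"
        using c' g f(3,5) PSL2R_cancel(1)[of r' f'] by (simp add: PSL2R.m_assoc)
      moreover have "inv\<^bsub>PSL2R\<^esub> r' \<star> \<delta>' \<in> \<Gamma>" 
        by (intro cl(1) cl(2) subsetD[OF R(1) f(1)] subsetD[OF sub(3) f(4)])
      ultimately have "f' \<in> \<Gamma> #>\<^bsub>PSL2R\<^esub> g" unfolding r_coset_def by blast
      then have "f' = f0" by (rule uniq[OF f(2)])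
      then have "r' \<star> \<gamma> \<star> g = \<delta>' \<star> g"
        using f(3,5) \<gamma>(2) c c' g by (simp add: PSL2R.m_assoc)
      then have "r' \<star> \<gamma> = \<delta>'" using c c' g by simp
      then have "r' = \<delta>' \<star> (\<delta> \<star> r)"
        using c c' PSL2R.inv_solve_right[of "r'" "\<delta>'" "\<gamma>"] by (simp add: r(3)[symmetric])
      then have "r' = (\<delta>' \<star> \<delta>) \<star> r"
        using c c' by (simp add: PSL2R.m_assoc)
      then have "r' \<in> \<Delta> #>\<^bsub>PSL2R\<^esub> r"
        using cl(3)[OF f(4) r(2)] unfolding r_coset_def by blast
      then have "\<Delta> #>\<^bsub>PSL2R\<^esub> r = \<Delta> #>\<^bsub>PSL2R\<^esub> r'" by (rule PSL2R.repr_independence[OF _ c(1) sub(1)])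
      then have "r = r'" by (rule inj_onD[OF R(2) _ r(1) f(1)])
      then show "f = r \<star> f0" using f(3) \<open>f' = f0\<close> by simp
    qed
  qed
  have Rc: "r \<in> carrier PSL2R" if "r \<in> R" for r using that R(1) mem by blast
  have meas: "r <#\<^bsub>PSL2R\<^esub> F \<in> sets \<mu>" if "r \<in> R" for r by (rule l_coset_measurable[OF Rc[OF that] F(2)])
  have F': "F' \<in> sets \<mu>" unfolding F'_def using finR meas by blast
  have "emeasure \<mu> F' \<le> (\<Sum>r\<in>R. emeasure \<mu> (r <#\<^bsub>PSL2R\<^esub> F))"
    unfolding F'_def using finR meas by (intro emeasure_subadditive_finite) auto
  also have "\<dots> = (\<Sum>r\<in>R. emeasure \<mu> F)" using Rc by (intro sum.cong refl emeasure_l_coset F(2))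
  also have "\<dots> < \<infinity>" using F(3) by (simp add: ennreal_mult_less_top of_nat_less_top)
  finally have F'fin: "emeasure \<mu> F' < \<infinity>" .
  have "subtopology PSL2R_topology \<Delta> = subtopology (subtopology PSL2R_topology \<Gamma>) \<Delta>"
    using sub(3) by (simp add: subtopology_subtopology Int_absorb1)
  also have "\<dots> = discrete_topology \<Delta>"
    unfolding disc using sub(3) by (simp add: subtopology_discrete_topology Int_absorb1)
  finally show ?thesis
    unfolding lattice_PSL2R_def using sub(1) F(1) F' dom F'fin
    by (intro conjI exI[of _ \<mu>] exI[of _ F'] ballI)
qed


section \<open>The commensurator\<close>

locale nonconstant_modular_embedding =
  fixes p :: "complex \<Rightarrow> complex" and \<rho> :: "psl2 \<Rightarrow> psl2" and \<Gamma> :: "psl2 set"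
  assumes modular: "modular_embedding (p, \<rho>, \<Gamma>)"
    and nonconstant: "\<not> p constant_on \<H>"
begin

lemma lattice: "lattice_PSL2R \<Gamma>"
  and rho_hom: "\<rho> \<in> hom (PSL2R\<lparr>carrier := \<Gamma>\<rparr>) PSL2R"
  and p_holomorphic: "p holomorphic_on \<H>"
  and p_image: "p ` \<H> \<subseteq> \<H>"
  and p_equivariant: "\<gamma> \<in> \<Gamma> \<Longrightarrow> z \<in> \<H> \<Longrightarrow> p (psl2_act \<gamma> z) = psl2_act (\<rho> \<gamma>) (p z)"
  using modular by auto

lemma Gamma_subgroup: "subgroup \<Gamma> PSL2R"
  by (rule lattice_subgroup[OF lattice])

lemmas Gamma_carrier = subgroup.mem_carrier[OF Gamma_subgroup]

lemma rho_carrier: "\<gamma> \<in> \<Gamma> \<Longrightarrow> \<rho> \<gamma> \<in> carrier PSL2R"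
  using rho_hom by (auto simp: hom_def)

lemma rho_mult: "\<gamma> \<in> \<Gamma> \<Longrightarrow> \<delta> \<in> \<Gamma> \<Longrightarrow> \<rho> (\<gamma> \<star> \<delta>) = \<rho> \<gamma> \<star> \<rho> \<delta>"
  using rho_hom by (auto simp: hom_def)

lemma p_upper: "z \<in> \<H> \<Longrightarrow> p z \<in> \<H>"
  using p_image by auto

lemma Comm_iff:
  "(g, h) \<in> carrier (Comm (p, \<rho>, \<Gamma>)) \<longleftrightarrow> g \<in> carrier PSL2R \<and> h \<in> carrier PSL2R \<and>
     (\<exists>\<Delta>. fin_index \<Delta> \<Gamma> \<and> fin_index \<Delta> (psl2_conj h ` \<Gamma>) \<and>
       (\<forall>\<gamma>\<in>\<Delta>. \<rho> \<gamma> = psl2_conj g (\<rho> (psl2_conj (inv\<^bsub>PSL2R\<^esub> h) \<gamma>))))"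
  using finite_index_subgroup_iff[OF Gamma_subgroup]
    finite_index_subgroup_iff[OF subgroup_conj[OF _ Gamma_subgroup]]
  by (auto simp: Comm_def fin_index_def)

text \<open>On a subgroup of finite index \<open>p\<close> and \<open>g p h\<^sup>-\<^sup>1\<close> are equivariant for the same homomorphism,
  so their overlap is invariant.\<close>

lemma Comm_equivariant:
  assumes gh: "(g, h) \<in> carrier (Comm (p, \<rho>, \<Gamma>))" and z: "z \<in> \<H>"
  shows "p (psl2_act h z) = psl2_act g (p z)"
proof -
  obtain \<Delta> where g: "g \<in> carrier PSL2R" and h: "h \<in> carrier PSL2R"
    and \<Delta>: "fin_index \<Delta> \<Gamma>" "fin_index \<Delta> (psl2_conj h ` \<Gamma>)"
    and rho: "\<And>\<gamma>. \<gamma> \<in> \<Delta> \<Longrightarrow> \<rho> \<gamma> = psl2_conj g (\<rho> (psl2_conj (inv\<^bsub>PSL2R\<^esub> h) \<gamma>))"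
    using gh unfolding Comm_iff by blast
  define q where "q w = psl2_act g (p (psl2_act (inv\<^bsub>PSL2R\<^esub> h) w))" for w
  have hi: "inv\<^bsub>PSL2R\<^esub> h \<in> carrier PSL2R" using h by simp
  have q_hol: "q holomorphic_on \<H>"
  proof -
    have "(p \<circ> psl2_act (inv\<^bsub>PSL2R\<^esub> h)) holomorphic_on \<H>"
      by (rule holomorphic_on_compose_gen[OF psl2_act_holomorphic[OF hi] p_holomorphic])
        (use psl2_act_upper[OF hi] in auto)
    then have "(psl2_act g \<circ> (p \<circ> psl2_act (inv\<^bsub>PSL2R\<^esub> h))) holomorphic_on \<H>"
      by (rule holomorphic_on_compose_gen[OF _ psl2_act_holomorphic[OF g]])
        (use psl2_act_upper[OF hi] p_upper in auto)
    then show ?thesis by (simp add: q_def[abs_def] o_def)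
  qed
  have q_im: "q ` \<H> \<subseteq> \<H>"
    using psl2_act_upper[OF g] psl2_act_upper[OF hi] p_upper by (auto simp: q_def)
  have inv: "overlap (p (psl2_act \<gamma> w)) (q (psl2_act \<gamma> w)) = overlap (p w) (q w)"
    if \<gamma>: "\<gamma> \<in> \<Delta>" and w: "w \<in> \<H>" for \<gamma> w
  proof -
    have \<gamma>\<Gamma>: "\<gamma> \<in> \<Gamma>" and c: "\<gamma> \<in> carrier PSL2R" using \<Delta>(1) \<gamma> Gamma_carrier by (auto simp: fin_index_def)
    define \<delta> where "\<delta> = psl2_conj (inv\<^bsub>PSL2R\<^esub> h) \<gamma>"
    have "\<gamma> \<in> psl2_conj h ` \<Gamma>" using \<Delta>(2) \<gamma> by (auto simp: fin_index_def)
    then have \<delta>: "\<delta> \<in> \<Gamma>" unfolding \<delta>_def using psl2_conj_inv(1)[OF h Gamma_carrier] by auto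
    define v where "v = psl2_act (inv\<^bsub>PSL2R\<^esub> h) w"
    have v: "v \<in> \<H>" unfolding v_def by (rule psl2_act_upper[OF hi w])
    have "inv\<^bsub>PSL2R\<^esub> h \<star> \<gamma> = \<delta> \<star> inv\<^bsub>PSL2R\<^esub> h"
      using h c by (simp add: \<delta>_def psl2_conj_def PSL2R.m_assoc)
    then have "psl2_act (inv\<^bsub>PSL2R\<^esub> h) (psl2_act \<gamma> w) = psl2_act \<delta> v"
      using psl2_act_mult[OF hi c w] psl2_act_mult[OF Gamma_carrier[OF \<delta>] hi w] by (simp add: v_def)
    then have "q (psl2_act \<gamma> w) = psl2_act g (psl2_act (\<rho> \<delta>) (p v))"
      by (simp add: q_def p_equivariant[OF \<delta> v])
    also have "\<dots> = psl2_act (g \<star> \<rho> \<delta>) (p v)"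
      by (rule psl2_act_mult[OF g rho_carrier[OF \<delta>] p_upper[OF v], symmetric])
    also have "g \<star> \<rho> \<delta> = \<rho> \<gamma> \<star> g"
    proof -
      have "\<rho> \<gamma> = psl2_conj g (\<rho> \<delta>)" unfolding \<delta>_def by (rule rho[OF \<gamma>])
      then show ?thesis using g rho_carrier[OF \<delta>] by (simp add: psl2_conj_def PSL2R.m_assoc)
    qed
    also have "psl2_act (\<rho> \<gamma> \<star> g) (p v) = psl2_act (\<rho> \<gamma>) (q w)"
      unfolding q_def v_def[symmetric] by (rule psl2_act_mult[OF rho_carrier[OF \<gamma>\<Gamma>] g p_upper[OF v]])
    finally have "q (psl2_act \<gamma> w) = psl2_act (\<rho> \<gamma>) (q w)" .
    moreover have "q w \<in> \<H>" using q_im w by auto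
    ultimately show ?thesis
      using p_equivariant[OF \<gamma>\<Gamma> w] overlap_psl2_act[OF rho_carrier[OF \<gamma>\<Gamma>] p_upper[OF w]] by simp
  qed
  have hz: "psl2_act h z \<in> \<H>" by (rule psl2_act_upper[OF h z])
  have "p (psl2_act h z) = q (psl2_act h z)"
    by (rule overlap_rigidity[OF lattice_finite_index[OF lattice \<Delta>(1)] p_holomorphic p_image q_hol q_im
          inv nonconstant hz])
  then show ?thesis using psl2_act_inv(1)[OF h z] by (simp add: q_def)
qed

lemma p_two_values:
  obtains z w where "z \<in> \<H>" "w \<in> \<H>" "p z \<noteq> p w"
  using nonconstant unfolding constant_on_def by blast

text \<open>By equivariance \<open>h\<close> determines \<open>g\<close> on the image of \<open>p\<close>, which contains two points.\<close>

lemma Comm_snd_injective: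
  assumes "(g, h) \<in> carrier (Comm (p, \<rho>, \<Gamma>))" "(g', h) \<in> carrier (Comm (p, \<rho>, \<Gamma>))"
  shows "g = g'"
proof -
  have g: "g \<in> carrier PSL2R" "g' \<in> carrier PSL2R" using assms by (auto simp: Comm_iff)
  obtain z w where zw: "z \<in> \<H>" "w \<in> \<H>" "p z \<noteq> p w" by (rule p_two_values)
  have fixed: "psl2_act (inv\<^bsub>PSL2R\<^esub> g' \<star> g) (p u) = p u" if u: "u \<in> \<H>" for u
  proof -
    have "psl2_act (inv\<^bsub>PSL2R\<^esub> g' \<star> g) (p u) = psl2_act (inv\<^bsub>PSL2R\<^esub> g') (psl2_act g (p u))"
      using g p_upper[OF u] by (simp add: psl2_act_mult)
    also have "psl2_act g (p u) = psl2_act g' (p u)"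
      using Comm_equivariant[OF assms(1) u] Comm_equivariant[OF assms(2) u] by simp
    finally show ?thesis using psl2_act_inv(1)[OF g(2) p_upper[OF u]] by simp
  qed
  have "inv\<^bsub>PSL2R\<^esub> g' \<star> g = \<one>\<^bsub>PSL2R\<^esub>"
    using g by (intro psl2_act_two_fixed_points[OF _ p_upper[OF zw(1)] p_upper[OF zw(2)] zw(3)] fixed zw) simp
  then have "g' \<star> (inv\<^bsub>PSL2R\<^esub> g' \<star> g) = g'" using g by simp
  then show ?thesis using PSL2R_cancel(2)[OF g(2,1)] by simp
qed

lemma Comm_subgroup: "subgroup (carrier (Comm (p, \<rho>, \<Gamma>))) (PSL2R \<times>\<times> PSL2R)"
proof -
  interpret D: group "PSL2R \<times>\<times> PSL2R" by (rule DirProd_group[OF group_PSL2R group_PSL2R])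
  let ?C = "carrier (Comm (p, \<rho>, \<Gamma>))"
  have conj_id: "psl2_conj \<one>\<^bsub>PSL2R\<^esub> ` \<Gamma> = \<Gamma>" using psl2_conj_one[OF Gamma_carrier] by force
  show ?thesis
  proof (rule D.subgroupI)
    show "?C \<subseteq> carrier (PSL2R \<times>\<times> PSL2R)" by (auto simp: Comm_def)
    have "(\<one>\<^bsub>PSL2R\<^esub>, \<one>\<^bsub>PSL2R\<^esub>) \<in> ?C"
      unfolding Comm_iff using fin_index_refl[OF Gamma_subgroup] conj_id Gamma_carrier rho_carrier
      by (auto simp: psl2_conj_one intro!: exI[of _ \<Gamma>])
    then show "?C \<noteq> {}" by blast
  next
    fix a assume "a \<in> ?C"
    then obtain g h \<Delta> where a: "a = (g, h)" and g: "g \<in> carrier PSL2R" and h: "h \<in> carrier PSL2R"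
      and \<Delta>: "fin_index \<Delta> \<Gamma>" "fin_index \<Delta> (psl2_conj h ` \<Gamma>)"
      and rho: "\<And>\<gamma>. \<gamma> \<in> \<Delta> \<Longrightarrow> \<rho> \<gamma> = psl2_conj g (\<rho> (psl2_conj (inv\<^bsub>PSL2R\<^esub> h) \<gamma>))"
      by (cases a) (auto simp: Comm_iff)
    let ?i = "inv\<^bsub>PSL2R\<^esub> h"
    have i: "?i \<in> carrier PSL2R" using h by simp
    have undo: "psl2_conj ?i ` psl2_conj h ` \<Gamma> = \<Gamma>"
      using psl2_conj_inv(1)[OF h Gamma_carrier] by force
    have "fin_index (psl2_conj ?i ` \<Delta>) (psl2_conj ?i ` \<Gamma>)" "fin_index (psl2_conj ?i ` \<Delta>) \<Gamma>"
      using fin_index_conj[OF i \<Delta>(1)] fin_index_conj[OF i \<Delta>(2)] by (simp_all add: undo)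
    moreover have "\<rho> \<gamma> = psl2_conj (inv\<^bsub>PSL2R\<^esub> g) (\<rho> (psl2_conj (inv\<^bsub>PSL2R\<^esub> ?i) \<gamma>))"
      if mem: "\<gamma> \<in> psl2_conj ?i ` \<Delta>" for \<gamma>
    proof -
      obtain \<delta> where \<delta>: "\<delta> \<in> \<Delta>" "\<gamma> = psl2_conj ?i \<delta>" using mem by blast
      have "\<delta> \<in> carrier PSL2R" using \<Delta>(1) \<delta>(1) Gamma_carrier by (auto simp: fin_index_def)
      then have "psl2_conj (inv\<^bsub>PSL2R\<^esub> ?i) \<gamma> = \<delta>" using h by (simp add: \<delta>(2) psl2_conj_inv)
      moreover have "\<gamma> \<in> \<Gamma>" using mem \<open>fin_index (psl2_conj ?i ` \<Delta>) \<Gamma>\<close> by (auto simp: fin_index_def)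
      ultimately show ?thesis
        using rho[OF \<delta>(1)] psl2_conj_inv(1)[OF g rho_carrier] by (simp add: \<delta>(2)[symmetric])
    qed
    ultimately show "inv\<^bsub>PSL2R \<times>\<times> PSL2R\<^esub> a \<in> ?C"
      using g h i by (auto simp: a inv_DirProd[OF group_PSL2R group_PSL2R] Comm_iff)
  next
    fix a b assume "a \<in> ?C" "b \<in> ?C"
    then obtain g h \<Delta> g' h' \<Delta>' where ab: "a = (g, h)" "b = (g', h')"
      and g: "g \<in> carrier PSL2R" "h \<in> carrier PSL2R" "g' \<in> carrier PSL2R" "h' \<in> carrier PSL2R"
      and \<Delta>: "fin_index \<Delta> \<Gamma>" "fin_index \<Delta> (psl2_conj h ` \<Gamma>)"
      and rho: "\<And>\<gamma>. \<gamma> \<in> \<Delta> \<Longrightarrow> \<rho> \<gamma> = psl2_conj g (\<rho> (psl2_conj (inv\<^bsub>PSL2R\<^esub> h) \<gamma>))"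
      and \<Delta>': "fin_index \<Delta>' \<Gamma>" "fin_index \<Delta>' (psl2_conj h' ` \<Gamma>)"
      and rho': "\<And>\<gamma>. \<gamma> \<in> \<Delta>' \<Longrightarrow> \<rho> \<gamma> = psl2_conj g' (\<rho> (psl2_conj (inv\<^bsub>PSL2R\<^esub> h') \<gamma>))"
      by (cases a, cases b) (auto simp: Comm_iff)
    \<comment> \<open>on this group the relations for both factors can be composed\<close>
    let ?E = "\<Delta> \<inter> psl2_conj h ` \<Delta>'"
    have 1: "fin_index (psl2_conj h ` \<Delta>') (psl2_conj h ` \<Gamma>)" by (rule fin_index_conj[OF g(2) \<Delta>'(1)])
    have E: "fin_index ?E (psl2_conj h ` \<Gamma>)" by (rule fin_index_Int[OF \<Delta>(2) 1])
    have sub: "subgroup \<Delta> PSL2R" "subgroup (psl2_conj h ` \<Delta>') PSL2R"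
      "\<Delta> \<subseteq> psl2_conj h ` \<Gamma>" "psl2_conj h ` \<Delta>' \<subseteq> psl2_conj h ` \<Gamma>"
      using \<Delta>(2) 1 by (auto simp: fin_index_def)
    have "fin_index ?E \<Gamma>"
      by (rule fin_index_trans[OF fin_index_subset[OF E sub(1) _ sub(3)] \<Delta>(1)]) blast
    moreover have "fin_index ?E (psl2_conj (h \<star> h') ` \<Gamma>)"
    proof -
      have "psl2_conj h ` psl2_conj h' ` \<Gamma> = psl2_conj (h \<star> h') ` \<Gamma>"
        unfolding image_image by (intro image_cong refl psl2_conj_conj g Gamma_carrier)
      then have "fin_index (psl2_conj h ` \<Delta>') (psl2_conj (h \<star> h') ` \<Gamma>)"
        using fin_index_conj[OF g(2) \<Delta>'(2)] by simp
      from fin_index_trans[OF fin_index_subset[OF E sub(2) _ sub(4)] this] show ?thesis by blast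
    qed
    moreover have "\<rho> \<gamma> = psl2_conj (g \<star> g') (\<rho> (psl2_conj (inv\<^bsub>PSL2R\<^esub> (h \<star> h')) \<gamma>))"
      if \<gamma>: "\<gamma> \<in> ?E" for \<gamma>
    proof -
      obtain \<delta> where \<delta>: "\<delta> \<in> \<Delta>'" "\<gamma> = psl2_conj h \<delta>" using \<gamma> by blast
      have c: "\<delta> \<in> carrier PSL2R" "\<gamma> \<in> carrier PSL2R" using \<Delta>'(1) \<Delta>(1) \<delta>(1) \<gamma> Gamma_carrier by (auto simp: fin_index_def)
      define \<epsilon> where "\<epsilon> = psl2_conj (inv\<^bsub>PSL2R\<^esub> h') \<delta>"
      have "\<epsilon> \<in> \<Gamma>"
        using \<Delta>'(2) \<delta>(1) psl2_conj_inv(1)[OF g(4) Gamma_carrier] by (auto simp: fin_index_def \<epsilon>_def)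
      have d: "psl2_conj (inv\<^bsub>PSL2R\<^esub> h) \<gamma> = \<delta>" using g c by (simp add: \<delta>(2) psl2_conj_inv)
      then have "psl2_conj (inv\<^bsub>PSL2R\<^esub> (h \<star> h')) \<gamma> = \<epsilon>"
        using g c by (simp add: PSL2R.inv_mult_group \<epsilon>_def flip: psl2_conj_conj)
      moreover have "\<rho> \<gamma> = psl2_conj g (psl2_conj g' (\<rho> \<epsilon>))"
        using rho[of \<gamma>] rho'[OF \<delta>(1)] \<gamma> d by (simp add: \<epsilon>_def)
      ultimately show ?thesis
        using g rho_carrier[OF \<open>\<epsilon> \<in> \<Gamma>\<close>] by (simp add: psl2_conj_conj)
    qed
    ultimately show "a \<otimes>\<^bsub>PSL2R \<times>\<times> PSL2R\<^esub> b \<in> ?C"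
      using g by (auto simp: ab Comm_iff)
  qed
qed

lemma Comm_eq: "Comm (p, \<rho>, \<Gamma>) = (PSL2R \<times>\<times> PSL2R)\<lparr>carrier := carrier (Comm (p, \<rho>, \<Gamma>))\<rparr>"
  by (simp add: Comm_def)

lemma Comm_group: "group (Comm (p, \<rho>, \<Gamma>))"
  by (subst Comm_eq) (rule subgroup.subgroup_is_group[OF Comm_subgroup DirProd_group[OF group_PSL2R group_PSL2R]])

lemma Comm_mult: "(g, h) \<otimes>\<^bsub>Comm (p, \<rho>, \<Gamma>)\<^esub> (g', h') = (g \<star> g', h \<star> h')"
  by (simp add: Comm_def)

lemma Gamma_Comm:
  assumes \<gamma>: "\<gamma> \<in> \<Gamma>"
  shows "(\<rho> \<gamma>, \<gamma>) \<in> carrier (Comm (p, \<rho>, \<Gamma>))"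
proof -
  note c = Gamma_carrier[OF \<gamma>]
  have inv: "inv\<^bsub>PSL2R\<^esub> \<gamma> \<in> \<Gamma>" by (rule subgroup.m_inv_closed[OF Gamma_subgroup \<gamma>])
  note cl = subgroup.m_closed[OF Gamma_subgroup]
  have conj: "psl2_conj \<gamma> x \<in> \<Gamma>" "psl2_conj (inv\<^bsub>PSL2R\<^esub> \<gamma>) x \<in> \<Gamma>" if "x \<in> \<Gamma>" for x
    using that \<gamma> inv c by (auto simp: psl2_conj_def intro!: cl)
  have "psl2_conj \<gamma> ` \<Gamma> = \<Gamma>"
  proof (intro equalityI subsetI)
    fix x assume "x \<in> \<Gamma>"
    then show "x \<in> psl2_conj \<gamma> ` \<Gamma>"
      using psl2_conj_inv(2)[OF c Gamma_carrier, of x] imageI[OF conj(2), of x "psl2_conj \<gamma>"] by simp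
  qed (use conj in auto)
  moreover have "\<rho> x = psl2_conj (\<rho> \<gamma>) (\<rho> (psl2_conj (inv\<^bsub>PSL2R\<^esub> \<gamma>) x))" if x: "x \<in> \<Gamma>" for x
  proof -
    define y where "y = psl2_conj (inv\<^bsub>PSL2R\<^esub> \<gamma>) x"
    have y: "y \<in> \<Gamma>" using conj(2)[OF x] by (simp add: y_def)
    have "x \<star> \<gamma> = \<gamma> \<star> y"
      using c Gamma_carrier[OF x] by (simp add: y_def psl2_conj_def PSL2R.m_assoc PSL2R_cancel)
    then have "\<rho> x \<star> \<rho> \<gamma> = \<rho> \<gamma> \<star> \<rho> y" using rho_mult[OF x \<gamma>] rho_mult[OF \<gamma> y] by simp
    then have "\<rho> x = psl2_conj (\<rho> \<gamma>) (\<rho> y)"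
      unfolding psl2_conj_def
      using rho_carrier[OF x] rho_carrier[OF y] rho_carrier[OF \<gamma>]
        PSL2R.inv_solve_right[of "\<rho> x" "\<rho> \<gamma> \<star> \<rho> y" "\<rho> \<gamma>"] by simp
    then show ?thesis by (simp only: y_def)
  qed
  ultimately show ?thesis
    unfolding Comm_iff using c rho_carrier[OF \<gamma>] fin_index_refl[OF Gamma_subgroup] by auto
qed

lemma Gamma_image_subgroup: "subgroup ((\<lambda>\<gamma>. (\<rho> \<gamma>, \<gamma>)) ` \<Gamma>) (Comm (p, \<rho>, \<Gamma>))"
proof -
  have "(\<lambda>\<gamma>. (\<rho> \<gamma>, \<gamma>)) \<in> hom (PSL2R\<lparr>carrier := \<Gamma>\<rparr>) (Comm (p, \<rho>, \<Gamma>))"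
    by (rule homI) (simp_all add: Gamma_Comm Comm_mult rho_mult)
  then have "group_hom (PSL2R\<lparr>carrier := \<Gamma>\<rparr>) (Comm (p, \<rho>, \<Gamma>)) (\<lambda>\<gamma>. (\<rho> \<gamma>, \<gamma>))"
    by (intro group_hom.intro group_hom_axioms.intro PSL2R.subgroup_imp_group[OF Gamma_subgroup] Comm_group)
  from group_hom.img_is_subgroup[OF this] show ?thesis by simp
qed

end


section \<open>Discreteness of the commensurator\<close>

lemma commute_2_iff:
  fixes M Y :: "real^2^2"
  shows "M ** Y = Y ** M \<longleftrightarrow>
     M$1$2 * Y$2$1 = Y$1$2 * M$2$1 \<and>
     M$1$2 * (Y$1$1 - Y$2$2) = Y$1$2 * (M$1$1 - M$2$2) \<and>
     M$2$1 * (Y$1$1 - Y$2$2) = Y$2$1 * (M$1$1 - M$2$2)"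
  by (auto simp: matrix_2_eq_iff matrix_2_mult_nth algebra_simps)

text \<open>The triples \<open>(M\<^sub>1\<^sub>2, M\<^sub>2\<^sub>1, M\<^sub>1\<^sub>1 - M\<^sub>2\<^sub>2)\<close> of commuting matrices are linearly dependent, and that of a
  nonscalar matrix is not zero.\<close>

lemma commute_2_span:
  fixes A M :: "real^2^2"
  assumes A: "A \<noteq> mat (A$1$1)" and AM: "A ** M = M ** A"
  obtains s t where "M = s *\<^sub>R A + mat t"
proof -
  have nz: "A$1$2 \<noteq> 0 \<or> A$2$1 \<noteq> 0 \<or> A$1$1 - A$2$2 \<noteq> 0"
    using A by (auto simp: matrix_2_eq_iff mat_def)
  have eq: "A$1$2 * M$2$1 = M$1$2 * A$2$1" "A$1$2 * (M$1$1 - M$2$2) = M$1$2 * (A$1$1 - A$2$2)"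
    "A$2$1 * (M$1$1 - M$2$2) = M$2$1 * (A$1$1 - A$2$2)"
    using AM unfolding commute_2_iff by auto
  have "\<exists>s. M$1$2 = s * A$1$2 \<and> M$2$1 = s * A$2$1 \<and> M$1$1 - M$2$2 = s * (A$1$1 - A$2$2)"
  proof -
    consider "A$1$2 \<noteq> 0" | "A$2$1 \<noteq> 0" | "A$1$1 - A$2$2 \<noteq> 0" using nz by blast
    then show ?thesis
    proof cases
      case 1
      then show ?thesis using eq by (intro exI[of _ "M$1$2 / A$1$2"]) (auto simp: field_simps)
    next
      case 2
      then show ?thesis using eq by (intro exI[of _ "M$2$1 / A$2$1"]) (auto simp: field_simps)
    next
      case 3
      then show ?thesis using eq
        by (intro exI[of _ "(M$1$1 - M$2$2) / (A$1$1 - A$2$2)"]) (simp add: nonzero_eq_divide_eq mult.commute)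
    qed
  qed
  then obtain s where s: "M$1$2 = s * A$1$2" "M$2$1 = s * A$2$1" "M$1$1 - M$2$2 = s * (A$1$1 - A$2$2)"
    by blast
  have "M = s *\<^sub>R A + mat (M$1$1 - s * A$1$1)"
    using s by (auto simp: matrix_2_eq_iff mat_def algebra_simps)
  then show ?thesis using that by blast
qed

lemma adj_cancel:
  assumes "det A = 1"
  shows "adj A ** (A ** B) = B" "A ** (adj A ** B) = B"
  using adj_mult[OF assms] by (simp_all add: matrix_mul_assoc)

lemma tendsto_matrix_mult_2:
  fixes f g :: "'a \<Rightarrow> real^2^2"
  assumes "(f \<longlongrightarrow> A) F" "(g \<longlongrightarrow> B) F"
  shows "((\<lambda>x. f x ** g x) \<longlongrightarrow> A ** B) F"
  unfolding matrix_matrix_mult_def by (intro tendsto_intros assms)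

lemma tendsto_adj:
  assumes "(f \<longlongrightarrow> A) F"
  shows "((\<lambda>x. adj (f x)) \<longlongrightarrow> adj A) F"
proof (intro vec_tendstoI)
  fix i j :: 2
  have "((\<lambda>x. f x $ k $ l) \<longlongrightarrow> A $ k $ l) F" for k l by (intro tendsto_intros assms)
  then have "\<forall>i j. ((\<lambda>x. adj (f x) $ i $ j) \<longlongrightarrow> adj A $ i $ j) F"
    unfolding forall_2 by (auto intro: tendsto_minus)
  then show "((\<lambda>x. adj (f x) $ i $ j) \<longlongrightarrow> adj A $ i $ j) F" by blast
qed

lemma matrix_entry_le_norm: "\<bar>A $ i $ j\<bar> \<le> norm (A :: real^2^2)"
  using component_le_norm_cart[of "A $ i" j] Finite_Cartesian_Product.norm_nth_le[of A i] by simp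

lemma near_one_not_minus_one:
  assumes "norm (A - mat 1 :: real^2^2) < 1"
  shows "A \<noteq> - mat 1"
  using matrix_entry_le_norm[of "A - mat 1" 1 1] assms by (auto simp: mat_2_nth)

lemma scalar_det_1:
  fixes A :: "real^2^2"
  assumes "det A = 1" "A = mat (A$1$1)"
  shows "A = mat 1 \<or> A = - mat 1"
proof -
  have e: "A$1$2 = 0" "A$2$1 = 0" "A$2$2 = A$1$1"
    using assms(2) by (simp_all add: matrix_2_eq_iff mat_def)
  then have "A$1$1 * A$1$1 = 1" using assms(1) by (simp add: det_2)
  then have "A$1$1 = 1 \<or> A$1$1 = -1" by (simp add: square_eq_1_iff)
  then show ?thesis using e by (auto simp: matrix_2_eq_iff mat_def)
qed

text \<open>Discreteness in matrix form. The bound also keeps \<open>A\<close> away from \<open>-1\<close>, the other representative of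
  the identity.\<close>

lemma lattice_discrete_at_one:
  assumes "lattice_PSL2R \<Gamma>"
  obtains e where "e > 0"
    "\<And>A. det A = 1 \<Longrightarrow> psl2_proj A \<in> \<Gamma> \<Longrightarrow> norm (A - mat 1) < e \<Longrightarrow> A = mat 1"
proof -
  have disc: "subtopology PSL2R_topology \<Gamma> = discrete_topology \<Gamma>" and sub: "subgroup \<Gamma> PSL2R"
    using assms by (simp_all add: lattice_PSL2R_def)
  have "openin (subtopology PSL2R_topology \<Gamma>) {\<one>\<^bsub>PSL2R\<^esub>}"
    unfolding disc using subgroup.one_closed[OF sub] by simp
  then obtain U where U: "openin PSL2R_topology U" "{\<one>\<^bsub>PSL2R\<^esub>} = U \<inter> \<Gamma>"
    unfolding openin_subtopology by blast
  have "openin (top_of_set (carrier SL2R)) {A \<in> carrier SL2R. psl2_proj A \<in> U}"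
    using U(1) by (simp add: openin_PSL2R_topology)
  then obtain W where W: "open W" "{A \<in> carrier SL2R. psl2_proj A \<in> U} = carrier SL2R \<inter> W"
    unfolding openin_open by blast
  have "mat 1 \<in> {A \<in> carrier SL2R. psl2_proj A \<in> U}"
    using U(2) by (auto simp: carrier_SL2R psl2_proj_one)
  then have "mat 1 \<in> W" using W(2) by blast
  then obtain e where e: "e > 0" "ball (mat 1) e \<subseteq> W" using W(1) by (meson openE)
  show ?thesis
  proof (rule that[of "min e 1"])
    fix A :: "real^2^2"
    assume A: "det A = 1" "psl2_proj A \<in> \<Gamma>" "norm (A - mat 1) < min e 1"
    then have "A \<in> W" using e(2) by (auto simp: dist_norm norm_minus_commute)
    then have "A \<in> {A \<in> carrier SL2R. psl2_proj A \<in> U}" unfolding W(2) using A(1) by (simp add: carrier_SL2R)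
    then have "psl2_proj A \<in> U \<inter> \<Gamma>" using A(2) by simp
    then have "psl2_proj A = psl2_proj (mat 1)" unfolding U(2)[symmetric] by (simp add: psl2_proj_one)
    then show "A = mat 1" using near_one_not_minus_one[of A] A(3) by (auto simp: psl2_proj_inj_iff)
  qed (use e in simp)
qed

context nonconstant_modular_embedding
begin


text \<open>The commutators of \<open>A\<^sub>n\<close> with a kernel element preserve \<open>p\<close> and tend to the identity. Since
  the fibres of \<open>p\<close> are discrete, such transformations eventually fix any given point.\<close>

lemma eventually_commute:
  assumes A: "\<And>n. det (A n) = 1" "\<And>n. psl2_proj (A n) \<in> snd ` carrier (Comm (p, \<rho>, \<Gamma>))"
    and lim: "A \<longlonglongrightarrow> mat 1"
    and M: "det M = 1" "psl2_proj M \<in> \<Gamma>" "\<rho> (psl2_proj M) = \<one>\<^bsub>PSL2R\<^esub>"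
  shows "\<forall>\<^sub>F n in sequentially. A n ** M = M ** A n"
proof -
  define Y where "Y n = A n ** (M ** (adj (A n) ** adj M))" for n
  have Y1: "det (Y n) = 1" for n by (simp add: Y_def det_mul A M det_adj)
  have pM: "p (sl2_act M z) = p z" if "z \<in> \<H>" for z
    using p_equivariant[OF M(2) that] by (simp add: M(3) psl2_act_proj)
  have up: "sl2_act B z \<in> \<H>" if "det B = 1" "z \<in> \<H>" for B z
    using sl2_act_upper that by (simp add: upper_half_plane_iff)
  have mult: "sl2_act (B ** C) z = sl2_act B (sl2_act C z)"
    if "det B = 1" "det C = 1" "z \<in> \<H>" for B C z
    using sl2_act_mult that by (simp add: upper_half_plane_iff)
  have inv: "sl2_act B (sl2_act (adj B) z) = z" if "det B = 1" "z \<in> \<H>" for B z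
    using mult[of B "adj B" z] that by (simp add: det_adj adj_mult sl2_act_one)
  have pY: "p (sl2_act (Y n) z) = p z" if z: "z \<in> \<H>" for n z
  proof -
    obtain g where g: "(g, psl2_proj (A n)) \<in> carrier (Comm (p, \<rho>, \<Gamma>))" using A(2)[of n] by auto
    have eq: "p (sl2_act (A n) w) = psl2_act g (p w)" if "w \<in> \<H>" for w
      using Comm_equivariant[OF g that] by (simp add: psl2_act_proj)
    define w1 where "w1 = sl2_act (adj M) z"
    define w2 where "w2 = sl2_act (adj (A n)) w1"
    have w: "w1 \<in> \<H>" "w2 \<in> \<H>"
      using z by (simp_all add: w1_def w2_def up det_adj A M)
    have "sl2_act (Y n) z = sl2_act (A n) (sl2_act M w2)"
      using z by (simp add: Y_def w1_def w2_def mult up det_adj det_mul A M)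
    then have "p (sl2_act (Y n) z) = psl2_act g (p w2)"
      using w by (simp add: eq up M pM)
    also have "\<dots> = p w1" using eq[OF w(2)] inv[OF A(1) w(1), of n] by (simp add: w2_def)
    also have "\<dots> = p z" using pM[OF w(1)] inv[OF M(1) z] by (simp add: w1_def)
    finally show ?thesis .
  qed
  have "(\<lambda>n. Y n) \<longlonglongrightarrow> mat 1 ** (M ** (adj (mat 1) ** adj M))"
    unfolding Y_def by (intro tendsto_matrix_mult_2 tendsto_adj lim tendsto_const)
  moreover have "adj (mat 1) = mat 1" by (simp add: matrix_2_eq_iff mat_2_nth)
  ultimately have limY: "Y \<longlonglongrightarrow> mat 1" using adj_mult[OF M(1)] by simp
  have fixed: "\<forall>\<^sub>F n in sequentially. sl2_act (Y n) z = z" if z: "z \<in> \<H>" for z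
  proof -
    obtain w where w: "w \<in> \<H>" "p w - p z \<noteq> 0"
      using nonconstant z unfolding constant_on_def by force
    have hol: "(\<lambda>w. p w - p z) holomorphic_on \<H>"
      by (intro holomorphic_intros p_holomorphic)
    obtain r where r: "0 < r" and "ball z r \<subseteq> \<H>"
      and r': "\<And>w. w \<in> ball z r - {z} \<Longrightarrow> p w - p z \<noteq> 0"
      by (rule isolated_zeros[OF hol open_upper_half_plane connected_upper_half_plane z _ w], simp, blast)
    have "(\<lambda>n. sl2_act (Y n) z) \<longlonglongrightarrow> sl2_act (mat 1) z"
      unfolding sl2_act_eq by (intro tendsto_intros limY) (simp add: mat_2_nth)
    then have "\<forall>\<^sub>F n in sequentially. dist (sl2_act (Y n) z) z < r"
      using r by (simp add: sl2_act_one tendstoD)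
    then show ?thesis
    proof (rule eventually_mono)
      fix n assume "dist (sl2_act (Y n) z) z < r"
      then have "sl2_act (Y n) z \<in> ball z r" by (simp add: dist_commute)
      then show "sl2_act (Y n) z = z" using r'[of "sl2_act (Y n) z"] pY[OF z, of n] by auto
    qed
  qed
  have "\<forall>\<^sub>F n in sequentially. dist (Y n) (mat 1) < 1" by (rule tendstoD[OF limY]) simp
  moreover have "\<forall>\<^sub>F n in sequentially. sl2_act (Y n) \<i> = \<i>" by (rule fixed[OF ii_upper])
  moreover have "\<forall>\<^sub>F n in sequentially. sl2_act (Y n) (2 * \<i>) = 2 * \<i>"
    by (rule fixed) (simp add: upper_half_plane_iff)
  ultimately show ?thesis
  proof eventually_elim
    case (elim n)
    have "Y n = mat 1 \<or> Y n = - mat 1"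
      by (rule sl2_act_two_fixed_points[OF Y1 _ _ _ elim(2,3)]) simp_all
    then have "Y n = mat 1" using near_one_not_minus_one[of "Y n"] elim(1) by (auto simp: dist_norm)
    then have "Y n ** (M ** A n) = M ** A n" by simp
    moreover have "Y n ** (M ** A n) = A n ** M"
      unfolding Y_def using A(1)[of n] M(1)
      by (simp only: matrix_mul_assoc[symmetric] adj_cancel adj_mult matrix_mul_rid)
    ultimately show ?case by simp
  qed
qed

end

lemma mat_2_entries:
  "(mat u :: real^2^2) $ 1 $ 1 = u" "(mat u :: real^2^2) $ 1 $ 2 = 0"
  "(mat u :: real^2^2) $ 2 $ 1 = 0" "(mat u :: real^2^2) $ 2 $ 2 = u"
  by (simp_all add: mat_def)

lemma conj_affine:
  assumes "det G = 1"
  shows "G ** (c *\<^sub>R M + mat u) ** adj G = c *\<^sub>R (G ** M ** adj G) + mat u"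
proof -
  have "G ** (c *\<^sub>R M + mat u) ** adj G = c *\<^sub>R (G ** M ** adj G) + u *\<^sub>R (G ** adj G)"
    by (simp add: matrix_2_eq_iff matrix_2_mult_nth mat_2_entries algebra_simps)
  moreover have "u *\<^sub>R (mat 1 :: real^2^2) = mat u"
    by (simp add: matrix_2_eq_iff mat_2_entries)
  ultimately show ?thesis by (simp add: adj_mult[OF assms])
qed

text \<open>A lattice contains no element contracting the traceless part of another one: iterating the
  conjugation would produce elements accumulating at the identity.\<close>

lemma lattice_no_contraction:
  assumes lat: "lattice_PSL2R \<Gamma>"
    and M: "det M = 1" "psl2_proj M \<in> \<Gamma>" "M \<noteq> mat (M$1$1)"
    and G: "det G = 1" "psl2_proj G \<in> \<Gamma>"
    and c: "G ** M ** adj G = c *\<^sub>R M + mat ((1 - c) * t)" "\<bar>c\<bar> < 1" "c \<noteq> 0"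
  shows False
proof -
  note sub = lattice_subgroup[OF lat]
  define Y where "Y n = c ^ n *\<^sub>R M + mat ((1 - c ^ n) * t)" for n
  have step: "G ** Y n ** adj G = Y (Suc n)" for n
    unfolding Y_def conj_affine[OF G(1)] c(1)
    by (simp add: matrix_2_eq_iff mat_2_entries algebra_simps)
  have Y: "det (Y n) = 1 \<and> psl2_proj (Y n) \<in> \<Gamma>" for n
  proof (induction n)
    case 0
    have "Y 0 = M" by (simp add: Y_def matrix_2_eq_iff mat_2_entries)
    then show ?case using M by simp
  next
    case (Suc n)
    have "psl2_proj (G ** Y n ** adj G) = psl2_proj G \<star> psl2_proj (Y n) \<star> inv\<^bsub>PSL2R\<^esub> psl2_proj G"
      using Suc G(1) by (simp add: psl2_proj_mult psl2_proj_inv det_mul det_adj)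
    also have "\<dots> \<in> \<Gamma>"
      using Suc G(2) by (intro subgroup.m_closed[OF sub] subgroup.m_inv_closed[OF sub]) simp_all
    finally show ?case using Suc G(1) by (simp add: step[symmetric] det_mul det_adj)
  qed
  have c0: "(\<lambda>n. c ^ n) \<longlonglongrightarrow> 0" by (rule LIMSEQ_power_zero) (use c(2) in simp)
  have limY: "(\<lambda>n. Y n $ i $ j) \<longlonglongrightarrow> (mat t :: real^2^2) $ i $ j" for i j
  proof -
    have "(\<lambda>n. c ^ n * M $ i $ j + (1 - c ^ n) * (mat t :: real^2^2) $ i $ j)
        \<longlonglongrightarrow> 0 * M $ i $ j + (1 - 0) * (mat t :: real^2^2) $ i $ j"
      by (intro tendsto_intros c0)
    moreover have "Y n $ i $ j = c ^ n * M $ i $ j + (1 - c ^ n) * (mat t :: real^2^2) $ i $ j" for n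
      by (simp add: Y_def mat_def)
    ultimately show ?thesis by simp
  qed
  have "(\<lambda>n. det (Y n)) \<longlonglongrightarrow> det (mat t :: real^2^2)"
    unfolding det_2 by (intro tendsto_intros limY)
  then have "(\<lambda>n::nat. 1 :: real) \<longlonglongrightarrow> det (mat t :: real^2^2)" using Y by simp
  then have "det (mat t :: real^2^2) = 1" using LIMSEQ_unique tendsto_const by blast
  then have t1: "t * t = 1" by (simp add: det_2 mat_2_entries)
  define Z where "Z n = t *\<^sub>R Y n" for n
  have "Z \<longlonglongrightarrow> mat 1"
  proof (intro vec_tendstoI)
    fix i j
    have "(\<lambda>n. t * Y n $ i $ j) \<longlonglongrightarrow> t * (mat t :: real^2^2) $ i $ j"
      by (intro tendsto_intros limY)
    moreover have "t * (mat t :: real^2^2) $ i $ j = (mat 1 :: real^2^2) $ i $ j" using t1 by (simp add: mat_def)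
    ultimately show "(\<lambda>n. Z n $ i $ j) \<longlonglongrightarrow> (mat 1 :: real^2^2) $ i $ j" by (simp add: Z_def)
  qed
  moreover obtain e where e: "e > 0"
    "\<And>A. det A = 1 \<Longrightarrow> psl2_proj A \<in> \<Gamma> \<Longrightarrow> norm (A - mat 1) < e \<Longrightarrow> A = mat 1"
    using lattice_discrete_at_one[OF lat] by blast
  ultimately have "\<forall>\<^sub>F n in sequentially. dist (Z n) (mat 1) < e" by (intro tendstoD)
  then obtain n where n: "norm (Z n - mat 1) < e"
    unfolding dist_norm by (auto simp: eventually_sequentially)
  have "t = 1 \<or> t = -1" using t1 by (simp add: square_eq_1_iff)
  then have "Z n = Y n \<or> Z n = - Y n" by (auto simp: Z_def)
  then have "det (Z n) = 1" "psl2_proj (Z n) = psl2_proj (Y n)"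
    using Y[of n] by (auto simp: det_uminus_2 psl2_proj_inj_iff)
  then have "Z n = mat 1" using e(2) n Y[of n] by simp
  then have "M$1$2 = 0 \<and> M$2$1 = 0 \<and> M$1$1 = M$2$2"
    using c(3) t1 unfolding Z_def Y_def
    by (simp add: matrix_2_eq_iff mat_2_entries) (auto simp: algebra_simps)
  then show False using M(3) by (simp add: matrix_2_eq_iff mat_2_entries)
qed

lemma trace_conj_2:
  assumes "det G = 1"
  shows "(G ** M ** adj G) $ 1 $ 1 + (G ** M ** adj G) $ 2 $ 2 = M $ 1 $ 1 + M $ 2 $ 2"
proof -
  have "(G ** M ** adj G) $ 1 $ 1 + (G ** M ** adj G) $ 2 $ 2 = det G * (M $ 1 $ 1 + M $ 2 $ 2)"
    by (simp add: matrix_2_mult_nth det_2 algebra_simps)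
  then show ?thesis by (simp add: assms)
qed

text \<open>If all conjugates of \<open>M\<close> lie in the span of \<open>M\<close> and the identity, then each of them is \<open>M\<close> or its
  inverse: comparing traces, conjugation multiplies the traceless part of \<open>M\<close> by a number \<open>s\<close>, and
  neither \<open>|s| < 1\<close> nor \<open>|1 / s| < 1\<close> is possible. Thus the overlap of \<open>z\<close> and \<open>\<kappa> z\<close> is invariant under the lattice, \<open>\<kappa>\<close>
  being the class of \<open>M\<close>, and rigidity applies to the pair consisting of the identity and \<open>\<kappa>\<close>.\<close>

lemma lattice_commuting_conjugates:
  assumes lat: "lattice_PSL2R \<Gamma>"
    and M: "det M = 1" "psl2_proj M \<in> \<Gamma>" "M \<noteq> mat (M$1$1)"
    and comm: "\<And>G. det G = 1 \<Longrightarrow> psl2_proj G \<in> \<Gamma> \<Longrightarrow> \<exists>s u. G ** M ** adj G = s *\<^sub>R M + mat u"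
  shows False
proof -
  define t where "t = (M$1$1 + M$2$2) / 2"
  have t2: "2 * t = M$1$1 + M$2$2" by (simp add: t_def)
  note sub = lattice_subgroup[OF lat]
  have adjG: "psl2_proj (adj G) \<in> \<Gamma>" if "det G = 1" "psl2_proj G \<in> \<Gamma>" for G
    using subgroup.m_inv_closed[OF sub that(2)] psl2_proj_inv[OF that(1)] by simp
  have form: "\<exists>s. s \<noteq> 0 \<and> G ** M ** adj G = s *\<^sub>R M + mat ((1 - s) * t)"
    if G: "det G = 1" "psl2_proj G \<in> \<Gamma>" for G
  proof -
    obtain s u where su: "G ** M ** adj G = s *\<^sub>R M + mat u" using comm[OF G] by blast
    have "s * (2 * t) + 2 * u = 2 * t"
      using trace_conj_2[OF G(1), of M] unfolding su t2 by (simp add: mat_2_entries algebra_simps)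
    then have u: "u = (1 - s) * t" by (simp add: algebra_simps)
    have "s \<noteq> 0"
    proof
      assume "s = 0"
      then have "adj G ** (G ** M ** adj G) ** G = adj G ** mat u ** G" by (simp add: su)
      moreover have "adj G ** mat u ** G = mat u"
        using conj_affine[of "adj G" 0 0 u] G(1) adj_mult[OF G(1)]
        by (simp add: matrix_2_eq_iff matrix_2_mult_nth mat_2_entries det_2 algebra_simps)
      moreover have "adj G ** (G ** M ** adj G) ** G = M"
        using G(1) by (simp add: matrix_mul_assoc[symmetric] adj_cancel adj_mult)
      ultimately have "M = mat u" by simp
      then show False using M(3) by (simp add: mat_2_entries)
    qed
    with su u show ?thesis by blast
  qed
  have pm: "G ** M ** adj G = M \<or> G ** M ** adj G = adj M" if G: "det G = 1" "psl2_proj G \<in> \<Gamma>" for G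
  proof -
    obtain s where s: "s \<noteq> 0" "G ** M ** adj G = s *\<^sub>R M + mat ((1 - s) * t)" using form[OF G] by blast
    have back': "adj G ** M ** adj (adj G) = (1 / s) *\<^sub>R M + mat ((1 - 1 / s) * t)"
    proof -
      have adj2: "adj (adj G) = G" by (simp add: matrix_2_eq_iff)
      have "M = adj G ** (G ** M ** adj G) ** G"
        using G(1) by (simp add: matrix_mul_assoc[symmetric] adj_cancel adj_mult)
      also have "\<dots> = s *\<^sub>R (adj G ** M ** adj (adj G)) + mat ((1 - s) * t)"
        unfolding s(2) using conj_affine[of "adj G" s M] G(1) by (simp add: det_adj adj2)
      finally have "M = s *\<^sub>R (adj G ** M ** adj (adj G)) + mat ((1 - s) * t)" .
      then have "M $ i $ j = s * (adj G ** M ** adj (adj G)) $ i $ j + mat ((1 - s) * t) $ i $ j" for i j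
        by (metis vector_add_component vector_scaleR_component real_scaleR_def)
      then have "(adj G ** M ** adj (adj G)) $ i $ j = (M $ i $ j - mat ((1 - s) * t) $ i $ j) / s" for i j
        using s(1) by (simp add: field_simps)
      then show ?thesis using s(1)
        by (simp add: matrix_2_eq_iff mat_2_entries) (simp add: field_simps)
    qed
    have "\<not> \<bar>s\<bar> < 1" using lattice_no_contraction[OF lat M G s(2)] s(1) by blast
    moreover have "\<not> \<bar>1 / s\<bar> < 1"
      using lattice_no_contraction[OF lat M _ adjG[OF G] back'] s(1) G(1) by (auto simp: det_adj)
    ultimately have "\<bar>s\<bar> = 1" using s(1) by (simp add: field_simps)
    then have "s = 1 \<or> s = -1" by linarith
    then show ?thesis
      unfolding s(2) using t2 by (elim disjE) (simp_all add: matrix_2_eq_iff mat_2_entries)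
  qed
  define \<kappa> where "\<kappa> = psl2_proj M"
  have \<kappa>: "\<kappa> \<in> carrier PSL2R" using M(1) by (simp add: \<kappa>_def psl2_proj_carrier)
  have up: "sl2_act B z \<in> \<H>" if "det B = 1" "z \<in> \<H>" for B z
    using sl2_act_upper that by (simp add: upper_half_plane_iff)
  have mult: "sl2_act (B ** C) z = sl2_act B (sl2_act C z)"
    if "det B = 1" "det C = 1" "z \<in> \<H>" for B C z
    using sl2_act_mult that by (simp add: upper_half_plane_iff)
  have ov: "overlap (sl2_act B z) (sl2_act B w) = overlap z w"
    if "det B = 1" "z \<in> \<H>" "w \<in> \<H>" for B z w
    using overlap_psl2_act[OF psl2_proj_carrier that(2,3)] that by (simp add: psl2_act_proj)
  have inv: "overlap (psl2_act \<gamma> z) (psl2_act \<kappa> (psl2_act \<gamma> z)) = overlap z (psl2_act \<kappa> z)"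
    if \<gamma>: "\<gamma> \<in> \<Gamma>" and z: "z \<in> \<H>" for \<gamma> z
  proof -
    obtain G where G: "det G = 1" "\<gamma> = psl2_proj G"
      using PSL2R_representative[OF subgroup.mem_carrier[OF sub \<gamma>]] by blast
    define M' where "M' = adj G ** M ** G"
    have M'1: "det M' = 1" using G(1) M(1) by (simp add: M'_def det_mul det_adj)
    have "adj (adj G) = G" by (simp add: matrix_2_eq_iff)
    then have M': "M' = M \<or> M' = adj M"
      using pm[of "adj G"] adjG[of G] G \<gamma> by (simp add: M'_def det_adj)
    have "G ** M' = M ** G" using G(1) by (simp add: M'_def matrix_mul_assoc[symmetric] adj_cancel)
    then have "sl2_act M (sl2_act G z) = sl2_act G (sl2_act M' z)"
      using mult[OF M(1) G(1) z] mult[OF G(1) M'1 z] by simp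
    then have "overlap (sl2_act G z) (sl2_act M (sl2_act G z)) = overlap z (sl2_act M' z)"
      using ov[OF G(1) z up[OF M'1 z]] by simp
    also have "\<dots> = overlap z (sl2_act M z)"
    proof (cases "M' = M")
      case False
      then have "M' = adj M" using M' by simp
      then have "overlap z (sl2_act M' z) = overlap (sl2_act M z) (sl2_act M (sl2_act (adj M) z))"
        using ov[OF M(1) z up[OF _ z], of "adj M"] M(1) by (simp add: det_adj)
      also have "sl2_act M (sl2_act (adj M) z) = z"
        using mult[OF M(1) _ z, of "adj M"] M(1) by (simp add: det_adj adj_mult sl2_act_one)
      finally show ?thesis by (simp add: overlap_commute)
    qed simp
    finally show ?thesis by (simp add: G(2) \<kappa>_def psl2_act_proj)
  qed
  have pts: "\<i> \<in> \<H>" "2 * \<i> \<in> \<H>" by (simp_all add: upper_half_plane_iff)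
  have nc: "\<not> (\<lambda>z. z) constant_on \<H>"
  proof
    assume "(\<lambda>z. z) constant_on \<H>"
    then obtain c where c: "\<And>z. z \<in> \<H> \<Longrightarrow> z = c" unfolding constant_on_def by blast
    from c[OF pts(1)] c[OF pts(2)] show False by simp
  qed
  have fixed: "z = psl2_act \<kappa> z" if z: "z \<in> \<H>" for z
    by (rule overlap_rigidity[OF lat _ _ psl2_act_holomorphic[OF \<kappa>] _ inv nc z])
      (use psl2_act_upper[OF \<kappa>] in \<open>auto intro: holomorphic_intros\<close>)
  have "\<kappa> = \<one>\<^bsub>PSL2R\<^esub>"
    using psl2_act_two_fixed_points[OF \<kappa> pts] fixed[OF pts(1)] fixed[OF pts(2)] by simp
  then have "M = mat 1 \<or> M = - mat 1"
    using psl2_proj_inj_iff[of M "mat 1"] by (simp add: \<kappa>_def psl2_proj_one)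
  then show False using M(3) by (auto simp: matrix_2_eq_iff mat_2_entries)
qed

context nonconstant_modular_embedding
begin

text \<open>A sequence \<open>A\<^sub>n\<close> of exceptions tending to the identity would eventually commute with any given
  kernel element, in particular with \<open>M\<close> and with any given conjugate of it. As \<open>A\<^sub>n\<close> is not scalar,
  that conjugate lies in the span of \<open>M\<close> and the identity.\<close>

theorem Comm_snd_discrete:
  assumes ker: "\<kappa> \<in> \<Gamma>" "\<rho> \<kappa> = \<one>\<^bsub>PSL2R\<^esub>" "\<kappa> \<noteq> \<one>\<^bsub>PSL2R\<^esub>"
  obtains e where "e > 0"
    "\<And>A. det A = 1 \<Longrightarrow> psl2_proj A \<in> snd ` carrier (Comm (p, \<rho>, \<Gamma>)) \<Longrightarrow> norm (A - mat 1) < e \<Longrightarrow> A = mat 1"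
proof (rule ccontr)
  assume no: "\<not> thesis"
  have "\<exists>A. det A = 1 \<and> psl2_proj A \<in> snd ` carrier (Comm (p, \<rho>, \<Gamma>)) \<and>
      norm (A - mat 1) < inverse (real (Suc n)) \<and> A \<noteq> mat 1" for n
  proof (rule ccontr)
    assume "\<not> ?thesis"
    then have "thesis" by (intro that[of "inverse (real (Suc n))"]) auto
    then show False using no by blast
  qed
  then obtain A where A: "\<And>n. det (A n) = 1" "\<And>n. psl2_proj (A n) \<in> snd ` carrier (Comm (p, \<rho>, \<Gamma>))"
    and small: "\<And>n. norm (A n - mat 1) < inverse (real (Suc n))" and ne: "\<And>n. A n \<noteq> mat 1"
    by metis
  have "(\<lambda>n. A n - mat 1) \<longlonglongrightarrow> 0"
    by (rule Lim_null_comparison[OF _ LIMSEQ_inverse_real_of_nat])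
      (intro always_eventually allI less_imp_le small)
  then have lim: "A \<longlonglongrightarrow> mat 1" by (simp add: LIM_zero_iff)
  have nonscalar: "A n \<noteq> mat (A n $ 1 $ 1)" for n
  proof
    assume "A n = mat (A n $ 1 $ 1)"
    from scalar_det_1[OF A(1) this] have "A n = - mat 1" using ne by blast
    moreover have "norm (A n - mat 1) < 1"
      by (rule less_le_trans[OF small]) (simp add: field_simps)
    ultimately show False using near_one_not_minus_one by blast
  qed
  obtain M where M: "det M = 1" "\<kappa> = psl2_proj M"
    by (rule PSL2R_representative[OF Gamma_carrier[OF ker(1)]])
  have Mns: "M \<noteq> mat (M$1$1)"
  proof
    assume "M = mat (M$1$1)"
    from scalar_det_1[OF M(1) this] have "psl2_proj M = psl2_proj (mat 1)" by (simp add: psl2_proj_inj_iff)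
    then show False using ker(3) by (simp add: M(2) psl2_proj_one)
  qed
  have "\<exists>s u. G ** M ** adj G = s *\<^sub>R M + mat u" if G: "det G = 1" "psl2_proj G \<in> \<Gamma>" for G
  proof -
    let ?M = "G ** M ** adj G" and ?g = "psl2_proj G"
    have eq: "psl2_proj ?M = ?g \<star> \<kappa> \<star> inv\<^bsub>PSL2R\<^esub> ?g"
      using G(1) M by (simp add: psl2_proj_mult psl2_proj_inv det_mul det_adj)
    have gi: "inv\<^bsub>PSL2R\<^esub> ?g \<in> \<Gamma>" by (rule subgroup.m_inv_closed[OF Gamma_subgroup G(2)])
    have gk: "?g \<star> \<kappa> \<in> \<Gamma>" by (rule subgroup.m_closed[OF Gamma_subgroup G(2) ker(1)])
    have mem: "psl2_proj ?M \<in> \<Gamma>"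
      unfolding eq by (rule subgroup.m_closed[OF Gamma_subgroup gk gi])
    have "\<rho> (psl2_proj ?M) = \<rho> ?g \<star> \<rho> (inv\<^bsub>PSL2R\<^esub> ?g)"
      unfolding eq using rho_carrier[OF G(2)] rho_carrier[OF gi]
      by (simp add: rho_mult gk gi G(2) ker)
    also have "\<dots> = \<rho> \<one>\<^bsub>PSL2R\<^esub>"
      using rho_mult[OF G(2) gi] Gamma_carrier[OF G(2)] by simp
    also have "\<dots> = \<one>\<^bsub>PSL2R\<^esub>"
      using rho_mult[OF ker(1) subgroup.one_closed[OF Gamma_subgroup]] ker Gamma_carrier[OF ker(1)]
        rho_carrier[OF subgroup.one_closed[OF Gamma_subgroup]] by simp
    finally have triv: "\<rho> (psl2_proj ?M) = \<one>\<^bsub>PSL2R\<^esub>" .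
    have "\<forall>\<^sub>F n in sequentially. A n ** M = M ** A n"
      using eventually_commute[OF A lim M(1)] ker M(2) by simp
    moreover have "\<forall>\<^sub>F n in sequentially. A n ** ?M = ?M ** A n"
      by (rule eventually_commute[OF A lim _ mem triv]) (simp add: det_mul det_adj G M)
    ultimately have "\<forall>\<^sub>F n in sequentially. A n ** M = M ** A n \<and> A n ** ?M = ?M ** A n"
      by (rule eventually_conj)
    then obtain n where n: "A n ** M = M ** A n" "A n ** ?M = ?M ** A n"
      by (auto simp: eventually_sequentially)
    obtain s t where st: "?M = s *\<^sub>R A n + mat t" by (rule commute_2_span[OF nonscalar n(2)])
    obtain s' t' where st': "M = s' *\<^sub>R A n + mat t'" by (rule commute_2_span[OF nonscalar n(1)])
    have "s' \<noteq> 0"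
    proof
      assume "s' = 0"
      then have "M = mat t'" using st' by simp
      then show False using Mns by (simp add: mat_2_entries)
    qed
    then have "s *\<^sub>R A n + mat t = (s / s') *\<^sub>R (s' *\<^sub>R A n + mat t') + mat (t - s / s' * t')"
      by (simp add: matrix_2_eq_iff mat_2_entries algebra_simps)
    then have "?M = (s / s') *\<^sub>R M + mat (t - s / s' * t')"
      by (simp only: st flip: st')
    then show ?thesis by blast
  qed
  then show False
    using lattice_commuting_conjugates[OF lattice M(1) _ Mns] ker(1) M(2) by blast
qed

end


section \<open>Finite index\<close>

lemma continuous_on_quotient_2: "continuous_on UNIV (\<lambda>q :: (real^2^2) \<times> (real^2^2). fst q ** adj (snd q))"
  unfolding continuous_on_def by (intro ballI tendsto_matrix_mult_2 tendsto_adj tendsto_intros)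

lemma small_neighbourhood_of_one:
  assumes "e > 0"
  obtains U where "openin PSL2R_topology U" "\<one>\<^bsub>PSL2R\<^esub> \<in> U"
    "\<And>x y. x \<in> U \<Longrightarrow> y \<in> U \<Longrightarrow>
       \<exists>A. det A = 1 \<and> psl2_proj A = x \<star> inv\<^bsub>PSL2R\<^esub> y \<and> norm (A - mat 1) < e"
proof -
  define W where "W = {q :: (real^2^2) \<times> (real^2^2). norm (fst q ** adj (snd q) - mat 1) < e}"
  have "open W"
    unfolding W_def by (intro open_Collect_less continuous_on_norm continuous_on_diff
        continuous_on_quotient_2 continuous_on_const)
  moreover have "(mat 1, mat 1) \<in> W"
    using assms adj_mult(2)[of "mat 1"] by (simp add: W_def)
  ultimately obtain V V' where V: "open V" "open V'" "(mat 1, mat 1) \<in> V \<times> V'" "V \<times> V' \<subseteq> W"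
    by (rule open_prod_elim)
  define S where "S = carrier SL2R \<inter> (V \<inter> V')"
  have S: "openin (top_of_set (carrier SL2R)) S"
    unfolding S_def using V(1,2) by (intro openin_open_Int open_Int)
  show ?thesis
  proof (rule that[of "psl2_proj ` S"])
    show "openin PSL2R_topology (psl2_proj ` S)"
      using open_map_psl2_proj S unfolding open_map_def by blast
    show "\<one>\<^bsub>PSL2R\<^esub> \<in> psl2_proj ` S"
      using V(3) by (auto simp: S_def carrier_SL2R simp flip: psl2_proj_one)
    fix x y assume "x \<in> psl2_proj ` S" "y \<in> psl2_proj ` S"
    then obtain A B where AB: "x = psl2_proj A" "y = psl2_proj B" "det A = 1" "det B = 1" "A \<in> V" "B \<in> V'"
      by (auto simp: S_def carrier_SL2R)
    then have "(A, B) \<in> W" using V(4) by blast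
    then show "\<exists>A. det A = 1 \<and> psl2_proj A = x \<star> inv\<^bsub>PSL2R\<^esub> y \<and> norm (A - mat 1) < e"
      using AB by (intro exI[of _ "A ** adj B"])
        (simp add: W_def det_mul det_adj psl2_proj_mult psl2_proj_inv)
  qed
qed

context haar_lattice
begin

text \<open>Translates of \<open>U\<close> whose images in the quotient by \<open>\<Gamma>\<close> are injective and pairwise disjoint:
  folded into the fundamental domain they occupy disjoint sets of the same measure.\<close>

lemma card_disjoint_translates:
  assumes U: "U \<in> sets \<mu>" and B: "finite B" and h: "\<And>b. b \<in> B \<Longrightarrow> h b \<in> carrier PSL2R"
    and disj: "\<And>b b' \<gamma> \<gamma>' x. b \<in> B \<Longrightarrow> b' \<in> B \<Longrightarrow> \<gamma> \<in> \<Gamma> \<Longrightarrow> \<gamma>' \<in> \<Gamma> \<Longrightarrow> x \<in> F \<Longrightarrow>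
      \<gamma> \<star> x \<in> h b <#\<^bsub>PSL2R\<^esub> U \<Longrightarrow> \<gamma>' \<star> x \<in> h b' <#\<^bsub>PSL2R\<^esub> U \<Longrightarrow> b = b' \<and> \<gamma> = \<gamma>'"
  shows "of_nat (card B) * emeasure \<mu> U \<le> emeasure \<mu> F"
proof -
  define S where "S b = F \<inter> (\<Union>\<gamma>\<in>\<Gamma>. (\<lambda>x. \<gamma> \<star> x) -` (h b <#\<^bsub>PSL2R\<^esub> U) \<inter> space \<mu>)" for b
  have tr: "h b <#\<^bsub>PSL2R\<^esub> U \<in> sets \<mu>" if "b \<in> B" for b by (rule l_coset_measurable[OF h[OF that] U])
  have S: "S b \<in> sets \<mu>" if "b \<in> B" for b
    unfolding S_def
    by (intro sets.Int F_measurable sets.countable_UN' countable image_subsetI measurable_sets[OF left_mult_measurable] carrierI tr that)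
  have SI: "x \<in> S b \<longleftrightarrow> x \<in> F \<and> (\<exists>\<gamma>\<in>\<Gamma>. \<gamma> \<star> x \<in> h b <#\<^bsub>PSL2R\<^esub> U)" for x b
    using F_carrier by (auto simp: S_def)
  have "emeasure \<mu> (S b) = emeasure \<mu> U" if b: "b \<in> B" for b
  proof -
    have count: "(\<integral>\<^sup>+\<gamma>. indicator (h b <#\<^bsub>PSL2R\<^esub> U) (\<gamma> \<star> x) \<partial>count_space \<Gamma>) = (indicator (S b) x :: ennreal)"
      if x: "x \<in> F" for x
    proof (cases "x \<in> S b")
      case True
      then obtain \<gamma> where \<gamma>: "\<gamma> \<in> \<Gamma>" "\<gamma> \<star> x \<in> h b <#\<^bsub>PSL2R\<^esub> U" unfolding SI by blast
      have "\<delta> \<star> x \<in> h b <#\<^bsub>PSL2R\<^esub> U \<longleftrightarrow> \<delta> = \<gamma>" if "\<delta> \<in> \<Gamma>" for \<delta>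
        using disj[OF b b that \<gamma>(1) x _ \<gamma>(2)] \<gamma>(2) by blast
      then have "(\<integral>\<^sup>+\<gamma>. indicator (h b <#\<^bsub>PSL2R\<^esub> U) (\<gamma> \<star> x) \<partial>count_space \<Gamma>)
          = (\<integral>\<^sup>+\<delta>. indicator {\<gamma>} \<delta> \<partial>count_space \<Gamma>)"
        by (intro nn_integral_cong) (simp add: indicator_def)
      then show ?thesis using True \<gamma>(1) by simp
    next
      case False
      then have "(\<integral>\<^sup>+\<gamma>. indicator (h b <#\<^bsub>PSL2R\<^esub> U) (\<gamma> \<star> x) \<partial>count_space \<Gamma>)
          = (\<integral>\<^sup>+\<gamma>. 0 \<partial>count_space \<Gamma>)"
        using x by (intro nn_integral_cong) (auto simp: SI)
      then show ?thesis using False by simp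
    qed
    have "emeasure \<mu> U = (\<integral>\<^sup>+x. indicator (h b <#\<^bsub>PSL2R\<^esub> U) x \<partial>\<mu>)"
      using emeasure_l_coset[OF h[OF b] U] tr[OF b] by simp
    also have "\<dots> = (\<integral>\<^sup>+\<gamma>. \<integral>\<^sup>+x. indicator (h b <#\<^bsub>PSL2R\<^esub> U) (\<gamma> \<star> x) \<partial>N \<partial>count_space \<Gamma>)"
      by (intro nn_integral_unfold borel_measurable_indicator tr b)
    also have "\<dots> = (\<integral>\<^sup>+x. \<integral>\<^sup>+\<gamma>. indicator (h b <#\<^bsub>PSL2R\<^esub> U) (\<gamma> \<star> x) \<partial>count_space \<Gamma> \<partial>N)"
      by (intro nn_integral_count_space_nn_integral[symmetric] countable measurable_restrict_space1
          measurable_compose[OF left_mult_measurable borel_measurable_indicator] carrierI tr b)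
    also have "\<dots> = (\<integral>\<^sup>+x. indicator (S b) x \<partial>N)"
      by (intro nn_integral_cong count) (simp add: space_N)
    also have "\<dots> = (\<integral>\<^sup>+x. indicator (S b) x \<partial>\<mu>)"
      unfolding nn_integral_N by (intro nn_integral_cong) (auto simp: S_def indicator_def)
    finally show ?thesis using S[OF b] by simp
  qed
  then have "of_nat (card B) * emeasure \<mu> U = (\<Sum>b\<in>B. emeasure \<mu> (S b))" by simp
  also have "\<dots> = emeasure \<mu> (\<Union>b\<in>B. S b)"
  proof (rule sum_emeasure)
    show "disjoint_family_on S B"
      unfolding disjoint_family_on_def
    proof (intro ballI impI)
      fix b b' assume b: "b \<in> B" "b' \<in> B" "b \<noteq> b'"
      have False if x: "x \<in> S b" "x \<in> S b'" for x
      proof -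
        from x obtain \<gamma> \<gamma>' where "x \<in> F" "\<gamma> \<in> \<Gamma>" "\<gamma>' \<in> \<Gamma>"
          "\<gamma> \<star> x \<in> h b <#\<^bsub>PSL2R\<^esub> U" "\<gamma>' \<star> x \<in> h b' <#\<^bsub>PSL2R\<^esub> U"
          unfolding SI by blast
        then show False using disj[OF b(1,2)] b(3) by blast
      qed
      then show "S b \<inter> S b' = {}" by blast
    qed
  qed (use S B in auto)
  also have "\<dots> \<le> emeasure \<mu> F"
    by (intro emeasure_mono F_measurable) (auto simp: S_def)
  finally show ?thesis .
qed

end

lemma ennreal_exceeded_by_multiple:
  fixes m u :: ennreal
  assumes "m < \<infinity>" "u \<noteq> 0"
  obtains n :: nat where "m < of_nat n * u"
proof (cases u)
  case (real r)
  then have r: "r > 0" using assms(2) by (cases "r = 0") auto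
  obtain m' where m': "m' \<ge> 0" "m = ennreal m'" using assms(1) by (cases m) auto
  obtain n :: nat where "m' < real n * r" using reals_Archimedean3[OF r] by blast
  then have "ennreal m' < ennreal (real n * r)" using m'(1) by (simp add: ennreal_less_iff)
  also have "\<dots> = of_nat n * u" using r real by (simp add: ennreal_mult ennreal_of_nat_eq_real_of_nat)
  finally show ?thesis using that m' by simp
next
  case top
  then show ?thesis using that[of 1] assms(1) by simp
qed

theorem proposition5p16:
  fixes p :: "complex \<Rightarrow> complex" and \<rho> :: "psl2 \<Rightarrow> psl2" and \<Gamma> :: "psl2 set"
  assumes "modular_embedding (p, \<rho>, \<Gamma>)"
    and "\<not> p constant_on upper_half_plane"
    and "kernel (PSL2R\<lparr>carrier := \<Gamma>\<rparr>) PSL2R \<rho> \<noteq> {\<one>\<^bsub>PSL2R\<^esub>}"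
  shows "finite_index_subgroup ((\<lambda>\<gamma>. (\<rho> \<gamma>, \<gamma>)) ` \<Gamma>) (Comm (p, \<rho>, \<Gamma>))"
proof -
  interpret nonconstant_modular_embedding p \<rho> \<Gamma> by unfold_locales (fact assms)+
  let ?C = "Comm (p, \<rho>, \<Gamma>)" and ?H = "(\<lambda>\<gamma>. (\<rho> \<gamma>, \<gamma>)) ` \<Gamma>"
  interpret C: group ?C by (rule Comm_group)
  have one: "\<one>\<^bsub>PSL2R\<^esub> \<in> \<Gamma>" by (rule subgroup.one_closed[OF Gamma_subgroup])
  have "\<rho> \<one>\<^bsub>PSL2R\<^esub> \<star> \<rho> \<one>\<^bsub>PSL2R\<^esub> = \<rho> \<one>\<^bsub>PSL2R\<^esub>" using rho_mult[OF one one] by simp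
  then have "\<rho> \<one>\<^bsub>PSL2R\<^esub> = \<one>\<^bsub>PSL2R\<^esub>" using rho_carrier[OF one] by simp
  then obtain \<kappa> where \<kappa>: "\<kappa> \<in> \<Gamma>" "\<rho> \<kappa> = \<one>\<^bsub>PSL2R\<^esub>" "\<kappa> \<noteq> \<one>\<^bsub>PSL2R\<^esub>"
    using assms(3) one by (auto simp: kernel_def)
  obtain e where e: "e > 0"
    "\<And>A. det A = 1 \<Longrightarrow> psl2_proj A \<in> snd ` carrier ?C \<Longrightarrow> norm (A - mat 1) < e \<Longrightarrow> A = mat 1"
    using Comm_snd_discrete[OF \<kappa>] by blast
  obtain U where U: "openin PSL2R_topology U" "\<one>\<^bsub>PSL2R\<^esub> \<in> U"
    and near: "\<And>x y. x \<in> U \<Longrightarrow> y \<in> U \<Longrightarrow>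
      \<exists>A. det A = 1 \<and> psl2_proj A = x \<star> inv\<^bsub>PSL2R\<^esub> y \<and> norm (A - mat 1) < e"
    using small_neighbourhood_of_one[OF e(1)] by blast
  have Uc: "u \<in> carrier PSL2R" if "u \<in> U" for u
    using that U(1) by (auto simp: openin_PSL2R_topology)
  have "snd \<in> hom ?C PSL2R"
    by (rule homI) (auto simp: Comm_mult Comm_iff)
  then have snd_sub: "subgroup (snd ` carrier ?C) PSL2R"
    by (intro group_hom.img_is_subgroup group_hom.intro group_hom_axioms.intro Comm_group group_PSL2R)
  have Gamma_snd: "\<gamma> \<in> snd ` carrier ?C" if "\<gamma> \<in> \<Gamma>" for \<gamma>
    using imageI[OF Gamma_Comm[OF that], of snd] by simp
  define r where "r D = (SOME a. a \<in> carrier ?C \<and> D = ?H #>\<^bsub>?C\<^esub> a)" for D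
  have r: "r D \<in> carrier ?C \<and> D = ?H #>\<^bsub>?C\<^esub> r D" if D: "D \<in> rcosets\<^bsub>?C\<^esub> ?H" for D
  proof -
    have "\<exists>a. a \<in> carrier ?C \<and> D = ?H #>\<^bsub>?C\<^esub> a" using D unfolding RCOSETS_def by blast
    then show ?thesis unfolding r_def by (rule someI_ex)
  qed
  define h where "h D = snd (r D)" for D
  have h_snd: "h D \<in> snd ` carrier ?C" if "D \<in> rcosets\<^bsub>?C\<^esub> ?H" for D
    unfolding h_def using r[OF that] by blast
  have h: "h D \<in> carrier PSL2R" if "D \<in> rcosets\<^bsub>?C\<^esub> ?H" for D
    by (rule subgroup.mem_carrier[OF snd_sub h_snd[OF that]])
  have coset: "D = D'"
    if D: "D \<in> rcosets\<^bsub>?C\<^esub> ?H" "D' \<in> rcosets\<^bsub>?C\<^esub> ?H" and \<delta>: "\<delta> \<in> \<Gamma>" "h D' = \<delta> \<star> h D" for D D' \<delta>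
  proof -
    note c = r[OF D(1)] r[OF D(2)]
    have "(\<rho> \<delta>, \<delta>) \<otimes>\<^bsub>?C\<^esub> r D \<in> carrier ?C" using Gamma_Comm[OF \<delta>(1)] c by simp
    moreover have "(\<rho> \<delta>, \<delta>) \<otimes>\<^bsub>?C\<^esub> r D = (\<rho> \<delta> \<star> fst (r D), h D')"
      using Comm_mult[of "\<rho> \<delta>" \<delta> "fst (r D)" "snd (r D)"] \<delta>(2) by (simp add: h_def)
    moreover have "(fst (r D'), h D') \<in> carrier ?C" using c by (simp add: h_def)
    ultimately have "r D' = (\<rho> \<delta>, \<delta>) \<otimes>\<^bsub>?C\<^esub> r D"
      using Comm_snd_injective[of "\<rho> \<delta> \<star> fst (r D)" "h D'" "fst (r D')"]
      by (simp add: h_def prod_eq_iff)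
    then have "r D' \<in> ?H #>\<^bsub>?C\<^esub> r D" using \<delta>(1) unfolding r_coset_def by blast
    then have "?H #>\<^bsub>?C\<^esub> r D = ?H #>\<^bsub>?C\<^esub> r D'"
      by (rule C.repr_independence) (use c Gamma_image_subgroup in auto)
    then show "D = D'" using c by simp
  qed
  obtain \<mu> F where "haar_lattice \<mu> \<Gamma> F" by (rule lattice_haar_lattice[OF lattice])
  then interpret haar_lattice \<mu> \<Gamma> F .
  have UM: "U \<in> sets \<mu>" by (rule open_measurable[OF U(1)])
  have "emeasure \<mu> U \<noteq> 0" using open_nonnull[OF U(1)] U(2) by blast
  then obtain n :: nat where n: "emeasure \<mu> F < of_nat n * emeasure \<mu> U"
    using ennreal_exceeded_by_multiple[OF F_finite] by blast
  \<comment> \<open>if the translates of \<open>U\<close> by two representatives meet modulo \<open>\<Gamma>\<close>, the quotient \<open>u' u\<^sup>-\<^sup>1\<close> of two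
    elements of \<open>U\<close> lies in the discrete group \<open>snd ` carrier ?C\<close> and is therefore trivial\<close>
  have bound: "card B \<le> n" if B: "B \<subseteq> rcosets\<^bsub>?C\<^esub> ?H" "finite B" for B
  proof -
    have "of_nat (card B) * emeasure \<mu> U \<le> emeasure \<mu> F"
    proof (rule card_disjoint_translates[OF UM B(2), of h])
      show "h D \<in> carrier PSL2R" if "D \<in> B" for D using h B(1) that by blast
      fix D D' \<gamma> \<gamma>' x
      assume DB: "D \<in> B" "D' \<in> B" and \<gamma>: "\<gamma> \<in> \<Gamma>" "\<gamma>' \<in> \<Gamma>" and x: "x \<in> F"
        and mem: "\<gamma> \<star> x \<in> h D <#\<^bsub>PSL2R\<^esub> U" "\<gamma>' \<star> x \<in> h D' <#\<^bsub>PSL2R\<^esub> U"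
      have D: "D \<in> rcosets\<^bsub>?C\<^esub> ?H" "D' \<in> rcosets\<^bsub>?C\<^esub> ?H" using DB B(1) by auto
      obtain u u' where u: "u \<in> U" "\<gamma> \<star> x = h D \<star> u"
        "u' \<in> U" "\<gamma>' \<star> x = h D' \<star> u'"
        using mem by (auto simp: l_coset_def)
      define \<delta> where "\<delta> = \<gamma>' \<star> inv\<^bsub>PSL2R\<^esub> \<gamma>"
      have \<delta>: "\<delta> \<in> \<Gamma>"
        unfolding \<delta>_def by (intro subgroup.m_closed[OF Gamma_subgroup] subgroup.m_inv_closed[OF Gamma_subgroup] \<gamma>)
      note c = h[OF D(1)] h[OF D(2)] Uc[OF u(1)] Uc[OF u(3)] F_carrier[OF x]
        Gamma_carrier[OF \<gamma>(1)] Gamma_carrier[OF \<gamma>(2)] Gamma_carrier[OF \<delta>]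
      have "\<delta> \<star> (\<gamma> \<star> x) = \<gamma>' \<star> x"
        using c by (simp add: \<delta>_def PSL2R.m_assoc PSL2R_cancel)
      then have eq: "\<delta> \<star> h D \<star> u = h D' \<star> u'"
        using c by (simp add: u PSL2R.m_assoc)
      have quot: "u' \<star> inv\<^bsub>PSL2R\<^esub> u = inv\<^bsub>PSL2R\<^esub> (h D') \<star> (\<delta> \<star> h D)"
      proof -
        have "u' = inv\<^bsub>PSL2R\<^esub> (h D') \<star> (\<delta> \<star> h D \<star> u)"
          unfolding eq using c by (simp add: PSL2R_cancel)
        then show ?thesis using c by (simp add: PSL2R.m_assoc)
      qed
      have "u' \<star> inv\<^bsub>PSL2R\<^esub> u \<in> snd ` carrier ?C"
        unfolding quot
        by (intro subgroup.m_closed[OF snd_sub] subgroup.m_inv_closed[OF snd_sub] h_snd D Gamma_snd \<delta>)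
      moreover obtain A where A: "det A = 1" "psl2_proj A = u' \<star> inv\<^bsub>PSL2R\<^esub> u" "norm (A - mat 1) < e"
        using near[OF u(3,1)] by blast
      ultimately have "A = mat 1" using e(2) by simp
      then have "inv\<^bsub>PSL2R\<^esub> (h D') \<star> (\<delta> \<star> h D) = \<one>\<^bsub>PSL2R\<^esub>"
        using A(2) quot by (simp add: psl2_proj_one)
      then have "h D' \<star> (inv\<^bsub>PSL2R\<^esub> (h D') \<star> (\<delta> \<star> h D)) = h D'" using c by simp
      then have h\<delta>: "h D' = \<delta> \<star> h D" using c by (simp add: PSL2R_cancel)
      have "D = D'" by (rule coset[OF D \<delta> h\<delta>])
      then have "\<delta> = \<one>\<^bsub>PSL2R\<^esub>" using h\<delta> c by simp
      then have "\<gamma>' = \<gamma>"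
        using PSL2R.inv_solve_right[of "\<one>\<^bsub>PSL2R\<^esub>" \<gamma>' \<gamma>] c by (simp add: \<delta>_def)
      with \<open>D = D'\<close> show "D = D' \<and> \<gamma> = \<gamma>'" by simp
    qed
    show "card B \<le> n"
    proof (rule ccontr)
      assume "\<not> card B \<le> n"
      then have "of_nat n * emeasure \<mu> U \<le> of_nat (card B) * emeasure \<mu> U"
        by (intro mult_right_mono) simp_all
      also have "\<dots> \<le> emeasure \<mu> F" by fact
      finally show False using n by simp
    qed
  qed
  have "finite (rcosets\<^bsub>?C\<^esub> ?H)"
    using finite_if_finite_subsets_card_bdd[of "rcosets\<^bsub>?C\<^esub> ?H" n] bound by blast
  then show ?thesis
    unfolding finite_index_subgroup_def using Comm_group Gamma_image_subgroup by blast
qed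

end
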